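(* For all integers $n\ge 3$ and $1\le m\le n-2$ there are finite sets $A'_{n,m}$ consisting of cycles (classes) in $H_{1}\big(\mathrm{cell}(n,2);\mathbb{Q}\big)$ such that, for all such $n$ and $m$: (1) the elements of $A'_{n,m}$ are linearly independent and $|A'_{n,m}|=|A_{n,m}|$; (2) the $\mathbb{Q}$-span of $B_{n,0}\cup\bigcup_{1\le l\le m}\big(A'_{n,l}\cup B_{n,l}\big)$ in $H_{1}\big(\mathrm{cell}(n,2);\mathbb{Q}\big)$ equals the $\mathbb{Q}$-span of $B_{n,0}\cup\bigcup_{1\le l\le m}\big(A_{n,l}\cup B_{n,l}\big)$; (3) the $\mathbb{Q}$-span of $A'_{n,m}$ is the degree $n$ term of the $\mathrm{FI}_{1}$-submodule of $H_{1}\big(\mathrm{cell}(\bullet, 2);\mathbb{Q}\big)$ generated by the $\mathbb{Q}$-span of $A'_{m+2,m}$ and the high-insertion map $[\iota_{1}]$, and this $\mathrm{FI}_{1}$-submodule is free; (4) as a representation of $S_{m+2}$ the $\mathbb{Q}$-span of $A'_{m+2, m}$ is isomorphic to $\bigwedge^{2}\mathrm{Std}_{m+2}$, where $\mathrm{Std}_{m+2}$ is the standard $S_{m+2}$-representation, and this span is a subrepresentation of the degree $m+2$ term of the $\mathrm{FI}_{1}$-submodule of $H_{1}\big(\mathrm{cell}(\bullet, 2);\mathbb{Q}\big)$ generated by the $\mathbb{Q}$-span of $A'_{3,1}$ and the high-insertion map $[\iota_{0}]$.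
   Context: Cells. A symbol on a finite set $S$ of positive integers (labels) is a sequence $\alpha_1|\cdots|\alpha_r$ of nonempty blocks, each a string of labels, with every element of $S$ occurring exactly once. $\mathrm{cell}(S)$ is the polyhedral cell complex with one cell of dimension $|S|-r$ for each symbol on $S$ with $r$ blocks; $f$ is a face of $g$ iff the symbol of $g$ is obtained from that of $f$ by deleting bars and shuffling the merged blocks (keeping the internal order of each original block). $\mathrm{cell}(S,2)$ is the subcomplex of cells all of whose blocks have at most $2$ elements; $\mathrm{cell}(n)=\mathrm{cell}([n])$, $\mathrm{cell}(n,2)=\mathrm{cell}([n],2)$, $[n]=\{1,\dots,n\}$. The boundary of a one-block cell $g$ is $\sum \pm\,\alpha|\beta$ over all ways to split $g$ into two complementary nonempty subwords $\alpha,\beta$, the sign being that of the permutation taking the word $g$ to the word $\alpha\beta$; and $\partial(g_1|g_2)=\partial g_1|g_2+(-1)^{b(g_1)}g_1|\partial g_2$ with $b$ the number of blocks. $S_n$ acts by permuting labels, so $H_k(\mathrm{cell}(n,2);\mathbb{Q})$ is an $S_n$-representation. The concatenation product $z_1|z_2$ of cycles on disjoint label sets is the bilinear extension of concatenation of symbols. Basis. A singleton is a one-element block; a block is a follower if the preceding block is a singleton whose element is less than every element of the block. A symbol $e$ on $[n]$ is critical if its blocks have at most $2$ elements, every two consecutive singletons are in decreasing order, and every $2$-element block with decreasing elements is a follower. Put $z(i)=i$; $z(a\,b)=a\,b+b\,a$ for $a<b$; and for $a<b<c$ let $z(a|c\,b)$ be the image, under the order-preserving relabeling $1,2,3\mapsto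 a,b,c$, of $z(1|3\,2):=\partial(3\,2\,1)$ (boundary taken in $\mathrm{cell}(3)$). A critical symbol is uniquely a concatenation of pieces $i$; $a\,b$ ($a<b$); $a|c\,b$ ($a<b<c$), and $z(e)$ is the concatenation product of the corresponding cycles. By a theorem of Alpert the classes $z(e)$, $e$ critical with exactly $k$ two-element blocks, form a basis of $H_k(\mathrm{cell}(n,2);\mathbb{Q})$. Sets. For $n\ge3$, $1\le m\le n-2$, $A_{n,m}$ is the set of basis elements $z(e)$ of $H_1(\mathrm{cell}(n,2);\mathbb{Q})$ with $e=i_{1}|\cdots|i_{m}|i_{m+1}\,i_{m+2}|i_{m+3}|\cdots|i_{n}$, the $i_j$ a permutation of $[n]$, $i_1>\cdots>i_m$, $i_{m+3}>\cdots>i_n$, $i_{m+1}>i_{m+2}>i_m$. For $n\ge2$, $0\le m\le n-2$, $B_{n,m}$ is the set of those with $e$ of the same shape, $i_1>\cdots>i_m$, $i_{m+3}>\cdots>i_n$, $i_{m+2}>i_{m+1}$. High insertion. The barriers of a critical $e$ are its pieces of type $a\,b$ and $a|c\,b$; for $0\le j\le k$ ($k$ the number of barriers) $\iota_j(e)$ is the critical symbol obtained by inserting the singleton block $n+1$ immediately after the $j$-th barrier (at the far left if $j=0$), and $[\iota_j]:H_k(\mathrm{cell}(n,2);\mathbb{Q})\to H_k(\mathrm{cell}(n+1,2);\mathbb{Q})$ is linear with $z(e)\mapsto z(\iota_j(e))$. (For $k=1$: $[\iota_0]z=(n+1)|z$, $[\iota_1]z=z|(n+1)$ in homology.) $\mathrm{FI}_d$.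 $\mathrm{FI}_d$ has objects $[n]$ and morphisms $(f,g)$ with $f$ an injection and $g$ a $d$-coloring of the complement of the image of $f$; composition is $(f,g)\circ(f',g')=(f\circ f',h)$, $h(x)=g(x)$ if $x\notin\mathrm{im} f$, $h(x)=g'(f^{-1}(x))$ otherwise. An $\mathrm{FI}_d$-module over $\mathbb{Q}$ is a functor from $\mathrm{FI}_d$ to $\mathbb{Q}$-vector spaces. Put $M^{\mathrm{FI}_d}(m)=\mathbb{Q}[\mathrm{Hom}_{\mathrm{FI}_d}([m],\bullet)]$ and $M^{\mathrm{FI}_d}(U_m)=M^{\mathrm{FI}_d}(m)\otimes_{\mathbb{Q}[S_m]}U_m$ for an $S_m$-representation $U_m$; a module is free if it is isomorphic to some $\bigoplus_m M^{\mathrm{FI}_d}(U_m)$. By work of Alpert, $H_k(\mathrm{cell}(\bullet,2);\mathbb{Q})$ with any $d$ of the maps $[\iota_j]$ is an $\mathrm{FI}_d$-module (each chosen map is induced by the standard inclusion $[n]\to[n+1]$ with $n+1$ given the corresponding color). The submodule generated by a subspace $V\subseteq H_k(\mathrm{cell}(r,2);\mathbb{Q})$ and chosen maps is the smallest sequence of $S_n$-subrepresentations containing $V$ and closed under the chosen maps. *)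

theory Defs
  imports Complex_Main "HOL-Library.Poly_Mapping" "HOL-Library.FuncSet"
    "HOL-Combinatorics.Permutations"
begin

section \<open>Rational vector spaces\<close>

class rat_vector = ab_group_add +
  fixes scaleQ :: "rat \<Rightarrow> 'a \<Rightarrow> 'a" (infixr "*\<^sub>Q" 75)
  assumes scaleQ_add_right: "c *\<^sub>Q (x + y) = c *\<^sub>Q x + c *\<^sub>Q y"
    and scaleQ_add_left: "(c + d) *\<^sub>Q x = c *\<^sub>Q x + d *\<^sub>Q x"
    and scaleQ_scaleQ: "c *\<^sub>Q d *\<^sub>Q x = (c * d) *\<^sub>Q x"
    and scaleQ_one: "1 *\<^sub>Q x = x"

global_interpretation rat_vec: vector_space "scaleQ :: rat \<Rightarrow> 'a \<Rightarrow> 'a::rat_vector"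
  by unfold_locales (simp_all add: scaleQ_add_right scaleQ_add_left scaleQ_scaleQ scaleQ_one)

instantiation rat :: rat_vector
begin

definition scaleQ_rat :: "rat \<Rightarrow> rat \<Rightarrow> rat" where "scaleQ_rat c x = c * x"

instance by standard (simp_all add: scaleQ_rat_def algebra_simps)

end

instantiation poly_mapping :: (type, rat_vector) rat_vector
begin

definition scaleQ_poly_mapping :: "rat \<Rightarrow> ('a \<Rightarrow>\<^sub>0 'b) \<Rightarrow> ('a \<Rightarrow>\<^sub>0 'b)" where
  "scaleQ_poly_mapping c x = Poly_Mapping.map (\<lambda>y. c *\<^sub>Q y) x"

lemma lookup_scaleQ: "Poly_Mapping.lookup (c *\<^sub>Q x) a = c *\<^sub>Q Poly_Mapping.lookup x a"
  for x :: "'a \<Rightarrow>\<^sub>0 'b"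
  by (simp add: scaleQ_poly_mapping_def Poly_Mapping.map.rep_eq when_def)

instance
  by standard (rule poly_mapping_eqI, simp add: lookup_scaleQ lookup_add
      scaleQ_add_right scaleQ_add_left scaleQ_scaleQ scaleQ_one)+

end

text \<open>\<open>lin_ext f\<close> is the linear extension of \<open>f\<close> from a set of basis elements to the free
  rational vector space on it.\<close>

definition lin_ext :: "('a \<Rightarrow> 'v::rat_vector) \<Rightarrow> ('a \<Rightarrow>\<^sub>0 rat) \<Rightarrow> 'v" where
  "lin_ext f x = (\<Sum>a\<in>Poly_Mapping.keys x. Poly_Mapping.lookup x a *\<^sub>Q f a)"

abbreviation basis_elt :: "'a \<Rightarrow> ('a \<Rightarrow>\<^sub>0 rat)" where
  "basis_elt a \<equiv> Poly_Mapping.single a 1"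

lemma lin_ext_superset:
  assumes "finite A" "Poly_Mapping.keys x \<subseteq> A"
  shows "lin_ext f x = (\<Sum>a\<in>A. Poly_Mapping.lookup x a *\<^sub>Q f a)"
  unfolding lin_ext_def
  by (rule sum.mono_neutral_left) (use assms in \<open>auto simp: in_keys_iff\<close>)

lemma lin_ext_add: "lin_ext f (x + y) = lin_ext f x + lin_ext f y"
proof -
  let ?A = "Poly_Mapping.keys x \<union> Poly_Mapping.keys y"
  have "Poly_Mapping.keys (x + y) \<subseteq> ?A"
    by (rule Poly_Mapping.keys_add)
  then have "lin_ext f (x + y) = (\<Sum>a\<in>?A. Poly_Mapping.lookup (x + y) a *\<^sub>Q f a)"
    by (intro lin_ext_superset) auto
  also have "\<dots> = (\<Sum>a\<in>?A. Poly_Mapping.lookup x a *\<^sub>Q f a) + (\<Sum>a\<in>?A. Poly_Mapping.lookup y a *\<^sub>Q f a)"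
    by (simp add: lookup_add scaleQ_add_left sum.distrib)
  also have "\<dots> = lin_ext f x + lin_ext f y"
    by (simp add: lin_ext_superset[of ?A x] lin_ext_superset[of ?A y])
  finally show ?thesis .
qed

lemma lin_ext_scale: "lin_ext f (c *\<^sub>Q x) = c *\<^sub>Q lin_ext f x"
proof -
  have "Poly_Mapping.keys (c *\<^sub>Q x) \<subseteq> Poly_Mapping.keys x"
    by (auto simp: in_keys_iff lookup_scaleQ)
  then show ?thesis
    by (simp add: lin_ext_superset[of "Poly_Mapping.keys x"] lookup_scaleQ scaleQ_rat_def
        rat_vec.scale_sum_right scaleQ_scaleQ)
qed

lemma linear_lin_ext: "Vector_Spaces.linear scaleQ scaleQ (lin_ext f)"
  by (rule Vector_Spaces.linear_iff[THEN iffD2])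
    (simp add: lin_ext_add lin_ext_scale rat_vec.vector_space_axioms)

lemma lin_ext_single [simp]: "lin_ext f (Poly_Mapping.single a c) = c *\<^sub>Q f a"
  by (simp add: lin_ext_def)

lemma lin_ext_zero [simp]: "lin_ext f 0 = 0"
  by (simp add: lin_ext_def)

lemma lin_ext_minus: "lin_ext f (- x) = - lin_ext f x"
  using lin_ext_add[of f x "- x"] by (simp add: eq_neg_iff_add_eq_0 add.commute)

lemma lin_ext_diff: "lin_ext f (x - y) = lin_ext f x - lin_ext f y"
  using lin_ext_add[of f x "- y"] by (simp add: lin_ext_minus)

lemma lin_ext_sum: "lin_ext f (sum g A) = (\<Sum>a\<in>A. lin_ext f (g a))"
  by (induction A rule: infinite_finite_induct) (simp_all add: lin_ext_add)

lemma lin_ext_cong: "(\<And>a. a \<in> Poly_Mapping.keys x \<Longrightarrow> f a = g a) \<Longrightarrow> lin_ext f x = lin_ext g x"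
  by (simp add: lin_ext_def)

lemma lin_ext_lin_ext: "lin_ext f (lin_ext g x) = lin_ext (\<lambda>a. lin_ext f (g a)) x"
  by (simp add: lin_ext_def[of g] lin_ext_def[of "\<lambda>a. lin_ext f (g a)"] lin_ext_sum lin_ext_scale)

lemma lin_ext_basis_elt: "lin_ext basis_elt x = x"
proof (rule poly_mapping_eqI)
  fix a
  have "Poly_Mapping.lookup (lin_ext basis_elt x) a
      = (\<Sum>b\<in>Poly_Mapping.keys x. if a = b then Poly_Mapping.lookup x b else 0)"
    unfolding lin_ext_def lookup_sum
    by (rule sum.cong) (auto simp: lookup_scaleQ lookup_single scaleQ_rat_def when_def)
  also have "\<dots> = Poly_Mapping.lookup x a"
    by (simp add: sum.delta' in_keys_iff)
  finally show "Poly_Mapping.lookup (lin_ext basis_elt x) a = Poly_Mapping.lookup x a" .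
qed

text \<open>Linearity on a subspace, and linear isomorphisms from a quotient \<open>V / K\<close> (whose elements are
  the cosets \<open>x + K\<close>, with the usual operations) onto a subspace \<open>W\<close>.\<close>

definition lin_on :: "'v::rat_vector set \<Rightarrow> ('v \<Rightarrow> 'w::rat_vector) \<Rightarrow> bool" where
  "lin_on V f \<longleftrightarrow> (\<forall>x\<in>V. \<forall>y\<in>V. f (x + y) = f x + f y) \<and> (\<forall>c. \<forall>x\<in>V. f (c *\<^sub>Q x) = c *\<^sub>Q f x)"

definition coset :: "'v::rat_vector set \<Rightarrow> 'v \<Rightarrow> 'v set" where
  "coset K x = {x + k |k. k \<in> K}"

definition quotient_iso ::
  "'v::rat_vector set \<Rightarrow> 'v set \<Rightarrow> ('v set \<Rightarrow> 'w::rat_vector) \<Rightarrow> 'w set \<Rightarrow> bool" where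
  "quotient_iso V K \<phi> W \<longleftrightarrow> bij_betw \<phi> (coset K ` V) W \<and> lin_on V (\<lambda>x. \<phi> (coset K x))"


section \<open>Symbols and the cellular chain complex\<close>

type_synonym sym = "nat list list"
type_synonym chain = "sym \<Rightarrow>\<^sub>0 rat"

definition symbols :: "nat set \<Rightarrow> sym set" where
  "symbols S = {e. (\<forall>g\<in>set e. g \<noteq> []) \<and> distinct (concat e) \<and> set (concat e) = S}"

definition symbols2 :: "nat set \<Rightarrow> sym set" where
  "symbols2 S = {e \<in> symbols S. \<forall>g\<in>set e. length g \<le> 2}"

definition cell_dim :: "sym \<Rightarrow> nat" where
  "cell_dim e = length (concat e) - length e"

definition concat_chain :: "chain \<Rightarrow> chain \<Rightarrow> chain" where
  "concat_chain x y = lin_ext (\<lambda>e. lin_ext (\<lambda>f. basis_elt (e @ f)) y) x"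

text \<open>A splitting of the word \<open>g\<close> is given by the set \<open>I\<close> of positions of the letters of
  \<open>\<alpha>\<close>; the letters of \<open>g\<close> are distinct, so the permutation below is unique.\<close>

definition split_perm :: "nat set \<Rightarrow> nat list \<Rightarrow> nat \<Rightarrow> nat" where
  "split_perm I g = (THE p. p permutes {..<length g} \<and> permute_list p g = nths g I @ nths g (- I))"

definition bd_block :: "nat list \<Rightarrow> chain" where
  "bd_block g = (\<Sum>I | I \<subset> {..<length g} \<and> I \<noteq> {}.
     of_int (sign (split_perm I g)) *\<^sub>Q basis_elt [nths g I, nths g (- I)])"

fun bd_sym :: "sym \<Rightarrow> chain" where
  "bd_sym [] = 0"
| "bd_sym (g # e) =
     concat_chain (bd_block g) (basis_elt e) - concat_chain (basis_elt [g]) (bd_sym e)"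

definition bd :: "chain \<Rightarrow> chain" where
  "bd = lin_ext bd_sym"

definition relabel :: "(nat \<Rightarrow> nat) \<Rightarrow> chain \<Rightarrow> chain" where
  "relabel \<sigma> = lin_ext (\<lambda>e. basis_elt (map (map \<sigma>) e))"

definition chains2 :: "nat \<Rightarrow> nat \<Rightarrow> chain set" where
  "chains2 k n = {x. Poly_Mapping.keys x \<subseteq> {e \<in> symbols2 {1..n}. cell_dim e = k}}"


section \<open>Homology\<close>

text \<open>The type \<open>homology\<close> is the total homology of the disjoint union of the complexes
  \<open>cell(S, 2)\<close> over all finite sets \<open>S\<close> of labels (all degrees together); it is the direct sum of
  the \<open>H\<^sub>k(cell(S, 2))\<close>.  The space \<open>H\<^sub>k(cell(n, 2))\<close> is the summand \<open>Hcell k n\<close>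
  below, and the theorem \<open>hclass_eq_iff\<close> certifies that two cycles in \<open>C\<^sub>k(cell(n, 2))\<close>
  have the same class iff they differ by the boundary of an element of
  \<open>C\<^sub>k\<^sub>+\<^sub>1(cell(n, 2))\<close>.\<close>

definition all_chains2 :: "chain set" where
  "all_chains2 = {x. Poly_Mapping.keys x \<subseteq> (\<Union>S. symbols2 S)}"

definition homologous :: "chain \<Rightarrow> chain \<Rightarrow> bool" where
  "homologous x y \<longleftrightarrow> x \<in> all_chains2 \<and> bd x = 0 \<and> y \<in> all_chains2 \<and> bd y = 0
     \<and> x - y \<in> bd ` all_chains2"

lemma bd_add: "bd (x + y) = bd x + bd y" by (simp add: bd_def lin_ext_add)
lemma bd_scale: "bd (c *\<^sub>Q x) = c *\<^sub>Q bd x" by (simp add: bd_def lin_ext_scale)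
lemma bd_minus: "bd (- x) = - bd x" by (simp add: bd_def lin_ext_minus)
lemma bd_diff: "bd (x - y) = bd x - bd y" by (simp add: bd_def lin_ext_diff)
lemma bd_zero [simp]: "bd 0 = 0" by (simp add: bd_def)

lemma subspace_keys: "rat_vec.subspace {x :: 'a \<Rightarrow>\<^sub>0 'v::rat_vector. Poly_Mapping.keys x \<subseteq> A}"
proof -
  have "{x :: 'a \<Rightarrow>\<^sub>0 'v. Poly_Mapping.keys x \<subseteq> A} = {x. \<forall>a. a \<notin> A \<longrightarrow> Poly_Mapping.lookup x a = 0}"
    by (auto simp: in_keys_iff)
  then show ?thesis
    by (simp add: rat_vec.subspace_def lookup_add lookup_scaleQ)
qed

lemma subspace_all_chains2: "rat_vec.subspace all_chains2"
  unfolding all_chains2_def by (rule subspace_keys)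

lemma subspace_boundaries: "rat_vec.subspace (bd ` all_chains2)"
  unfolding rat_vec.subspace_def
proof (intro conjI ballI allI)
  note s = subspace_all_chains2[unfolded rat_vec.subspace_def]
  show "0 \<in> bd ` all_chains2" using s by (intro image_eqI[of _ _ 0]) auto
  show "x + y \<in> bd ` all_chains2" if "x \<in> bd ` all_chains2" "y \<in> bd ` all_chains2" for x y
    using that s by (auto simp flip: bd_add)
  show "c *\<^sub>Q x \<in> bd ` all_chains2" if "x \<in> bd ` all_chains2" for x c
    using that s by (auto simp flip: bd_scale)
qed

quotient_type homology = chain / partial: homologous
  morphisms rep_homology hclass
proof (rule part_equivpI)
  have "0 \<in> all_chains2" "0 \<in> bd ` all_chains2"
    using subspace_all_chains2 subspace_boundaries by (auto simp: rat_vec.subspace_def)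
  then show "\<exists>x. homologous x x"
    by (intro exI[of _ 0]) (simp add: homologous_def)
  show "symp homologous"
  proof (rule sympI)
    fix x y assume "homologous x y"
    then show "homologous y x"
      using rat_vec.subspace_neg[OF subspace_boundaries, of "x - y"] by (simp add: homologous_def)
  qed
  show "transp homologous"
  proof (rule transpI)
    fix x y z assume "homologous x y" "homologous y z"
    then show "homologous x z"
      using rat_vec.subspace_add[OF subspace_boundaries, of "x - y" "y - z"]
      by (simp add: homologous_def)
  qed
qed

instantiation homology :: rat_vector
begin

lift_definition zero_homology :: homology is 0
  using subspace_all_chains2 subspace_boundaries by (simp add: homologous_def rat_vec.subspace_def)

lift_definition plus_homology :: "homology \<Rightarrow> homology \<Rightarrow> homology" is "(+)"
proof -
  fix x y x' y' assume "homologous x y" "homologous x' y'"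
  then show "homologous (x + x') (y + y')"
    using rat_vec.subspace_add[OF subspace_boundaries, of "x - y" "x' - y'"]
    by (simp add: homologous_def bd_add rat_vec.subspace_add[OF subspace_all_chains2]
        add_diff_add)
qed

lift_definition uminus_homology :: "homology \<Rightarrow> homology" is uminus
proof -
  fix x y assume "homologous x y"
  then show "homologous (- x) (- y)"
    using rat_vec.subspace_neg[OF subspace_boundaries, of "x - y"]
    by (simp add: homologous_def bd_minus rat_vec.subspace_neg[OF subspace_all_chains2])
qed

definition minus_homology :: "homology \<Rightarrow> homology \<Rightarrow> homology" where
  "minus_homology x y = x + - y"

lift_definition scaleQ_homology :: "rat \<Rightarrow> homology \<Rightarrow> homology" is scaleQ
proof -
  fix c x y assume "homologous x y"
  then show "homologous (c *\<^sub>Q x) (c *\<^sub>Q y)"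
    using rat_vec.subspace_scale[OF subspace_boundaries, of "x - y" c]
    by (simp add: homologous_def bd_scale rat_vec.subspace_scale[OF subspace_all_chains2]
        rat_vec.scale_right_diff_distrib)
qed

lemma homologous_refl: "homologous x y \<Longrightarrow> homologous x x" "homologous x y \<Longrightarrow> homologous y y"
  using subspace_boundaries by (auto simp: homologous_def rat_vec.subspace_def)

lemma homologous_cycles:
  "homologous x x \<longleftrightarrow> x \<in> all_chains2 \<and> bd x = 0"
  using subspace_boundaries by (auto simp: homologous_def rat_vec.subspace_def)

lemmas cycle_closure =
  bd_add bd_scale bd_minus
  rat_vec.subspace_add[OF subspace_all_chains2] rat_vec.subspace_scale[OF subspace_all_chains2]
  rat_vec.subspace_neg[OF subspace_all_chains2] rat_vec.subspace_0[OF subspace_all_chains2]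

instance
proof
  fix a b c :: homology and r s :: rat
  show "a + b + c = a + (b + c)"
    by transfer (simp add: homologous_cycles cycle_closure add.assoc)
  show "a + b = b + a"
    by transfer (simp add: homologous_cycles cycle_closure add.commute)
  show "0 + a = a"
    by transfer (simp add: homologous_cycles cycle_closure)
  show "- a + a = 0"
    by transfer (simp add: homologous_cycles cycle_closure)
  show "a - b = a + - b"
    by (simp add: minus_homology_def)
  show "r *\<^sub>Q (a + b) = r *\<^sub>Q a + r *\<^sub>Q b"
    by transfer (simp add: homologous_cycles cycle_closure scaleQ_add_right)
  show "(r + s) *\<^sub>Q a = r *\<^sub>Q a + s *\<^sub>Q a"
    by transfer (simp add: homologous_cycles cycle_closure scaleQ_add_left)
  show "r *\<^sub>Q s *\<^sub>Q a = (r * s) *\<^sub>Q a"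
    by transfer (simp add: homologous_cycles cycle_closure scaleQ_scaleQ)
  show "1 *\<^sub>Q a = a"
    by transfer (simp add: homologous_cycles cycle_closure scaleQ_one)
qed

end

definition Hcell :: "nat \<Rightarrow> nat \<Rightarrow> homology set" where
  "Hcell k n = hclass ` {x \<in> chains2 k n. bd x = 0}"

lemma keys_lin_ext: "Poly_Mapping.keys (lin_ext f x) \<subseteq> (\<Union>a\<in>Poly_Mapping.keys x. Poly_Mapping.keys (f a))"
  for f :: "'a \<Rightarrow> ('b \<Rightarrow>\<^sub>0 rat)"
proof
  fix b assume b: "b \<in> Poly_Mapping.keys (lin_ext f x)"
  show "b \<in> (\<Union>a\<in>Poly_Mapping.keys x. Poly_Mapping.keys (f a))"
  proof (rule ccontr)
    assume "\<not> ?thesis"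
    then have "Poly_Mapping.lookup (lin_ext f x) b = 0"
      by (simp add: lin_ext_def lookup_sum lookup_scaleQ in_keys_iff scaleQ_rat_def)
    with b show False by (simp add: in_keys_iff)
  qed
qed

lemma keys_concat_chain:
  assumes "f \<in> Poly_Mapping.keys (concat_chain x y)"
  obtains a b where "a \<in> Poly_Mapping.keys x" "b \<in> Poly_Mapping.keys y" "f = a @ b"
proof -
  from assms obtain a where a: "a \<in> Poly_Mapping.keys x"
    "f \<in> Poly_Mapping.keys (lin_ext (\<lambda>b. basis_elt (a @ b)) y)"
    unfolding concat_chain_def using keys_lin_ext by fast
  from a(2) obtain b where "b \<in> Poly_Mapping.keys y" "f \<in> Poly_Mapping.keys (basis_elt (a @ b))"
    using keys_lin_ext by fast
  then show thesis using that a(1) by simp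
qed

lemma mset_nths_compl: "mset (nths xs I) + mset (nths xs (- I)) = mset xs"
proof (induction xs arbitrary: I)
  case (Cons a xs)
  have "{j. Suc j \<in> - I} = - {j. Suc j \<in> I}" by auto
  then show ?case using Cons[of "{j. Suc j \<in> I}"] by (simp add: nths_Cons)
qed simp

lemma keys_bd_block:
  assumes "f \<in> Poly_Mapping.keys (bd_block g)"
  obtains I where "I \<subset> {..<length g}" "I \<noteq> {}" "f = [nths g I, nths g (- I)]"
proof -
  have "Poly_Mapping.keys (bd_block g) \<subseteq> (\<Union>I\<in>{I. I \<subset> {..<length g} \<and> I \<noteq> {}}.
      Poly_Mapping.keys (of_int (sign (split_perm I g)) *\<^sub>Q basis_elt [nths g I, nths g (- I)]))"
    unfolding bd_block_def by (rule Poly_Mapping.keys_sum)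
  with assms obtain I where I: "I \<subset> {..<length g}" "I \<noteq> {}"
    "f \<in> Poly_Mapping.keys (of_int (sign (split_perm I g)) *\<^sub>Q basis_elt [nths g I, nths g (- I)])"
    by auto
  have "f = [nths g I, nths g (- I)]"
    using I(3) by (auto simp: in_keys_iff lookup_scaleQ lookup_single scaleQ_rat_def when_def
        split: if_splits)
  with I(1,2) show thesis by (rule that)
qed

lemma keys_bd_sym:
  assumes "f \<in> Poly_Mapping.keys (bd_sym e)" "\<forall>g\<in>set e. g \<noteq> []"
  shows "mset (concat f) = mset (concat e) \<and> length f = Suc (length e)
    \<and> (\<forall>g\<in>set f. g \<noteq> [] \<and> (\<exists>h\<in>set e. length g \<le> length h))"
  using assms
proof (induction e arbitrary: f)
  case (Cons g e)
  from Cons.prems(1) consider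
    "f \<in> Poly_Mapping.keys (concat_chain (bd_block g) (basis_elt e))"
    | "f \<in> Poly_Mapping.keys (concat_chain (basis_elt [g]) (bd_sym e))"
    by (fastforce simp: in_keys_iff lookup_minus)
  then show ?case
  proof cases
    case 1
    then obtain I where I: "I \<subset> {..<length g}" "I \<noteq> {}" "f = [nths g I, nths g (- I)] @ e"
      by (elim keys_concat_chain keys_bd_block) auto
    obtain i j where ij: "i < length g" "i \<in> I" "j < length g" "j \<notin> I"
      using I(1,2) by blast
    have "g ! i \<in> set (nths g I)" "g ! j \<in> set (nths g (- I))"
      using ij by (auto simp: set_nths)
    then have ne: "nths g I \<noteq> []" "nths g (- I) \<noteq> []" by auto
    have len: "length (nths g A) \<le> length g" for A
      unfolding length_nths by (rule order.trans[OF card_mono[of "{..<length g}"]]) auto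
    have "mset (concat f) = mset (nths g I) + mset (nths g (- I)) + mset (concat e)"
      unfolding I(3) by (simp add: add.assoc)
    then have "mset (concat f) = mset (concat (g # e))"
      unfolding mset_nths_compl by simp
    moreover have "g' \<noteq> [] \<and> (\<exists>h\<in>set (g # e). length g' \<le> length h)" if g': "g' \<in> set f" for g'
    proof -
      from g' I(3) consider "g' = nths g I" | "g' = nths g (- I)" | "g' \<in> set e"
        by auto
      then show ?thesis
      proof cases
        case 1
        with ne(1) len[of I] show ?thesis by simp
      next
        case 2
        with ne(2) len[of "- I"] show ?thesis by simp
      next
        case 3
        with Cons.prems(2) show ?thesis by auto
      qed
    qed
    ultimately show ?thesis by (simp add: I(3))
  next
    case 2
    then obtain b where b: "b \<in> Poly_Mapping.keys (bd_sym e)" "f = g # b"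
      by (elim keys_concat_chain) auto
    have "\<forall>h\<in>set e. h \<noteq> []" using Cons.prems(2) by simp
    note IH = Cons.IH[OF b(1) this]
    have "g' \<noteq> [] \<and> (\<exists>h\<in>set (g # e). length g' \<le> length h)" if g': "g' \<in> set f" for g'
      using IH g' b(2) Cons.prems(2) by (cases "g' = g") auto
    then have 1: "\<forall>g'\<in>set f. g' \<noteq> [] \<and> (\<exists>h\<in>set (g # e). length g' \<le> length h)"
      by (rule ballI)
    have 2: "mset (concat f) = mset (concat (g # e))" "length f = Suc (length (g # e))"
      using IH b(2) by simp_all
    show ?thesis by (intro conjI 1 2)
  qed
qed simp

lemma length_le_concat: "\<forall>g\<in>set e. g \<noteq> [] \<Longrightarrow> length e \<le> length (concat e)"
proof (induction e)
  case (Cons g e)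
  then have "1 \<le> length g" by (cases g) auto
  with Cons show ?case by auto
qed simp

lemma keys_bd_sym_symbols2:
  assumes "f \<in> Poly_Mapping.keys (bd_sym e)" "e \<in> symbols2 S"
  shows "f \<in> symbols2 S" "cell_dim e = Suc (cell_dim f)"
proof -
  have e: "\<forall>g\<in>set e. g \<noteq> []" using assms(2) by (simp add: symbols2_def symbols_def)
  note f = keys_bd_sym[OF assms(1) e]
  then have "distinct (concat f) = distinct (concat e)" "set (concat f) = set (concat e)"
    by (metis mset_eq_imp_distinct_iff, metis set_mset_mset)
  then show "f \<in> symbols2 S"
    using f assms(2) unfolding symbols2_def symbols_def by (fastforce intro: order.trans)
  have "length (concat f) = length (concat e)" using f by (metis size_mset)
  moreover have "length f \<le> length (concat f)" using f by (intro length_le_concat) auto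
  ultimately show "cell_dim e = Suc (cell_dim f)" using f by (simp add: cell_dim_def)
qed

lemma chains2_subset: "chains2 k n \<subseteq> all_chains2"
  by (auto simp: chains2_def all_chains2_def)

theorem hclass_eq_iff:
  assumes x: "x \<in> chains2 k n" "bd x = 0" and y: "y \<in> chains2 k n" "bd y = 0"
  shows "hclass x = hclass y \<longleftrightarrow> x - y \<in> bd ` chains2 (Suc k) n"
proof -
  have hom: "homologous x x" "homologous y y"
    using x y chains2_subset[of k n] by (auto simp: homologous_cycles)
  have *: "hclass x = hclass y \<longleftrightarrow> homologous x y"
    using Quotient3_rel[OF Quotient3_homology, of x y] hom by auto
  define P where "P k e \<longleftrightarrow> e \<in> symbols2 {1..n} \<and> cell_dim e = k" for k e
  define pr where "pr k = lin_ext (\<lambda>e. if P k e then basis_elt e else 0)" for k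
  have pr_id: "pr j z = z" if "\<And>e. e \<in> Poly_Mapping.keys z \<Longrightarrow> P j e" for j z
    unfolding pr_def using lin_ext_cong[of z "\<lambda>e. if P j e then basis_elt e else 0" basis_elt] that
    by (simp add: lin_ext_basis_elt)
  have pr_0: "pr j z = 0" if "\<And>e. e \<in> Poly_Mapping.keys z \<Longrightarrow> \<not> P j e" for j z
    unfolding pr_def lin_ext_def using that by (intro sum.neutral) auto
  have pr_chains: "pr j z \<in> chains2 j n" for j z
  proof -
    have "Poly_Mapping.keys (pr j z)
        \<subseteq> (\<Union>e\<in>Poly_Mapping.keys z. Poly_Mapping.keys (if P j e then basis_elt e else 0))"
      unfolding pr_def by (rule keys_lin_ext)
    also have "\<dots> \<subseteq> {e. P j e}" by (auto split: if_splits)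
    finally show ?thesis by (simp add: chains2_def P_def)
  qed
  have pr_bd: "pr k (bd w) = bd (pr (Suc k) w)" if "w \<in> all_chains2" for w
    unfolding bd_def pr_def lin_ext_lin_ext
  proof (rule lin_ext_cong)
    fix e assume "e \<in> Poly_Mapping.keys w"
    with that obtain S where e: "e \<in> symbols2 S" by (auto simp: all_chains2_def)
    then have S: "P (Suc k) e \<longleftrightarrow> S = {1..n} \<and> cell_dim e = Suc k"
      by (auto simp: P_def symbols2_def symbols_def)
    have f: "P k f \<longleftrightarrow> P (Suc k) e" if "f \<in> Poly_Mapping.keys (bd_sym e)" for f
      using keys_bd_sym_symbols2[OF that e] e by (auto simp: P_def symbols2_def symbols_def)
    have "pr k (bd_sym e) = (if P (Suc k) e then bd_sym e else 0)"
      using f pr_id[of "bd_sym e" k] pr_0[of "bd_sym e" k] by auto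
    then show "lin_ext (\<lambda>e. if P k e then basis_elt e else 0) (bd_sym e)
        = lin_ext bd_sym (if P (Suc k) e then basis_elt e else 0)"
      by (simp add: pr_def scaleQ_one)
  qed
  show ?thesis
  proof
    assume "hclass x = hclass y"
    then obtain w where w: "w \<in> all_chains2" "x - y = bd w"
      unfolding * homologous_def by blast
    have "\<And>e. e \<in> Poly_Mapping.keys (x - y) \<Longrightarrow> P k e"
      using x y Poly_Mapping.keys_diff[of x y] by (auto simp: chains2_def P_def)
    then have "x - y = bd (pr (Suc k) w)"
      using pr_bd[OF w(1)] pr_id[of "x - y" k] w(2) by simp
    then show "x - y \<in> bd ` chains2 (Suc k) n" using pr_chains by blast
  next
    assume "x - y \<in> bd ` chains2 (Suc k) n"
    then show "hclass x = hclass y"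
      unfolding * using hom chains2_subset[of "Suc k" n]
      by (auto simp: homologous_def)
  qed
qed

subsection \<open>Relabeling\<close>

lemma relabel_concat_chain:
  "relabel \<sigma> (concat_chain x y) = concat_chain (relabel \<sigma> x) (relabel \<sigma> y)"
  by (simp add: relabel_def concat_chain_def lin_ext_lin_ext scaleQ_one)

lemma relabel_bd_block:
  assumes "inj \<sigma>"
  shows "bd_block (map \<sigma> g) = relabel \<sigma> (bd_block g)"
proof -
  have "p permutes {..<length g} \<and>
      permute_list p (map \<sigma> g) = map \<sigma> (nths g I) @ map \<sigma> (nths g (- I)) \<longleftrightarrow>
    p permutes {..<length g} \<and> permute_list p g = nths g I @ nths g (- I)" for p I
    using inj_map_eq_map[OF assms, of "permute_list p g" "nths g I @ nths g (- I)"]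
    by (auto simp: permute_list_map)
  then have "split_perm I (map \<sigma> g) = split_perm I g" for I
    by (simp add: split_perm_def nths_map)
  then show ?thesis
    by (simp add: bd_block_def relabel_def lin_ext_sum lin_ext_scale nths_map scaleQ_one)
qed

lemma relabel_bd:
  assumes "inj \<sigma>"
  shows "bd (relabel \<sigma> x) = relabel \<sigma> (bd x)"
proof -
  have "bd_sym (map (map \<sigma>) e) = relabel \<sigma> (bd_sym e)" for e
  proof (induction e)
    case (Cons g e)
    have "relabel \<sigma> (a - b) = relabel \<sigma> a - relabel \<sigma> b" for a b
      by (simp add: relabel_def lin_ext_diff)
    moreover have "relabel \<sigma> (basis_elt f) = basis_elt (map (map \<sigma>) f)" for f
      by (simp add: relabel_def scaleQ_one)
    ultimately show ?case
      using Cons by (simp add: relabel_bd_block[OF assms] relabel_concat_chain)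
  qed (simp add: relabel_def)
  then show ?thesis
    by (simp add: bd_def relabel_def lin_ext_lin_ext scaleQ_one)
qed

lemma relabel_all_chains2:
  assumes "inj \<sigma>" "x \<in> all_chains2"
  shows "relabel \<sigma> x \<in> all_chains2"
proof -
  have "map (map \<sigma>) e \<in> symbols2 (\<sigma> ` S)" if "e \<in> symbols2 S" for e S
  proof -
    have "concat (map (map \<sigma>) e) = map \<sigma> (concat e)" by (simp add: map_concat)
    with that show ?thesis
      using assms(1) by (auto simp: symbols2_def symbols_def distinct_map inj_on_def)
  qed
  with assms(2) show ?thesis
    using keys_lin_ext[of "\<lambda>e. basis_elt (map (map \<sigma>) e)" x]
    by (fastforce simp: all_chains2_def relabel_def)
qed

text \<open>The action of \<open>S\<^sub>n\<close> on homology is \<open>hact \<sigma>\<close> for \<open>\<sigma> permutes {1..n}\<close>; the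
  convention for non-injective \<open>\<sigma>\<close> only makes the function total.\<close>

lift_definition hact :: "(nat \<Rightarrow> nat) \<Rightarrow> homology \<Rightarrow> homology" is
  "\<lambda>\<sigma> x. if inj \<sigma> then relabel \<sigma> x else x"
proof -
  fix \<sigma> :: "nat \<Rightarrow> nat" and x y assume h: "homologous x y"
  show "homologous (if inj \<sigma> then relabel \<sigma> x else x) (if inj \<sigma> then relabel \<sigma> y else y)"
  proof (cases "inj \<sigma>")
    case True
    from h obtain w where w: "w \<in> all_chains2" "x - y = bd w"
      by (auto simp: homologous_def)
    have "relabel \<sigma> x - relabel \<sigma> y = bd (relabel \<sigma> w)"
      unfolding relabel_bd[OF True] w(2)[symmetric] by (simp add: relabel_def lin_ext_diff)
    then have "relabel \<sigma> x - relabel \<sigma> y \<in> bd ` all_chains2"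
      using relabel_all_chains2[OF True w(1)] by (rule image_eqI)
    moreover have "relabel \<sigma> 0 = 0"
      by (simp add: relabel_def)
    ultimately show ?thesis
      using h True w(1) relabel_all_chains2[OF True] by (simp add: homologous_def relabel_bd)
  qed (use h in simp)
qed


section \<open>Critical symbols and the basis of homology\<close>

definition follower :: "sym \<Rightarrow> nat \<Rightarrow> bool" where
  "follower e i \<longleftrightarrow> 0 < i \<and> length (e ! (i - 1)) = 1 \<and> (\<forall>x\<in>set (e ! i). hd (e ! (i - 1)) < x)"

definition critical :: "nat \<Rightarrow> sym \<Rightarrow> bool" where
  "critical n e \<longleftrightarrow> e \<in> symbols2 {1..n}
     \<and> (\<forall>i. Suc i < length e \<and> length (e ! i) = 1 \<and> length (e ! Suc i) = 1
          \<longrightarrow> hd (e ! i) > hd (e ! Suc i))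
     \<and> (\<forall>i<length e. length (e ! i) = 2 \<and> e ! i ! 0 > e ! i ! 1 \<longrightarrow> follower e i)"

definition num_pairs :: "sym \<Rightarrow> nat" where
  "num_pairs e = length (filter (\<lambda>g. length g = 2) e)"

text \<open>The decomposition of a critical symbol into pieces \<open>i\<close>, \<open>a b\<close> (\<open>a < b\<close>) and
  \<open>a|c b\<close> (\<open>a < b < c\<close>).\<close>

fun pieces :: "sym \<Rightarrow> sym list" where
  "pieces [] = []"
| "pieces ([a] # [c, b] # e) =
     (if a < b \<and> b < c then [[a], [c, b]] # pieces e else [[a]] # pieces ([c, b] # e))"
| "pieces (g # e) = [g] # pieces e"

fun piece_cycle :: "sym \<Rightarrow> chain" where
  "piece_cycle [[i]] = basis_elt [[i]]"
| "piece_cycle [[a, b]] = basis_elt [[a, b]] + basis_elt [[b, a]]"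
| "piece_cycle [[a], [c, b]] =
     relabel (\<lambda>i. if i = 1 then a else if i = 2 then b else c) (bd (basis_elt [[3, 2, 1]]))"
| "piece_cycle _ = 0"

definition zcycle :: "sym \<Rightarrow> chain" where
  "zcycle e = foldr concat_chain (map piece_cycle (pieces e)) (basis_elt [])"

definition zclass :: "sym \<Rightarrow> homology" where
  "zclass e = hclass (zcycle e)"


section \<open>High insertion\<close>

definition barrier :: "sym \<Rightarrow> bool" where
  "barrier p \<longleftrightarrow> (\<exists>g\<in>set p. length g = 2)"

fun insert_after_barrier :: "nat \<Rightarrow> nat \<Rightarrow> sym list \<Rightarrow> sym list" where
  "insert_after_barrier x 0 ps = [[x]] # ps"
| "insert_after_barrier x (Suc j) [] = []"
| "insert_after_barrier x (Suc j) (p # ps) =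
     p # insert_after_barrier x (if barrier p then j else Suc j) ps"

definition iota :: "nat \<Rightarrow> nat \<Rightarrow> sym \<Rightarrow> sym" where
  "iota n j e = concat (insert_after_barrier (Suc n) j (pieces e))"

text \<open>The map \<open>[\<iota>\<^sub>j] : H\<^sub>k(cell(n, 2)) \<rightarrow> H\<^sub>k(cell(n + 1, 2))\<close>.  On
  \<open>Hcell k n\<close> it is determined by the stated property, because the \<open>zclass e\<close> form a basis of
  \<open>Hcell k n\<close>; its values elsewhere are irrelevant.\<close>

definition high_insertion :: "nat \<Rightarrow> nat \<Rightarrow> nat \<Rightarrow> homology \<Rightarrow> homology" where
  "high_insertion k n j = (SOME f. Vector_Spaces.linear scaleQ scaleQ f \<and>
     (\<forall>e. critical n e \<and> num_pairs e = k \<longrightarrow> f (zclass e) = zclass (iota n j e)))"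


section \<open>The sets of basis elements\<close>

definition shape :: "nat \<Rightarrow> nat \<Rightarrow> (nat \<Rightarrow> nat) \<Rightarrow> sym" where
  "shape n m i = map (\<lambda>j. [i j]) [1..<m + 1] @ [[i (m + 1), i (m + 2)]] @ map (\<lambda>j. [i j]) [m + 3..<n + 1]"

definition decreasing_ends :: "nat \<Rightarrow> nat \<Rightarrow> (nat \<Rightarrow> nat) \<Rightarrow> bool" where
  "decreasing_ends n m i \<longleftrightarrow> (\<forall>j. 1 \<le> j \<and> j < m \<longrightarrow> i j > i (j + 1))
     \<and> (\<forall>j. m + 3 \<le> j \<and> j < n \<longrightarrow> i j > i (j + 1))"

definition setA :: "nat \<Rightarrow> nat \<Rightarrow> homology set" where
  "setA n m = {zclass (shape n m i) |i. i permutes {1..n} \<and> critical n (shape n m i)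
     \<and> decreasing_ends n m i \<and> i (m + 1) > i (m + 2) \<and> i (m + 2) > i m}"

definition setB :: "nat \<Rightarrow> nat \<Rightarrow> homology set" where
  "setB n m = {zclass (shape n m i) |i. i permutes {1..n} \<and> critical n (shape n m i)
     \<and> decreasing_ends n m i \<and> i (m + 2) > i (m + 1)}"


section \<open>Representations of symmetric groups\<close>

definition rep_on :: "nat \<Rightarrow> 'v::rat_vector set \<Rightarrow> ((nat \<Rightarrow> nat) \<Rightarrow> 'v \<Rightarrow> 'v) \<Rightarrow> bool" where
  "rep_on n V \<rho> \<longleftrightarrow> rat_vec.subspace V
     \<and> (\<forall>\<sigma>. \<sigma> permutes {1..n} \<longrightarrow> \<rho> \<sigma> ` V \<subseteq> V \<and> lin_on V (\<rho> \<sigma>))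
     \<and> (\<forall>x\<in>V. \<rho> id x = x)
     \<and> (\<forall>\<sigma> \<tau>. \<sigma> permutes {1..n} \<and> \<tau> permutes {1..n} \<longrightarrow> (\<forall>x\<in>V. \<rho> (\<sigma> \<circ> \<tau>) x = \<rho> \<sigma> (\<rho> \<tau> x)))"

definition Std :: "nat \<Rightarrow> (nat \<Rightarrow>\<^sub>0 rat) set" where
  "Std n = {v. Poly_Mapping.keys v \<subseteq> {1..n} \<and> (\<Sum>i\<in>{1..n}. Poly_Mapping.lookup v i) = 0}"

text \<open>The exterior square of \<open>Std n\<close> is the quotient of \<open>Std n \<otimes> Std n\<close> (inside the tensor
  square of the permutation representation, whose basis is the set of pairs of labels) by the
  subspace spanned by the \<open>v \<otimes> v\<close>.\<close>

definition tensor :: "(nat \<Rightarrow>\<^sub>0 rat) \<Rightarrow> (nat \<Rightarrow>\<^sub>0 rat) \<Rightarrow> (nat \<times> nat \<Rightarrow>\<^sub>0 rat)" where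
  "tensor v w = lin_ext (\<lambda>i. lin_ext (\<lambda>j. basis_elt (i, j)) w) v"

definition tensor_act :: "(nat \<Rightarrow> nat) \<Rightarrow> (nat \<times> nat \<Rightarrow>\<^sub>0 rat) \<Rightarrow> (nat \<times> nat \<Rightarrow>\<^sub>0 rat)" where
  "tensor_act \<sigma> = lin_ext (\<lambda>(i, j). basis_elt (\<sigma> i, \<sigma> j))"

definition Std_tensor_Std :: "nat \<Rightarrow> (nat \<times> nat \<Rightarrow>\<^sub>0 rat) set" where
  "Std_tensor_Std n = rat_vec.span {tensor v w |v w. v \<in> Std n \<and> w \<in> Std n}"

definition alternating_relations :: "nat \<Rightarrow> (nat \<times> nat \<Rightarrow>\<^sub>0 rat) set" where
  "alternating_relations n = rat_vec.span {tensor v v |v. v \<in> Std n}"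

definition iso_Ext2_Std :: "nat \<Rightarrow> 'v::rat_vector set \<Rightarrow> ((nat \<Rightarrow> nat) \<Rightarrow> 'v \<Rightarrow> 'v) \<Rightarrow> bool" where
  "iso_Ext2_Std n W \<rho> \<longleftrightarrow> (\<exists>\<psi>. quotient_iso (Std_tensor_Std n) (alternating_relations n) \<psi> W
     \<and> (\<forall>\<sigma> t. \<sigma> permutes {1..n} \<and> t \<in> Std_tensor_Std n \<longrightarrow>
          \<psi> (coset (alternating_relations n) (tensor_act \<sigma> t))
            = \<rho> \<sigma> (\<psi> (coset (alternating_relations n) t))))"


section \<open>FI-modules\<close>

text \<open>A morphism \<open>[m] \<rightarrow> [n]\<close> of \<open>FI\<^sub>d\<close> is a pair \<open>(f, g)\<close>; both functions are taken
  extensional (undefined outside their domains), so that equal morphisms are equal pairs.\<close>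

type_synonym fimor = "(nat \<Rightarrow> nat) \<times> (nat \<Rightarrow> nat)"

definition FI_hom :: "nat \<Rightarrow> nat \<Rightarrow> nat \<Rightarrow> fimor set" where
  "FI_hom d m n = {(f, g). f \<in> {1..m} \<rightarrow>\<^sub>E {1..n} \<and> inj_on f {1..m}
     \<and> g \<in> ({1..n} - f ` {1..m}) \<rightarrow>\<^sub>E {..<d}}"

text \<open>\<open>FI_comp l m n p p'\<close> is the composition \<open>p \<circ> p'\<close> of
  \<open>p : [m] \<rightarrow> [n]\<close> and \<open>p' : [l] \<rightarrow> [m]\<close>.\<close>

definition FI_comp :: "nat \<Rightarrow> nat \<Rightarrow> nat \<Rightarrow> fimor \<Rightarrow> fimor \<Rightarrow> fimor" where
  "FI_comp l m n = (\<lambda>(f, g) (f', g').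
     (compose {1..l} f f',
      restrict (\<lambda>x. if x \<notin> f ` {1..m} then g x else g' (inv_into {1..m} f x))
        ({1..n} - (f \<circ> f') ` {1..l})))"

definition FI_perm :: "nat \<Rightarrow> (nat \<Rightarrow> nat) \<Rightarrow> fimor" where
  "FI_perm n \<sigma> = (restrict \<sigma> {1..n}, \<lambda>_. undefined)"

definition FI_incl :: "nat \<Rightarrow> nat \<Rightarrow> fimor" where
  "FI_incl n c = (restrict id {1..n}, restrict (\<lambda>_. c) {Suc n})"

definition FI_module :: "nat \<Rightarrow> (nat \<Rightarrow> 'v::rat_vector set) \<Rightarrow> (nat \<Rightarrow> nat \<Rightarrow> fimor \<Rightarrow> 'v \<Rightarrow> 'v) \<Rightarrow> bool"
  where "FI_module d V T \<longleftrightarrow> (\<forall>n. rat_vec.subspace (V n))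
     \<and> (\<forall>m n. \<forall>p\<in>FI_hom d m n. T m n p ` V m \<subseteq> V n \<and> lin_on (V m) (T m n p))
     \<and> (\<forall>n. \<forall>x\<in>V n. T n n (FI_perm n id) x = x)
     \<and> (\<forall>l m n. \<forall>p\<in>FI_hom d m n. \<forall>p'\<in>FI_hom d l m. \<forall>x\<in>V l.
          T l n (FI_comp l m n p p') x = T m n p (T l m p' x))"

text \<open>The free module \<open>\<Oplus>\<^sub>m M(U\<^sub>m)\<close>.  As \<open>\<rat>[Hom([m],[n])]\<close> has basis
  \<open>Hom([m],[n])\<close>, its tensor product over \<open>\<rat>\<close> with \<open>U\<^sub>m\<close> is the space of finitely
  supported functions \<open>Hom([m],[n]) \<rightarrow> U\<^sub>m\<close>, with \<open>p \<otimes> u\<close> the function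
  supported at \<open>p\<close> with value \<open>u\<close>.  Tensoring over \<open>\<rat>[S\<^sub>m]\<close> means dividing by the
  relations \<open>p \<sigma> \<otimes> u = p \<otimes> \<sigma> u\<close>.  The degree \<open>n\<close> term is thus
  \<open>free_FI_gens d U n / free_FI_rels d U \<rho> n\<close>, and \<open>free_FI_map\<close> induces the
  functorial maps on these quotients.\<close>

definition free_FI_gens ::
  "nat \<Rightarrow> (nat \<Rightarrow> 'v::rat_vector set) \<Rightarrow> nat \<Rightarrow> (nat \<times> fimor \<Rightarrow>\<^sub>0 'v) set" where
  "free_FI_gens d U n = {x. \<forall>(m, p)\<in>Poly_Mapping.keys x.
     p \<in> FI_hom d m n \<and> Poly_Mapping.lookup x (m, p) \<in> U m}"

definition free_FI_rels ::
  "nat \<Rightarrow> (nat \<Rightarrow> 'v::rat_vector set) \<Rightarrow> (nat \<Rightarrow> (nat \<Rightarrow> nat) \<Rightarrow> 'v \<Rightarrow> 'v) \<Rightarrow> nat \<Rightarrow> (nat \<times> fimor \<Rightarrow>\<^sub>0 'v) set"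
  where "free_FI_rels d U \<rho> n = rat_vec.span
     {Poly_Mapping.single (m, FI_comp m m n p (FI_perm m \<sigma>)) u - Poly_Mapping.single (m, p) (\<rho> m \<sigma> u)
       |m p \<sigma> u. p \<in> FI_hom d m n \<and> \<sigma> permutes {1..m} \<and> u \<in> U m}"

definition free_FI_map ::
  "nat \<Rightarrow> nat \<Rightarrow> fimor \<Rightarrow> (nat \<times> fimor \<Rightarrow>\<^sub>0 'v::rat_vector) \<Rightarrow> (nat \<times> fimor \<Rightarrow>\<^sub>0 'v)" where
  "free_FI_map n n' q x = (\<Sum>(m, p)\<in>Poly_Mapping.keys x.
     Poly_Mapping.single (m, FI_comp m n n' q p) (Poly_Mapping.lookup x (m, p)))"

text \<open>Taking the \<open>U\<^sub>m\<close> inside the type of the module is no restriction: if \<open>V\<close> is isomorphic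
  to \<open>\<Oplus>\<^sub>m M(U\<^sub>m)\<close>, then \<open>U\<^sub>m\<close> embeds into \<open>V m\<close>.\<close>

definition FI_free :: "nat \<Rightarrow> (nat \<Rightarrow> 'v::rat_vector set) \<Rightarrow> (nat \<Rightarrow> nat \<Rightarrow> fimor \<Rightarrow> 'v \<Rightarrow> 'v) \<Rightarrow> bool"
  where "FI_free d V T \<longleftrightarrow> FI_module d V T \<and>
     (\<exists>(U :: nat \<Rightarrow> 'v set) \<rho> \<phi>. (\<forall>m. rep_on m (U m) (\<rho> m))
        \<and> (\<forall>n. quotient_iso (free_FI_gens d U n) (free_FI_rels d U \<rho> n) (\<phi> n) (V n))
        \<and> (\<forall>n n'. \<forall>q\<in>FI_hom d n n'. \<forall>x\<in>free_FI_gens d U n.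
             \<phi> n' (coset (free_FI_rels d U \<rho> n') (free_FI_map n n' q x))
               = T n n' q (\<phi> n (coset (free_FI_rels d U \<rho> n) x))))"


section \<open>Submodules generated by high-insertion maps\<close>

text \<open>The chosen high-insertion maps are \<open>[\<iota>\<^sub>j]\<close> for \<open>j\<close> in the list \<open>js\<close>; the colour
  \<open>c < length js\<close> corresponds to \<open>[\<iota>\<^sub>j]\<close> with \<open>j = js ! c\<close>.\<close>

definition FI_closed :: "nat \<Rightarrow> nat list \<Rightarrow> (nat \<Rightarrow> homology set) \<Rightarrow> bool" where
  "FI_closed k js W \<longleftrightarrow> (\<forall>n. W n \<subseteq> Hcell k n \<and> rep_on n (W n) hact
     \<and> (\<forall>j\<in>set js. high_insertion k n j ` W n \<subseteq> W (Suc n)))"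

definition generated :: "nat \<Rightarrow> nat list \<Rightarrow> nat \<Rightarrow> homology set \<Rightarrow> nat \<Rightarrow> homology set" where
  "generated k js r V n = \<Inter> {W n |W. FI_closed k js W \<and> V \<subseteq> W r}"

text \<open>\<open>T\<close> is the \<open>FI\<^sub>d\<close>-action (\<open>d = length js\<close>) on the sequence \<open>W\<close> given by the
  \<open>S\<^sub>n\<close>-actions and the chosen high-insertion maps.  These morphisms generate \<open>FI\<^sub>d\<close>, so
  there is at most one such action.\<close>

definition FI_action ::
  "nat \<Rightarrow> nat list \<Rightarrow> (nat \<Rightarrow> homology set) \<Rightarrow> (nat \<Rightarrow> nat \<Rightarrow> fimor \<Rightarrow> homology \<Rightarrow> homology) \<Rightarrow> bool"
  where "FI_action k js W T \<longleftrightarrow> FI_module (length js) W T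
     \<and> (\<forall>n \<sigma>. \<sigma> permutes {1..n} \<longrightarrow> (\<forall>x\<in>W n. T n n (FI_perm n \<sigma>) x = hact \<sigma> x))
     \<and> (\<forall>n. \<forall>c<length js. \<forall>x\<in>W n. T n (Suc n) (FI_incl n c) x = high_insertion k n (js ! c) x)"

definition free_submodule :: "nat \<Rightarrow> nat list \<Rightarrow> (nat \<Rightarrow> homology set) \<Rightarrow> bool" where
  "free_submodule k js W \<longleftrightarrow> FI_closed k js W \<and>
     (\<exists>T. FI_action k js W T \<and> FI_free (length js) W T)"

end

theory Submission
  imports Defs
begin

text \<open>
  The proof linearizes the problem by one invariant.  Send a cell \<open>\<alpha>|a b|\<beta>\<close> with a single pair
  block to \<open>(-1)^|\<alpha>|\<close> times the triple of the set of labels of \<open>\<alpha>\<close>, the label \<open>a\<close> and the label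
  \<open>b\<close>.  This \<open>trace\<close> kills boundaries (\<open>trace_bd\<close>), commutes with relabeling, does not notice a
  singleton added on the right, and is triangular on the basis elements
  (\<open>crit_class_trace_independent\<close>).  So it is injective on the span of the basis elements, and
  there the high insertion maps are recognized by what they do to traces
  (\<open>high_insertion_trace\<close>): \<open>[\<iota>\<^sub>1]\<close> leaves them unchanged, and \<open>[\<iota>\<^sub>0]\<close> changes the sign and adds
  \<open>n + 1\<close> to the set of left labels.

  Writing \<open>2 (a b) = (a b - b a) + (a b + b a)\<close>, twice a basis element of type A is an alternating
  hexagon surrounded by singletons plus elements of type B (\<open>two_crit_class\<close>).  Singletons on the
  same side of a cycle commute in homology, so the class of such a hexagon on labels \<open>a, b, c\<close>
  only depends on the set \<open>T\<close> of the labels inside it or to its left; call it \<open>hex n T a b c\<close>.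
  The boundary of the permutohedron of order four gives the only further relation needed
  (\<open>hex_relation\<close>): modulo classes on smaller sets, an alternating sum over four labels of \<open>T\<close>
  vanishes.  In other words, modulo smaller sets the hexagons on \<open>T\<close> are a quotient of the
  exterior cube of \<open>\<rat>\<^sup>T\<close> by the image of the contraction \<open>\<partial>\<close> from the fourth exterior power,
  which is the exterior square of the standard representation.

  The point is to lift this quotient to honest classes.  Let \<open>e\<close> be the sum of the labels of \<open>T\<close> and
  take the classes of \<open>e \<and> a \<and> b\<close>, that is, \<open>eta n T a b\<close>, the sum of \<open>hex n T c a b\<close> over \<open>c\<close>.
  They only depend on \<open>a\<close> and \<open>b\<close> modulo \<open>e\<close>, so they span a copy of the exterior square of the
  standard representation, and the formula \<open>\<partial>(e \<and> w) = |T| w - e \<and> \<partial>w\<close> shows that they still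
  generate the quotient (\<open>hex_eta\<close>).  The set \<open>A'\<^sub>n\<^sub>,\<^sub>m\<close> consists of the \<open>eta n T a b\<close> with
  \<open>T\<close> of size \<open>m + 2\<close> and \<open>a < b\<close> different from the minimum of \<open>T\<close>, and the equality of spans
  is an induction on the size of \<open>T\<close> in both directions (\<open>hex_low\<close>, \<open>hex_in_new_span\<close>).

  The part of the trace that uses exactly the labels of \<open>T\<close> separates different sets \<open>T\<close>, and the
  functionals \<open>theta\<close> on it are dual to the chosen elements (\<open>theta_dual\<close>).  This gives
  independence, and freeness as well: degree \<open>n\<close> is the direct sum over \<open>T\<close> of the images of degree
  \<open>m + 2\<close> under injections with image \<open>T\<close>, where injections act by relabeling traces
  (\<open>kernel_rels\<close>).  The same functionals compute the kernel of the map that sends \<open>a \<otimes> b\<close> to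
  \<open>eta\<close> (\<open>wedge_to_eta_kernel\<close>).  Finally every hexagon on all labels comes from the one on three
  labels by \<open>[\<iota>\<^sub>0]\<close> and permutations (\<open>eta_span_sub_generated_0\<close>).
\<close>

section \<open>Chains with singletons on both sides\<close>

abbreviation singles :: "nat list \<Rightarrow> sym" where
  "singles \<equiv> map (\<lambda>x. [x])"

definition sandwich :: "nat list \<Rightarrow> chain \<Rightarrow> nat list \<Rightarrow> chain" where
  "sandwich \<alpha> c \<beta> = lin_ext (\<lambda>e. basis_elt (singles \<alpha> @ e @ singles \<beta>)) c"

lemma sandwich_linear:
  "sandwich \<alpha> (x + y) \<beta> = sandwich \<alpha> x \<beta> + sandwich \<alpha> y \<beta>"
  "sandwich \<alpha> (x - y) \<beta> = sandwich \<alpha> x \<beta> - sandwich \<alpha> y \<beta>"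
  "sandwich \<alpha> (- x) \<beta> = - sandwich \<alpha> x \<beta>"
  "sandwich \<alpha> (r *\<^sub>Q x) \<beta> = r *\<^sub>Q sandwich \<alpha> x \<beta>"
  "sandwich \<alpha> 0 \<beta> = 0"
  by (simp_all add: sandwich_def lin_ext_add lin_ext_diff lin_ext_minus lin_ext_scale)

lemma sandwich_basis_elt:
  "sandwich \<alpha> (basis_elt e) \<beta> = basis_elt (singles \<alpha> @ e @ singles \<beta>)"
  by (simp add: sandwich_def scaleQ_one)

lemma sandwich_sandwich:
  "sandwich \<alpha> (sandwich \<gamma> c \<delta>) \<beta> = sandwich (\<alpha> @ \<gamma>) c (\<delta> @ \<beta>)"
  by (simp add: sandwich_def lin_ext_lin_ext scaleQ_one)

lemma sandwich_Nil: "sandwich [] c [] = c"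
  by (simp add: sandwich_def lin_ext_basis_elt)

lemma relabel_linear:
  "relabel \<sigma> (x + y) = relabel \<sigma> x + relabel \<sigma> y"
  "relabel \<sigma> (x - y) = relabel \<sigma> x - relabel \<sigma> y"
  "relabel \<sigma> (- x) = - relabel \<sigma> x"
  "relabel \<sigma> (r *\<^sub>Q x) = r *\<^sub>Q relabel \<sigma> x"
  "relabel \<sigma> 0 = 0"
  by (simp_all add: relabel_def lin_ext_add lin_ext_diff lin_ext_minus lin_ext_scale)

lemma relabel_basis_elt: "relabel \<sigma> (basis_elt e) = basis_elt (map (map \<sigma>) e)"
  by (simp add: relabel_def scaleQ_one)

lemma relabel_sandwich:
  "relabel \<sigma> (sandwich \<alpha> c \<beta>) = sandwich (map \<sigma> \<alpha>) (relabel \<sigma> c) (map \<sigma> \<beta>)"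
  by (simp add: relabel_def sandwich_def lin_ext_lin_ext scaleQ_one o_def)

lemma keys_sandwich:
  "Poly_Mapping.keys (sandwich \<alpha> c \<beta>) \<subseteq> (\<lambda>e. singles \<alpha> @ e @ singles \<beta>) ` Poly_Mapping.keys c"
  using keys_lin_ext[of "\<lambda>e. basis_elt (singles \<alpha> @ e @ singles \<beta>)" c]
  by (auto simp: sandwich_def)

section \<open>Boundaries\<close>

lemma bd_basis_elt: "bd (basis_elt e) = bd_sym e"
  by (simp add: bd_def scaleQ_one)

lemma concat_chain_linear:
  "concat_chain (x + x') y = concat_chain x y + concat_chain x' y"
  "concat_chain (x - x') y = concat_chain x y - concat_chain x' y"
  "concat_chain (- x) y = - concat_chain x y"
  "concat_chain 0 y = 0"
  by (simp_all add: concat_chain_def lin_ext_add lin_ext_diff lin_ext_minus)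

lemma concat_chain_basis_elt:
  "concat_chain (basis_elt e) y = lin_ext (\<lambda>f. basis_elt (e @ f)) y"
  "concat_chain x (basis_elt f) = lin_ext (\<lambda>e. basis_elt (e @ f)) x"
  "concat_chain (basis_elt e) (basis_elt f) = basis_elt (e @ f)"
  by (simp_all add: concat_chain_def scaleQ_one)

text \<open>The letters of \<open>g\<close> being distinct, the permutation taking \<open>g\<close> to a given rearrangement is
  unique; this evaluates the definite description in the sign of a splitting.\<close>

lemma split_perm_eq:
  assumes "distinct g" "p permutes {..<length g}" "permute_list p g = nths g I @ nths g (- I)"
  shows "split_perm I g = p"
  unfolding split_perm_def
proof (rule the_equality)
  fix q assume q: "q permutes {..<length g} \<and> permute_list q g = nths g I @ nths g (- I)"
  show "q = p"
  proof
    fix i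
    show "q i = p i"
    proof (cases "i < length g")
      case True
      have "g ! q i = g ! p i"
        using True q assms(2,3) permute_list_nth[of q g i] permute_list_nth[of p g i] by simp
      moreover have "q i < length g" "p i < length g"
        using True q assms(2) permutes_in_image[of q "{..<length g}" i]
          permutes_in_image[of p "{..<length g}" i] by simp_all
      ultimately show ?thesis using assms(1) by (simp add: nth_eq_iff_index_eq)
    next
      case False
      then show ?thesis using q assms(2) by (simp add: permutes_def)
    qed
  qed
qed (use assms in auto)

lemma permute_list_pair: "permute_list p [a, b] = [[a, b] ! p 0, [a, b] ! p 1]"
  by (simp add: permute_list_def)

lemma permute_list_triple:
  "permute_list p [a, b, c] = [[a, b, c] ! p 0, [a, b, c] ! p 1, [a, b, c] ! p 2]"
  by (simp add: permute_list_def numeral_eq_Suc)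

lemma bd_block_single: "bd_block [x] = 0"
proof -
  have I: "{I. I \<subset> {..<length [x]} \<and> I \<noteq> {}} = {}"
    by (auto simp: lessThan_Suc)
  show ?thesis unfolding bd_block_def I by simp
qed

lemma bd_block_pair:
  assumes "a \<noteq> b"
  shows "bd_block [a, b] = basis_elt [[a], [b]] - basis_elt [[b], [a]]"
proof -
  have I: "{I. I \<subset> {..<length [a, b]} \<and> I \<noteq> {}} = {{0}, {1}}"
  proof -
    have "{I. I \<subset> {..<length [a, b]} \<and> I \<noteq> {}} = Pow {..<2} - {{}, {..<2}}"
      by auto
    also have "{..<2 :: nat} = {0, 1}" by auto
    finally show ?thesis by (auto simp: Pow_insert)
  qed
  have p0: "split_perm {0} [a, b] = id"
    using assms by (intro split_perm_eq) (auto simp: nths_Cons)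
  have p1: "split_perm {1} [a, b] = transpose 0 1"
    using assms by (intro split_perm_eq permutes_swap_id)
      (auto simp: nths_Cons permute_list_pair transpose_def)
  show ?thesis
    unfolding bd_block_def I
    by (simp add: p0 p1[simplified] sign_swap_id nths_Cons scaleQ_one)
qed

lemma bd_321:
  "bd (basis_elt [[3, 2, 1]]) = basis_elt [[3], [2, 1]] - basis_elt [[2], [3, 1]] + basis_elt [[1], [3, 2]]
     + basis_elt [[3, 2], [1]] - basis_elt [[3, 1], [2]] + basis_elt [[2, 1], [3]]"
proof -
  have I: "{I. I \<subset> {..<length [3, 2, 1 :: nat]} \<and> I \<noteq> {}} = {{0}, {1}, {2}, {0,1}, {0,2}, {1,2}}"
  proof -
    have "{I. I \<subset> {..<length [3, 2, 1 :: nat]} \<and> I \<noteq> {}} = Pow {..<3} - {{}, {..<3}}"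
      by auto
    also have "{..<3 :: nat} = {0, 1, 2}" by auto
    also have "Pow {0, 1, 2 :: nat} = {{}, {0,1,2}} \<union> {{0}, {1}, {2}, {0,1}, {0,2}, {1,2}}"
      by (simp add: Pow_insert insert_commute)
    also have "\<dots> - {{}, {0,1,2}} = {{0}, {1}, {2}, {0,1}, {0,2}, {1,2}}"
    proof -
      have "A \<union> B - A = B" if "A \<inter> B = {}" for A B :: "nat set set"
        using that by blast
      moreover have "{{}, {0,1,2}} \<inter> {{0}, {1}, {2}, {0,1}, {0,2}, {1,2::nat}} = {}"
        by (simp add: doubleton_eq_iff insert_eq_iff)
      ultimately show ?thesis .
    qed
    finally show ?thesis .
  qed
  let ?g = "[3, 2, 1 :: nat]"
  have p0: "split_perm {0} ?g = id"
    by (intro split_perm_eq) (auto simp: nths_Cons)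
  have p1: "split_perm {1} ?g = transpose 0 1"
    by (intro split_perm_eq permutes_swap_id) (auto simp: nths_Cons permute_list_triple transpose_def)
  have p2: "split_perm {2} ?g = transpose 0 2 \<circ> transpose 1 2"
    by (intro split_perm_eq permutes_compose permutes_swap_id)
      (auto simp: nths_Cons permute_list_triple transpose_def)
  have p01: "split_perm {0,1} ?g = id"
    by (intro split_perm_eq) (auto simp: nths_Cons)
  have p02: "split_perm {0,2} ?g = transpose 1 2"
    by (intro split_perm_eq permutes_swap_id) (auto simp: nths_Cons permute_list_triple transpose_def)
  have p12: "split_perm {1,2} ?g = transpose 1 2 \<circ> transpose 0 2"
    by (intro split_perm_eq permutes_compose permutes_swap_id)
      (auto simp: nths_Cons permute_list_triple transpose_def)
  have ne: "{0} \<noteq> {1::nat}" "{0} \<noteq> {2::nat}" "{0} \<noteq> {0,1::nat}" "{0} \<noteq> {0,2::nat}"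
    "{0} \<noteq> {1,2::nat}" "{1} \<noteq> {2::nat}" "{1} \<noteq> {0,1::nat}" "{1} \<noteq> {0,2::nat}" "{1} \<noteq> {1,2::nat}"
    "{2} \<noteq> {0,1::nat}" "{2} \<noteq> {0,2::nat}" "{2} \<noteq> {1,2::nat}" "{0,1} \<noteq> {0,2::nat}"
    "{0,1} \<noteq> {1,2::nat}" "{0,2} \<noteq> {1,2::nat}"
    by (simp_all add: doubleton_eq_iff)
  have sgn: "sign (transpose 0 2 \<circ> transpose 1 (2::nat)) = 1"
     "sign (transpose 1 2 \<circ> transpose 0 (2::nat)) = 1"
    by (simp_all add: sign_compose permutation_swap_id sign_swap_id)
  have b: "bd_block ?g = basis_elt [[3], [2, 1]] - basis_elt [[2], [3, 1]] + basis_elt [[1], [3, 2]]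
     + basis_elt [[3, 2], [1]] - basis_elt [[3, 1], [2]] + basis_elt [[2, 1], [3]]"
    unfolding bd_block_def I using ne
    by (simp only: sum.insert finite.intros insert_iff empty_iff simp_thms sum.empty
        p0 p1 p2 p01 p02 p12 sgn) (simp add: sign_swap_id nths_Cons)
  show ?thesis
    by (simp add: bd_basis_elt concat_chain_basis_elt concat_chain_linear lin_ext_basis_elt
        b[simplified])
qed

lemma bd_sym_single: "bd_sym ([x] # e) = - sandwich [x] (bd_sym e) []"
  by (simp add: bd_block_single concat_chain_linear concat_chain_basis_elt sandwich_def)

lemma bd_sym_pair:
  assumes "a \<noteq> b"
  shows "bd_sym ([a, b] # e) = basis_elt ([a] # [b] # e) - basis_elt ([b] # [a] # e)
     - lin_ext (\<lambda>f. basis_elt ([a, b] # f)) (bd_sym e)"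
  using assms by (simp add: bd_block_pair concat_chain_linear concat_chain_basis_elt lin_ext_diff)

text \<open>The Leibniz rule when the left or the right factor consists of singletons.\<close>

lemma bd_sym_append_singles: "bd_sym (e @ singles \<beta>) = sandwich [] (bd_sym e) \<beta>"
proof (induction e)
  case Nil
  have "bd_sym (singles \<beta>) = 0"
    by (induction \<beta>) (simp_all add: bd_sym_single sandwich_linear del: bd_sym.simps(2))
  then show ?case by (simp add: sandwich_linear)
next
  case (Cons g e)
  then show ?case
    by (simp add: concat_chain_def sandwich_def lin_ext_lin_ext lin_ext_diff scaleQ_one)
qed

lemma bd_sym_singles_append:
  "bd_sym (singles \<alpha> @ e) = (- 1) ^ length \<alpha> *\<^sub>Q sandwich \<alpha> (bd_sym e) []"
  by (induction \<alpha>)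
    (simp_all add: sandwich_Nil scaleQ_one bd_sym_single sandwich_linear sandwich_sandwich
      del: bd_sym.simps(2))

lemma bd_sandwich: "bd (sandwich \<alpha> c \<beta>) = (- 1) ^ length \<alpha> *\<^sub>Q sandwich \<alpha> (bd c) \<beta>"
proof -
  have "bd (sandwich \<alpha> c \<beta>)
      = lin_ext (\<lambda>e. (- 1) ^ length \<alpha> *\<^sub>Q sandwich \<alpha> (bd_sym e) \<beta>) c"
    by (simp add: bd_def sandwich_def lin_ext_lin_ext scaleQ_one bd_sym_singles_append
        bd_sym_append_singles sandwich_sandwich[unfolded sandwich_def])
  also have "\<dots> = (- 1) ^ length \<alpha> *\<^sub>Q sandwich \<alpha> (bd c) \<beta>"
    unfolding sandwich_def bd_def lin_ext_lin_ext
    by (simp add: lin_ext_def[of _ c] rat_vec.scale_sum_right scaleQ_scaleQ mult.commute)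
  finally show ?thesis .
qed

section \<open>Cycles and their classes\<close>

definition cycles1 :: "nat set \<Rightarrow> chain set" where
  "cycles1 C = {c. Poly_Mapping.keys c \<subseteq> {e \<in> symbols2 C. cell_dim e = 1} \<and> bd c = 0}"

lemma subspace_cycles1: "rat_vec.subspace (cycles1 C)"
proof -
  have "cycles1 C = {c. Poly_Mapping.keys c \<subseteq> {e \<in> symbols2 C. cell_dim e = 1}} \<inter> {c. bd c = 0}"
    by (auto simp: cycles1_def)
  moreover have "rat_vec.subspace {c. bd c = 0}"
    by (simp add: rat_vec.subspace_def bd_add bd_scale)
  ultimately show ?thesis
    using subspace_keys by (auto intro: rat_vec.subspace_inter)
qed

lemmas cycles1_add = rat_vec.subspace_add[OF subspace_cycles1]
lemmas cycles1_scale = rat_vec.subspace_scale[OF subspace_cycles1]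
lemmas cycles1_diff = rat_vec.subspace_diff[OF subspace_cycles1]
lemmas cycles1_neg = rat_vec.subspace_neg[OF subspace_cycles1]
lemmas cycles1_0 = rat_vec.subspace_0[OF subspace_cycles1]

lemma Hcell_1: "Hcell 1 n = hclass ` cycles1 {1..n}"
  by (simp add: Hcell_def chains2_def cycles1_def)

lemma cycles1_homologous: "x \<in> cycles1 C \<Longrightarrow> homologous x x"
  by (auto simp: homologous_cycles cycles1_def all_chains2_def)

lemma hclass_add: "homologous x x \<Longrightarrow> homologous y y \<Longrightarrow> hclass (x + y) = hclass x + hclass y"
  by (simp add: plus_homology.abs_eq)

lemma hclass_scale: "homologous x x \<Longrightarrow> hclass (r *\<^sub>Q x) = r *\<^sub>Q hclass x"
  by (simp add: scaleQ_homology.abs_eq)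

lemma hclass_0: "hclass 0 = 0"
  by (simp add: zero_homology_def)

lemma hact_hclass: "inj \<sigma> \<Longrightarrow> homologous x x \<Longrightarrow> hact \<sigma> (hclass x) = hclass (relabel \<sigma> x)"
  by (simp add: hact.abs_eq)

lemma hclass_eqI:
  assumes "x \<in> cycles1 C" "y \<in> cycles1 C" "w \<in> all_chains2" "x - y = bd w"
  shows "hclass x = hclass y"
proof -
  have "homologous x y"
    using assms by (auto simp: homologous_def cycles1_def all_chains2_def)
  then show ?thesis
    using Quotient3_rel[OF Quotient3_homology, of x y] cycles1_homologous assms(1,2) by auto
qed

lemma hclass_linear_cycles1:
  assumes "x \<in> cycles1 C" "y \<in> cycles1 C"
  shows "hclass (x + y) = hclass x + hclass y" "hclass (r *\<^sub>Q x) = r *\<^sub>Q hclass x"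
    "hclass (- x) = - hclass x" "hclass (x - y) = hclass x - hclass y"
proof -
  note h = cycles1_homologous[OF assms(1)] cycles1_homologous[OF assms(2)]
  show a: "hclass (x + y) = hclass x + hclass y" and s: "hclass (r *\<^sub>Q x) = r *\<^sub>Q hclass x"
    using h by (simp_all add: hclass_add hclass_scale)
  show m: "hclass (- x) = - hclass x"
    using h by (simp add: uminus_homology.abs_eq)
  show "hclass (x - y) = hclass x - hclass y"
    using hclass_add[OF h(1) cycles1_homologous[OF cycles1_neg[OF assms(2)]]] 
      uminus_homology.abs_eq[OF h(2)] by simp
qed

lemma Hcell_subspace: "rat_vec.subspace (Hcell 1 n)"
  unfolding rat_vec.subspace_def Hcell_1
proof (intro conjI ballI allI)
  show "0 \<in> hclass ` cycles1 {1..n}"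
    using cycles1_0 hclass_0 by (metis image_eqI)
  fix x y r assume x: "x \<in> hclass ` cycles1 {1..n}" 
  then show "r *\<^sub>Q x \<in> hclass ` cycles1 {1..n}"
    by (auto simp flip: hclass_linear_cycles1(2) intro: cycles1_scale)
  show "x + y \<in> hclass ` cycles1 {1..n}" if "y \<in> hclass ` cycles1 {1..n}"
    using x that by (auto simp flip: hclass_linear_cycles1(1) intro: cycles1_add)
qed

lemma concat_singles [simp]: "concat (singles \<alpha>) = \<alpha>"
  by (induction \<alpha>) auto

lemma symbols2_sandwich:
  assumes "e \<in> symbols2 C" "distinct (\<alpha> @ \<beta>)" "set (\<alpha> @ \<beta>) \<inter> C = {}"
  shows "singles \<alpha> @ e @ singles \<beta> \<in> symbols2 (set \<alpha> \<union> C \<union> set \<beta>)"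
    "cell_dim (singles \<alpha> @ e @ singles \<beta>) = cell_dim e"
  using assms by (auto simp: symbols2_def symbols_def cell_dim_def)

lemma cycles1_sandwich:
  assumes "c \<in> cycles1 C" "distinct (\<alpha> @ \<beta>)" "set (\<alpha> @ \<beta>) \<inter> C = {}"
  shows "sandwich \<alpha> c \<beta> \<in> cycles1 (set \<alpha> \<union> C \<union> set \<beta>)"
proof -
  have "Poly_Mapping.keys (sandwich \<alpha> c \<beta>)
      \<subseteq> {e \<in> symbols2 (set \<alpha> \<union> C \<union> set \<beta>). cell_dim e = 1}"
  proof
    fix f assume "f \<in> Poly_Mapping.keys (sandwich \<alpha> c \<beta>)"
    then obtain e where "e \<in> Poly_Mapping.keys c" "f = singles \<alpha> @ e @ singles \<beta>"
      using keys_sandwich by blast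
    then show "f \<in> {e \<in> symbols2 (set \<alpha> \<union> C \<union> set \<beta>). cell_dim e = 1}"
      using assms symbols2_sandwich[of e C \<alpha> \<beta>] by (auto simp: cycles1_def)
  qed
  then show ?thesis
    using assms(1) by (simp add: cycles1_def bd_sandwich sandwich_linear)
qed

section \<open>The trace, a linear invariant of homology in degree one\<close>

type_synonym trace = "(nat set \<times> nat \<times> nat) \<Rightarrow>\<^sub>0 rat"

definition add_left :: "nat set \<Rightarrow> trace \<Rightarrow> trace" where
  "add_left P = lin_ext (\<lambda>(S, a, b). basis_elt (P \<union> S, a, b))"

definition relabel_trace :: "(nat \<Rightarrow> nat) \<Rightarrow> trace \<Rightarrow> trace" where
  "relabel_trace f = lin_ext (\<lambda>(S, a, b). basis_elt (f ` S, f a, f b))"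

definition all_singletons :: "sym \<Rightarrow> bool" where
  "all_singletons e \<longleftrightarrow> (\<forall>g\<in>set e. length g = 1)"

text \<open>The trace of \<open>\<alpha>|a b|\<beta>\<close> is the triple \<open>(set \<alpha>, a, b)\<close> with sign \<open>(-1)^|\<alpha>|\<close>; the recursion
  collects the left labels and the sign one singleton at a time. The sign is the one with which
  the boundary of the pair enters the boundary of the cell. Cells with no pair or several pairs
  get trace 0.\<close>

fun trace_sym :: "sym \<Rightarrow> trace" where
  "trace_sym ([x] # e) = - add_left {x} (trace_sym e)"
| "trace_sym ([a, b] # e) = (if all_singletons e then basis_elt ({}, a, b) else 0)"
| "trace_sym _ = 0"

definition trace_chain :: "chain \<Rightarrow> trace" where
  "trace_chain = lin_ext trace_sym"

lemma add_left_linear: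
  "add_left P (x + y) = add_left P x + add_left P y"
  "add_left P (x - y) = add_left P x - add_left P y"
  "add_left P (- x) = - add_left P x"
  "add_left P (r *\<^sub>Q x) = r *\<^sub>Q add_left P x"
  "add_left P 0 = 0"
  "add_left P (sum g A) = (\<Sum>a\<in>A. add_left P (g a))"
  by (simp_all add: add_left_def lin_ext_add lin_ext_diff lin_ext_minus lin_ext_scale lin_ext_sum)

lemma add_left_basis_elt: "add_left P (basis_elt (S, a, b)) = basis_elt (P \<union> S, a, b)"
  by (simp add: add_left_def)

lemma add_left_add_left: "add_left P (add_left Q x) = add_left (P \<union> Q) x"
  by (simp add: add_left_def lin_ext_lin_ext case_prod_unfold Un_assoc)

lemma add_left_empty: "add_left {} x = x"
  by (simp add: add_left_def case_prod_unfold lin_ext_basis_elt)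

lemma relabel_trace_linear:
  "relabel_trace f (x + y) = relabel_trace f x + relabel_trace f y"
  "relabel_trace f (x - y) = relabel_trace f x - relabel_trace f y"
  "relabel_trace f (- x) = - relabel_trace f x"
  "relabel_trace f (r *\<^sub>Q x) = r *\<^sub>Q relabel_trace f x"
  "relabel_trace f 0 = 0"
  "relabel_trace f (sum g A) = (\<Sum>a\<in>A. relabel_trace f (g a))"
  by (simp_all add: relabel_trace_def lin_ext_add lin_ext_diff lin_ext_minus lin_ext_scale
      lin_ext_sum)

lemma relabel_trace_basis_elt:
  "relabel_trace f (basis_elt (S, a, b)) = basis_elt (f ` S, f a, f b)"
  by (simp add: relabel_trace_def)

lemma relabel_trace_comp: "relabel_trace f (relabel_trace g x) = relabel_trace (f \<circ> g) x"
  by (simp add: relabel_trace_def lin_ext_lin_ext case_prod_unfold image_comp)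

lemma relabel_trace_add_left:
  "relabel_trace f (add_left P x) = add_left (f ` P) (relabel_trace f x)"
  by (simp add: relabel_trace_def add_left_def lin_ext_lin_ext case_prod_unfold image_Un)

lemma trace_chain_linear:
  "trace_chain (x + y) = trace_chain x + trace_chain y"
  "trace_chain (x - y) = trace_chain x - trace_chain y"
  "trace_chain (- x) = - trace_chain x"
  "trace_chain (r *\<^sub>Q x) = r *\<^sub>Q trace_chain x"
  "trace_chain 0 = 0"
  "trace_chain (sum g A) = (\<Sum>a\<in>A. trace_chain (g a))"
  by (simp_all add: trace_chain_def lin_ext_add lin_ext_diff lin_ext_minus lin_ext_scale
      lin_ext_sum)

lemma trace_chain_basis_elt: "trace_chain (basis_elt e) = trace_sym e"
  by (simp add: trace_chain_def)

lemma all_singletons_simps: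
  "all_singletons (g # e) \<longleftrightarrow> length g = 1 \<and> all_singletons e"
  "all_singletons []"
  "all_singletons (e @ f) \<longleftrightarrow> all_singletons e \<and> all_singletons f"
  "all_singletons (singles \<alpha>)"
  by (auto simp: all_singletons_def)

lemma trace_sym_append_singles: "trace_sym (e @ singles \<beta>) = trace_sym e"
proof (induction e rule: trace_sym.induct)
  case "3_1"
  have "trace_sym (singles \<beta>) = 0"
    by (induction \<beta>) (simp_all add: add_left_linear)
  then show ?case by simp
qed (simp_all add: all_singletons_simps)

lemma trace_sym_singles_append:
  "trace_sym (singles \<alpha> @ e) = (- 1) ^ length \<alpha> *\<^sub>Q add_left (set \<alpha>) (trace_sym e)"
  by (induction \<alpha>) (simp_all add: add_left_linear add_left_add_left add_left_empty)

lemma trace_sandwich: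
  "trace_chain (sandwich \<alpha> c \<beta>) = (- 1) ^ length \<alpha> *\<^sub>Q add_left (set \<alpha>) (trace_chain c)"
proof -
  have "trace_chain (sandwich \<alpha> c \<beta>)
      = lin_ext (\<lambda>e. (- 1) ^ length \<alpha> *\<^sub>Q add_left (set \<alpha>) (trace_sym e)) c"
    using trace_sym_append_singles[of "singles \<alpha> @ e" \<beta> for e]
    by (simp add: trace_chain_def sandwich_def lin_ext_lin_ext trace_sym_singles_append)
  also have "\<dots> = (- 1) ^ length \<alpha> *\<^sub>Q add_left (set \<alpha>) (trace_chain c)"
    unfolding add_left_def trace_chain_def lin_ext_lin_ext
    by (simp add: lin_ext_def[of _ c] rat_vec.scale_sum_right scaleQ_scaleQ mult.commute)
  finally show ?thesis .
qed

lemma trace_sym_relabel: "trace_sym (map (map f) e) = relabel_trace f (trace_sym e)"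
proof (induction e rule: trace_sym.induct)
  case (2 a b e)
  have "all_singletons (map (map f) e) = all_singletons e"
    by (simp add: all_singletons_def)
  then show ?case by (simp add: relabel_trace_linear relabel_trace_basis_elt)
qed (simp_all add: relabel_trace_linear relabel_trace_add_left)

lemma trace_relabel: "trace_chain (relabel f c) = relabel_trace f (trace_chain c)"
  by (simp add: trace_chain_def relabel_def relabel_trace_def[of f] lin_ext_lin_ext
      trace_sym_relabel[unfolded relabel_trace_def])

text \<open>Summing the coefficients of the vertices, each boundary of an edge gives zero.\<close>

lemma augmentation_bd_sym:
  assumes "e \<in> symbols2 S"
  shows "lin_ext (\<lambda>f. if all_singletons f then 1 else 0 :: rat) (bd_sym e) = 0"
  using assms
proof (induction e arbitrary: S)
  case (Cons g e)
  have e: "e \<in> symbols2 (set (concat e))" and g: "g \<noteq> []" "length g \<le> 2" "distinct g"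
    using Cons.prems by (auto simp: symbols2_def symbols_def)
  note IH = Cons.IH[OF e]
  from g consider x where "g = [x]" | a b where "g = [a, b]" "a \<noteq> b"
    by (cases g; cases "tl g") auto
  then show ?case
  proof cases
    case 1
    then show ?thesis
      using IH by (simp add: bd_sym_single sandwich_def lin_ext_lin_ext lin_ext_minus
          all_singletons_simps del: bd_sym.simps(2))
  next
    case 2
    have "lin_ext (\<lambda>f. if all_singletons f then 1 else 0 :: rat)
      (lin_ext (\<lambda>f. basis_elt ([a, b] # f)) (bd_sym e)) = 0"
      by (simp add: lin_ext_lin_ext all_singletons_simps) (simp add: lin_ext_def)
    then show ?thesis
      using 2 by (simp add: bd_sym_pair lin_ext_diff all_singletons_simps del: bd_sym.simps(2))
  qed
qed simp

text \<open>In a cell with two pairs, splitting the first pair in its two ways gives the same set of labels to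
  the left of the second one, so these terms cancel; splitting the second pair changes nothing to
  the left of the first, so these terms cancel, too.  The second half only needs that the boundary of
  what follows the first pair has coefficient sum zero on vertices.\<close>

lemma trace_bd_sym:
  assumes "e \<in> symbols2 S"
  shows "trace_chain (bd_sym e) = 0"
  using assms
proof (induction e arbitrary: S)
  case (Cons g e)
  have e: "e \<in> symbols2 (set (concat e))" and g: "g \<noteq> []" "length g \<le> 2" "distinct g"
    using Cons.prems by (auto simp: symbols2_def symbols_def)
  note IH = Cons.IH[OF e]
  from g consider x where "g = [x]" | a b where "g = [a, b]" "a \<noteq> b"
    by (cases g; cases "tl g") auto
  then show ?case
  proof cases
    case 1
    then show ?thesis
      using IH by (simp add: bd_sym_single trace_sandwich trace_chain_linear add_left_linear
          del: bd_sym.simps(2))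
  next
    case 2
    have "trace_chain (lin_ext (\<lambda>f. basis_elt ([a, b] # f)) (bd_sym e))
      = lin_ext (\<lambda>f. lin_ext (\<lambda>_. basis_elt ({}, a, b)) (Poly_Mapping.single () (if all_singletons f then 1 else 0 :: rat))) (bd_sym e)"
      by (auto simp: trace_chain_def lin_ext_lin_ext intro!: lin_ext_cong)
    also have "\<dots> = lin_ext (\<lambda>f. if all_singletons f then 1 else 0 :: rat) (bd_sym e) *\<^sub>Q basis_elt ({}, a, b)"
      by (simp add: lin_ext_def[of _ "bd_sym e"] rat_vec.scale_sum_left scaleQ_scaleQ scaleQ_rat_def)
    also have "\<dots> = 0" by (simp add: augmentation_bd_sym[OF e])
    finally show ?thesis
      using 2 by (simp add: bd_sym_pair trace_chain_linear trace_chain_basis_elt add_left_linear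
          add_left_add_left insert_commute del: bd_sym.simps(2))
  qed
qed (simp add: trace_chain_linear)

lemma trace_bd: "w \<in> all_chains2 \<Longrightarrow> trace_chain (bd w) = 0"
  unfolding trace_chain_def bd_def lin_ext_lin_ext
  by (rule trans[OF lin_ext_cong[of _ _ "\<lambda>_. 0"]])
    (auto simp: all_chains2_def trace_chain_def[symmetric] intro: trace_bd_sym, simp add: lin_ext_def)

lift_definition trace_class :: "homology \<Rightarrow> trace" is trace_chain
proof -
  fix x y assume "homologous x y"
  then obtain w where "w \<in> all_chains2" "x - y = bd w"
    by (auto simp: homologous_def)
  then have "trace_chain (x - y) = 0" by (simp add: trace_bd)
  then show "trace_chain x = trace_chain y" by (simp add: trace_chain_linear)
qed

lemma trace_class_hclass: "homologous x x \<Longrightarrow> trace_class (hclass x) = trace_chain x"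
  by (simp add: trace_class.abs_eq)

lemma trace_class_add: "trace_class (x + y) = trace_class x + trace_class y"
  by transfer (simp add: trace_chain_linear)

lemma trace_class_scale: "trace_class (r *\<^sub>Q x) = r *\<^sub>Q trace_class x"
  by transfer (simp add: trace_chain_linear)

lemma trace_class_0 [simp]: "trace_class 0 = 0"
  by transfer (simp add: trace_chain_linear)

lemma trace_class_diff: "trace_class (x - y) = trace_class x - trace_class y"
  by (metis add_diff_cancel_right' diff_add_cancel trace_class_add)

lemma trace_class_sum: "trace_class (sum g A) = (\<Sum>a\<in>A. trace_class (g a))"
  by (induction A rule: infinite_finite_induct) (simp_all add: trace_class_add)

lemma trace_class_hact: "inj \<sigma> \<Longrightarrow> trace_class (hact \<sigma> x) = relabel_trace \<sigma> (trace_class x)"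
  by transfer (simp add: trace_relabel)

section \<open>Critical symbols with one pair\<close>

definition dlist :: "nat set \<Rightarrow> nat list" where
  "dlist S = rev (sorted_list_of_set S)"

lemma dlist_props:
  assumes "finite S"
  shows "set (dlist S) = S" "distinct (dlist S)" "sorted_wrt (>) (dlist S)" "length (dlist S) = card S"
  using assms by (simp_all add: dlist_def sorted_wrt_rev)

lemma dlist_set: "sorted_wrt (>) \<alpha> \<Longrightarrow> dlist (set \<alpha>) = \<alpha>"
proof -
  assume "sorted_wrt (>) \<alpha>"
  then have "sorted_wrt (<) (rev \<alpha>)" by (simp add: sorted_wrt_rev)
  then have "sorted_list_of_set (set (rev \<alpha>)) = rev \<alpha>"
    by (intro sorted_list_of_set.idem_if_sorted_distinct) (simp_all add: strict_sorted_iff)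
  then show ?thesis by (simp add: dlist_def)
qed

lemma dlist_insert_max:
  assumes "finite S" "\<forall>x\<in>S. x < k"
  shows "dlist (insert k S) = k # dlist S"
  using dlist_set[of "k # dlist S"] dlist_props[OF assms(1)] assms(2) by simp

lemma dlist_insert_min:
  assumes "finite S" "\<forall>x\<in>S. k < x"
  shows "dlist (insert k S) = dlist S @ [k]"
  using dlist_set[of "dlist S @ [k]"] dlist_props[OF assms(1)] assms(2)
  by (simp add: sorted_wrt_append)

text \<open>There is only one pair block, so the condition on consecutive singletons splits into one
  condition on each side of it, and the condition on followers concerns this block alone.\<close>

lemma critical_pair_iff:
  assumes "a \<noteq> b"
  shows "critical n (singles \<alpha> @ [a, b] # singles \<beta>) \<longleftrightarrow>
    distinct (\<alpha> @ [a, b] @ \<beta>) \<and> set (\<alpha> @ [a, b] @ \<beta>) = {1..n} \<and>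
    sorted_wrt (>) \<alpha> \<and> sorted_wrt (>) \<beta> \<and> (b < a \<longrightarrow> \<alpha> \<noteq> [] \<and> last \<alpha> < b)"
proof -
  let ?e = "singles \<alpha> @ [a, b] # singles \<beta>"
  let ?P = "\<lambda>g h. length g = 1 \<and> length h = 1 \<longrightarrow> hd g > (hd h :: nat)"
  have symb: "?e \<in> symbols2 {1..n} \<longleftrightarrow> distinct (\<alpha> @ [a, b] @ \<beta>) \<and> set (\<alpha> @ [a, b] @ \<beta>) = {1..n}"
    by (auto simp: symbols2_def symbols_def)
  have s: "successively ?P (singles \<gamma>) = sorted_wrt (>) \<gamma>" for \<gamma>
    by (simp add: successively_map successively_conv_sorted_wrt)
  have "(\<forall>i. Suc i < length ?e \<and> length (?e ! i) = 1 \<and> length (?e ! Suc i) = 1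
      \<longrightarrow> hd (?e ! i) > hd (?e ! Suc i)) \<longleftrightarrow> successively ?P ?e"
    unfolding successively_conv_nth by blast
  also have "\<dots> \<longleftrightarrow> sorted_wrt (>) \<alpha> \<and> sorted_wrt (>) \<beta>"
    unfolding successively_append_iff s by (auto simp: successively_Cons s[unfolded One_nat_def])
  finally have desc: "(\<forall>i. Suc i < length ?e \<and> length (?e ! i) = 1 \<and> length (?e ! Suc i) = 1
      \<longrightarrow> hd (?e ! i) > hd (?e ! Suc i)) \<longleftrightarrow> sorted_wrt (>) \<alpha> \<and> sorted_wrt (>) \<beta>" .
  have len: "length (?e ! i) = 2 \<longleftrightarrow> i = length \<alpha>" if "i < length ?e" for i
    using that by (auto simp: nth_append nth_Cons split: nat.splits)
  have nth: "?e ! length \<alpha> = [a, b]" by (simp add: nth_append)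
  have "(\<forall>i<length ?e. length (?e ! i) = 2 \<and> ?e ! i ! 0 > ?e ! i ! 1 \<longrightarrow> follower ?e i)
      \<longleftrightarrow> (b < a \<longrightarrow> follower ?e (length \<alpha>))"
    using len nth by auto
  also have "follower ?e (length \<alpha>) \<longleftrightarrow> \<alpha> \<noteq> [] \<and> last \<alpha> < b \<and> last \<alpha> < a"
  proof (cases "\<alpha> = []")
    case False
    then have "?e ! (length \<alpha> - 1) = [last \<alpha>]"
      by (simp add: nth_append last_conv_nth)
    then show ?thesis using False nth by (auto simp: follower_def)
  qed (simp add: follower_def)
  finally have fol: "(\<forall>i<length ?e. length (?e ! i) = 2 \<and> ?e ! i ! 0 > ?e ! i ! 1 \<longrightarrow> follower ?e i)
      \<longleftrightarrow> (b < a \<longrightarrow> \<alpha> \<noteq> [] \<and> last \<alpha> < b)" by auto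
  show ?thesis unfolding critical_def symb desc fol by blast
qed

lemma one_pair_form:
  assumes "e \<in> symbols2 S" "num_pairs e = 1"
  obtains \<alpha> a b \<beta> where "e = singles \<alpha> @ [a, b] # singles \<beta>" "a \<noteq> b"
proof -
  obtain g where "filter (\<lambda>g. length g = 2) e = [g]"
    using assms(2) unfolding num_pairs_def by (cases "filter (\<lambda>g. length g = 2) e") auto
  then obtain us vs where uv: "e = us @ g # vs" "\<forall>u\<in>set us. length u \<noteq> 2" "length g = 2"
    "filter (\<lambda>g. length g = 2) vs = []"
    by (auto simp: filter_eq_Cons_iff)
  have sing: "us' = singles (concat us')" if "\<forall>u\<in>set us'. length u \<noteq> 2" "set us' \<subseteq> set e" for us'
    using that
  proof (induction us')
    case (Cons u us')
    then have "u \<in> set e" "length u \<noteq> 2" by auto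
    moreover from this have "length u \<noteq> 0" "length u \<le> 2"
      using assms(1) by (simp_all add: symbols2_def symbols_def)
    ultimately have "length u = 1" by linarith
    then show ?case using Cons by (cases u) auto
  qed simp
  obtain a b where g: "g = [a, b]" using uv(3) by (auto simp: length_Suc_conv numeral_2_eq_2)
  have "a \<noteq> b" using assms(1) uv(1) g by (auto simp: symbols2_def symbols_def)
  moreover have "us = singles (concat us)" "vs = singles (concat vs)"
    using uv by (auto intro!: sing simp: filter_empty_conv)
  then have "e = singles (concat us) @ [a, b] # singles (concat vs)"
    using uv(1) g by metis
  ultimately show thesis using that by blast
qed

lemma num_pairs_pair: "num_pairs (singles \<alpha> @ [a, b] # singles \<beta>) = 1"
  by (simp add: num_pairs_def filter_map o_def)

text \<open>The singletons on either side of the pair decrease, so a critical symbol with one pair \<open>a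
  b\<close> is determined by \<open>a\<close>, \<open>b\<close> and the set \<open>S\<close> of labels to the left. The label just before the
  pair is the minimum of \<open>S\<close>; if the pair decreases, it has to be below \<open>b\<close>.\<close>

definition crit_index :: "nat \<Rightarrow> (nat set \<times> nat \<times> nat) set" where
  "crit_index n = {(S, a, b). S \<subseteq> {1..n} \<and> a \<in> {1..n} - S \<and> b \<in> {1..n} - S \<and> a \<noteq> b
     \<and> (b < a \<longrightarrow> (\<exists>x\<in>S. x < b))}"

definition crit_sym :: "nat \<Rightarrow> nat set \<times> nat \<times> nat \<Rightarrow> sym" where
  "crit_sym n = (\<lambda>(S, a, b). singles (dlist S) @ [a, b] # singles (dlist ({1..n} - S - {a, b})))"

lemma finite_crit_index: "finite (crit_index n)"
  by (rule finite_subset[of _ "Pow {1..n} \<times> {1..n} \<times> {1..n}"]) (auto simp: crit_index_def)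

lemma last_dlist: "finite S \<Longrightarrow> S \<noteq> {} \<Longrightarrow> last (dlist S) = Min S"
  using dlist_insert_min[of "S - {Min S}" "Min S"] Min_in[of S] Min_le[of S]
  by (fastforce simp: insert_absorb le_neq_implies_less)

lemma dlist_Nil: "finite S \<Longrightarrow> dlist S = [] \<longleftrightarrow> S = {}"
  by (simp add: dlist_def)

lemma crit_sym_critical:
  assumes "t \<in> crit_index n"
  shows "critical n (crit_sym n t)" "num_pairs (crit_sym n t) = 1"
proof -
  obtain S a b where t: "t = (S, a, b)" by (cases t)
  have S: "S \<subseteq> {1..n}" "a \<in> {1..n} - S" "b \<in> {1..n} - S" "a \<noteq> b" "b < a \<longrightarrow> (\<exists>x\<in>S. x < b)"
    using assms by (auto simp: crit_index_def t)
  have fin: "finite S" "finite ({1..n} - S - {a, b})" using S(1) finite_subset by auto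
  have follow: "b < a \<longrightarrow> dlist S \<noteq> [] \<and> last (dlist S) < b"
    using S(5) last_dlist[OF fin(1)] Min_le[OF fin(1)] dlist_Nil[OF fin(1)]
    by (metis empty_iff le_less_trans)
  show "critical n (crit_sym n t)"
    unfolding t crit_sym_def case_prod_conv critical_pair_iff[OF S(4)]
  proof (intro conjI follow)
    show "distinct (dlist S @ [a, b] @ dlist ({1..n} - S - {a, b}))"
      using dlist_props[OF fin(1)] dlist_props[OF fin(2)] S(2-4) by auto
    have "S \<union> ({a, b} \<union> (N - S - {a, b})) = N" if "S \<subseteq> N" "a \<in> N" "b \<in> N" for N
      using that by blast
    then show "set (dlist S @ [a, b] @ dlist ({1..n} - S - {a, b})) = {1..n}"
      using S(1-3) unfolding set_append dlist_props(1)[OF fin(1)] dlist_props(1)[OF fin(2)] by simp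
  qed (simp_all add: dlist_props fin)
  show "num_pairs (crit_sym n t) = 1"
    by (simp add: t crit_sym_def num_pairs_pair)
qed

lemma critical_one_pair_eq:
  "{e. critical n e \<and> num_pairs e = 1} = crit_sym n ` crit_index n"
proof
  show "crit_sym n ` crit_index n \<subseteq> {e. critical n e \<and> num_pairs e = 1}"
    using crit_sym_critical by auto
  show "{e. critical n e \<and> num_pairs e = 1} \<subseteq> crit_sym n ` crit_index n"
  proof safe
    fix e assume e: "critical n e" "num_pairs e = 1"
    then have "e \<in> symbols2 {1..n}" by (simp add: critical_def)
    from one_pair_form[OF this e(2)] obtain \<alpha> a b \<beta>
      where f: "e = singles \<alpha> @ [a, b] # singles \<beta>" "a \<noteq> b" by metis
    note c = e(1)[unfolded f(1) critical_pair_iff[OF f(2)]]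
    have "set \<beta> = {1..n} - set \<alpha> - {a, b}" using c by auto
    then have "e = crit_sym n (set \<alpha>, a, b)"
      using c f dlist_set[of \<alpha>] dlist_set[of \<beta>] by (simp add: crit_sym_def)
    moreover have "(set \<alpha>, a, b) \<in> crit_index n"
      using c f(2) last_in_set[of \<alpha>] unfolding crit_index_def by auto
    ultimately show "e \<in> crit_sym n ` crit_index n" by blast
  qed
qed

section \<open>The cycles of the pieces\<close>

definition pair_cycle :: "nat \<Rightarrow> nat \<Rightarrow> chain" where
  "pair_cycle a b = basis_elt [[a, b]] + basis_elt [[b, a]]"

text \<open>The image of \<open>z(1|3 2)\<close> under the relabeling \<open>1, 2, 3 \<mapsto> i, b, a\<close>.\<close>

definition hexagon :: "nat \<Rightarrow> nat \<Rightarrow> nat \<Rightarrow> chain" where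
  "hexagon i b a = basis_elt [[a], [b, i]] - basis_elt [[b], [a, i]] + basis_elt [[i], [a, b]]
     + basis_elt [[a, b], [i]] - basis_elt [[a, i], [b]] + basis_elt [[b, i], [a]]"

lemma piece_cycle_hexagon: "piece_cycle [[i], [a, b]] = hexagon i b a"
  unfolding piece_cycle.simps bd_321 by (simp add: relabel_linear relabel_basis_elt hexagon_def)

lemma pieces_singles: "pieces (singles \<beta>) = map (\<lambda>x. [[x]]) \<beta>"
proof (induction \<beta>)
  case (Cons x \<beta>)
  then show ?case by (cases \<beta>) simp_all
qed simp

lemma pieces_pair:
  "a < b \<Longrightarrow> pieces (singles \<alpha> @ [a, b] # singles \<beta>)
    = map (\<lambda>x. [[x]]) \<alpha> @ [[a, b]] # map (\<lambda>x. [[x]]) \<beta>"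
proof (induction \<alpha>)
  case (Cons x \<alpha>)
  then show ?case by (cases \<alpha>) (simp_all add: pieces_singles)
qed (simp add: pieces_singles)

lemma pieces_hexagon:
  "i < b \<Longrightarrow> b < a \<Longrightarrow> pieces (singles \<alpha> @ [i] # [a, b] # singles \<beta>)
    = map (\<lambda>x. [[x]]) \<alpha> @ [[i], [a, b]] # map (\<lambda>x. [[x]]) \<beta>"
proof (induction \<alpha>)
  case (Cons x \<alpha>)
  then show ?case by (cases \<alpha>) (simp_all add: pieces_singles)
qed (simp add: pieces_singles)

lemma foldr_concat_chain_singles:
  "foldr concat_chain (map piece_cycle (map (\<lambda>x. [[x]]) \<alpha>)) y = sandwich \<alpha> y []"
proof (induction \<alpha>)
  case (Cons x \<alpha>)
  have "concat_chain (basis_elt [[x]]) z = sandwich [x] z []" for z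
    by (simp add: concat_chain_basis_elt sandwich_def)
  then show ?case using Cons by (simp add: sandwich_sandwich)
qed (simp add: sandwich_Nil)

lemma concat_chain_sandwich: "concat_chain c (sandwich \<beta> (basis_elt []) []) = sandwich [] c \<beta>"
  by (simp add: sandwich_basis_elt concat_chain_basis_elt sandwich_def)

lemma zcycle_pair:
  assumes "a < b"
  shows "zcycle (singles \<alpha> @ [a, b] # singles \<beta>) = sandwich \<alpha> (pair_cycle a b) \<beta>"
  unfolding zcycle_def pieces_pair[OF assms] map_append foldr_append list.map(2) foldr_Cons o_def
    foldr_concat_chain_singles[unfolded o_def] 
  by (simp add: foldr_concat_chain_singles[unfolded map_map o_def] concat_chain_sandwich
      sandwich_sandwich pair_cycle_def[symmetric] o_def del: foldr_map)

lemma zcycle_hexagon: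
  assumes "i < b" "b < a"
  shows "zcycle (singles \<alpha> @ [i] # [a, b] # singles \<beta>) = sandwich \<alpha> (hexagon i b a) \<beta>"
  unfolding zcycle_def pieces_hexagon[OF assms] map_append foldr_append list.map(2) foldr_Cons o_def
    foldr_concat_chain_singles[unfolded o_def] 
  by (simp add: foldr_concat_chain_singles[unfolded map_map o_def] concat_chain_sandwich
      sandwich_sandwich piece_cycle_hexagon o_def del: foldr_map piece_cycle.simps)

section \<open>Independence of the basis classes\<close>

lemma single_edge:
  assumes "distinct (concat e)" "set (concat e) = C" "\<forall>g\<in>set e. g \<noteq> [] \<and> length g \<le> 2"
    "length (concat e) = Suc (length e)"
  shows "Poly_Mapping.keys (basis_elt e) \<subseteq> {e \<in> symbols2 C. cell_dim e = 1}"
  using assms by (auto simp: symbols2_def symbols_def cell_dim_def)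

lemma keys_closed:
  fixes x y :: "'a \<Rightarrow>\<^sub>0 'v::rat_vector"
  shows "Poly_Mapping.keys x \<subseteq> A \<Longrightarrow> Poly_Mapping.keys y \<subseteq> A \<Longrightarrow> Poly_Mapping.keys (x + y) \<subseteq> A"
  "Poly_Mapping.keys x \<subseteq> A \<Longrightarrow> Poly_Mapping.keys y \<subseteq> A \<Longrightarrow> Poly_Mapping.keys (x - y) \<subseteq> A"
  using rat_vec.subspace_add[OF subspace_keys[of A], of x y]
    rat_vec.subspace_diff[OF subspace_keys[of A], of x y] by simp_all

lemmas bd_edge_simps = bd_add bd_diff bd_basis_elt bd_sym_single bd_sym_pair sandwich_linear
  sandwich_basis_elt lin_ext_diff

lemma pair_cycle_cycles1: "a \<noteq> b \<Longrightarrow> pair_cycle a b \<in> cycles1 {a, b}"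
  unfolding cycles1_def pair_cycle_def mem_Collect_eq
  by (intro conjI keys_closed single_edge)
    (auto simp: bd_edge_simps simp del: bd_sym.simps(2))

lemma hexagon_cycles1: "distinct [i, b, a] \<Longrightarrow> hexagon i b a \<in> cycles1 {i, b, a}"
  unfolding cycles1_def hexagon_def mem_Collect_eq
  by (intro conjI keys_closed single_edge)
    (auto simp: bd_edge_simps simp del: bd_sym.simps(2))

lemma zcycle_crit_sym_pair:
  assumes "a < b"
  shows "zcycle (crit_sym n (S, a, b)) = sandwich (dlist S) (pair_cycle a b) (dlist ({1..n} - S - {a, b}))"
  using zcycle_pair[OF assms] by (simp add: crit_sym_def)

lemma crit_index_hexagon:
  assumes "(S, a, b) \<in> crit_index n" "b < a"
  shows "finite S" "Min S < b" "Min S \<in> S" "\<forall>x\<in>S - {Min S}. Min S < x" "S = insert (Min S) (S - {Min S})"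
proof -
  show fin: "finite S" using assms by (auto simp: crit_index_def intro: finite_subset)
  obtain x where x: "x \<in> S" "x < b" using assms by (auto simp: crit_index_def)
  show "Min S < b" using Min_le[OF fin x(1)] x(2) by linarith
  show "\<forall>x\<in>S - {Min S}. Min S < x" using Min_le[OF fin] by (auto simp: le_less)
  show "Min S \<in> S" using Min_in[OF fin] x(1) by blast
  then show "S = insert (Min S) (S - {Min S})" by blast
qed

lemma crit_sym_hexagon:
  assumes "(S, a, b) \<in> crit_index n" "b < a"
  shows "crit_sym n (S, a, b)
    = singles (dlist (S - {Min S})) @ [Min S] # [a, b] # singles (dlist ({1..n} - S - {a, b}))"
proof -
  note h = crit_index_hexagon[OF assms]
  have "dlist S = dlist (S - {Min S}) @ [Min S]"
    using dlist_insert_min[of "S - {Min S}" "Min S"] h(1,4) h(5)[symmetric] by simp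
  then show ?thesis by (simp add: crit_sym_def)
qed

lemma zcycle_crit_sym_hexagon:
  assumes "(S, a, b) \<in> crit_index n" "b < a"
  shows "zcycle (crit_sym n (S, a, b))
    = sandwich (dlist (S - {Min S})) (hexagon (Min S) b a) (dlist ({1..n} - S - {a, b}))"
  unfolding crit_sym_hexagon[OF assms]
  using crit_index_hexagon[OF assms] assms(2) by (intro zcycle_hexagon)

lemma crit_indexD:
  assumes "(S, a, b) \<in> crit_index n"
  shows "S \<subseteq> {1..n}" "a \<in> {1..n}" "b \<in> {1..n}" "a \<notin> S" "b \<notin> S" "a \<noteq> b" "finite S"
  using assms by (auto simp: crit_index_def intro: finite_subset)

lemma zcycle_cycles1:
  assumes "t \<in> crit_index n"
  shows "zcycle (crit_sym n t) \<in> cycles1 {1..n}"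
proof -
  obtain S a b where t: "t = (S, a, b)" by (cases t)
  note d = crit_indexD[OF assms[unfolded t]]
  let ?R = "{1..n} - S - {a, b}"
  have fin: "finite ?R" by simp
  consider "a < b" | "b < a" using d by linarith
  then show ?thesis
  proof cases
    case 1
    have "sandwich (dlist S) (pair_cycle a b) (dlist ?R) \<in> cycles1 (set (dlist S) \<union> {a, b} \<union> set (dlist ?R))"
      using d fin by (intro cycles1_sandwich pair_cycle_cycles1) (auto simp: dlist_props)
    moreover have "set (dlist S) \<union> {a, b} \<union> set (dlist ?R) = {1..n}"
      using d(1-3) unfolding dlist_props(1)[OF d(7)] dlist_props(1)[OF fin] by blast
    ultimately show ?thesis using zcycle_crit_sym_pair[OF 1, of n S] t by simp
  next
    case 2
    note h = crit_index_hexagon[OF assms[unfolded t] 2]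
    define i where "i = Min S"
    have fin': "finite (S - {i})" using d by simp
    have "sandwich (dlist (S - {i})) (hexagon i b a) (dlist ?R)
        \<in> cycles1 (set (dlist (S - {i})) \<union> {i, b, a} \<union> set (dlist ?R))"
      using d fin fin' h by (intro cycles1_sandwich hexagon_cycles1) (auto simp: dlist_props i_def)
    moreover have "set (dlist (S - {i})) \<union> {i, b, a} \<union> set (dlist ?R) = {1..n}"
    proof -
      have "(S - {i}) \<union> {i, b, a} \<union> (N - S - {a, b}) = N" if "S \<subseteq> N" "a \<in> N" "b \<in> N" "i \<in> S" for N
        using that by blast
      note U = this
      show ?thesis
        unfolding dlist_props(1)[OF fin'] dlist_props(1)[OF fin]
        by (rule U) (use d(1-3) h(3) i_def in auto)
    qed
    ultimately show ?thesis using zcycle_crit_sym_hexagon[OF assms[unfolded t] 2]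
      unfolding t i_def by simp
  qed
qed

definition crit_class :: "nat \<Rightarrow> nat set \<times> nat \<times> nat \<Rightarrow> homology" where
  "crit_class n t = zclass (crit_sym n t)"

lemma trace_crit_class_pair:
  assumes "(S, a, b) \<in> crit_index n" "a < b"
  shows "trace_class (crit_class n (S, a, b))
    = (- 1) ^ card S *\<^sub>Q (basis_elt (S, a, b) + basis_elt (S, b, a))"
proof -
  note d = crit_indexD[OF assms(1)]
  show ?thesis
    using dlist_props[OF d(7)] cycles1_homologous[OF zcycle_cycles1[OF assms(1)]]
    by (simp add: crit_class_def zclass_def trace_class_hclass zcycle_crit_sym_pair[OF assms(2)]
        trace_sandwich pair_cycle_def trace_chain_linear trace_chain_basis_elt all_singletons_simps
        add_left_linear add_left_basis_elt)
qed

lemma trace_hexagon: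
  "trace_chain (hexagon i b a) = - basis_elt ({a}, b, i) + basis_elt ({b}, a, i) - basis_elt ({i}, a, b)
     + basis_elt ({}, a, b) - basis_elt ({}, a, i) + basis_elt ({}, b, i)"
  by (simp add: hexagon_def trace_chain_linear trace_chain_basis_elt all_singletons_simps
      add_left_basis_elt)

lemma trace_crit_class_hexagon:
  assumes "(S, a, b) \<in> crit_index n" "b < a"
  shows "trace_class (crit_class n (S, a, b))
    = (- 1) ^ card (S - {Min S}) *\<^sub>Q (- basis_elt (insert a (S - {Min S}), b, Min S)
        + basis_elt (insert b (S - {Min S}), a, Min S) - basis_elt (S, a, b)
        + basis_elt (S - {Min S}, a, b) - basis_elt (S - {Min S}, a, Min S)
        + basis_elt (S - {Min S}, b, Min S))"
proof -
  note h = crit_index_hexagon[OF assms]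
  have fin: "finite (S - {Min S})" using h by simp
  have S: "insert (Min S) (S - {Min S}) = S" using h by blast
  show ?thesis
    using dlist_props[OF fin] cycles1_homologous[OF zcycle_cycles1[OF assms(1)]] S
    by (simp add: crit_class_def zclass_def trace_class_hclass zcycle_crit_sym_hexagon[OF assms]
        trace_sandwich trace_hexagon
        add_left_linear add_left_basis_elt)
qed

text \<open>In a vanishing combination, look at a nonzero coefficient \<open>c s\<close> of maximal rank: at the
  place \<open>p s\<close> only \<open>v s\<close> and members of larger rank can contribute.\<close>

lemma triangular_family:
  fixes v :: "'i \<Rightarrow> ('b \<Rightarrow>\<^sub>0 rat)" and r :: "'i \<Rightarrow> nat"
  assumes fin: "finite I"
    and diag: "\<And>t. t \<in> I \<Longrightarrow> Poly_Mapping.lookup (v t) (p t) \<noteq> 0"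
    and off: "\<And>s t. s \<in> I \<Longrightarrow> t \<in> I \<Longrightarrow> Poly_Mapping.lookup (v t) (p s) \<noteq> 0 \<Longrightarrow> s \<noteq> t \<Longrightarrow> r s < r t"
    and zero: "(\<Sum>t\<in>I. c t *\<^sub>Q v t) = 0"
  shows "\<forall>t\<in>I. c t = 0"
proof (rule ccontr)
  assume "\<not> (\<forall>t\<in>I. c t = 0)"
  then have ne: "r ` {t \<in> I. c t \<noteq> 0} \<noteq> {}" by blast
  have fin': "finite (r ` {t \<in> I. c t \<noteq> 0})" using fin by simp
  obtain s where s: "s \<in> I" "c s \<noteq> 0" "r s = Max (r ` {t \<in> I. c t \<noteq> 0})"
    using Max_in[OF fin' ne] by auto
  have max: "r t \<le> r s" if "t \<in> I" "c t \<noteq> 0" for t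
    using Max_ge[OF fin', of "r t"] that s(3) by auto
  have "0 = Poly_Mapping.lookup (\<Sum>t\<in>I. c t *\<^sub>Q v t) (p s)" by (simp add: zero)
  also have "\<dots> = (\<Sum>t\<in>I. c t * Poly_Mapping.lookup (v t) (p s))"
    by (simp add: lookup_sum lookup_scaleQ scaleQ_rat_def)
  also have "\<dots> = (\<Sum>t\<in>I. if t = s then c s * Poly_Mapping.lookup (v s) (p s) else 0)"
    using off[OF s(1)] max by (intro sum.cong) (auto simp: not_le[symmetric])
  also have "\<dots> = c s * Poly_Mapping.lookup (v s) (p s)" using s(1) fin by simp
  finally show False using s(2) diag[OF s(1)] by simp
qed

lemma lookup_basis_elt: "Poly_Mapping.lookup (basis_elt a) b = (if a = b then 1 else 0 :: rat)"
  by (simp add: lookup_single when_def)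

lemma lookup_six_terms:
  assumes "Poly_Mapping.lookup (r *\<^sub>Q (- basis_elt k1 + basis_elt k2 - basis_elt k3
    + basis_elt k4 - basis_elt k5 + basis_elt k6)) k \<noteq> 0"
  shows "k = k3 \<or> k \<in> {k1, k2, k4, k5, k6}"
  using assms by (auto simp: lookup_scaleQ lookup_add lookup_minus scaleQ_rat_def lookup_basis_elt
      split: if_splits)

text \<open>The trace of a basis element with an increasing pair consists of its own triple and the
  one with the pair reversed; it gets the largest rank. For a decreasing pair \<open>a b\<close> preceded by
  \<open>i\<close>, the trace has six terms: the own triple, two terms \<open>(_, b, i)\<close> and \<open>(_, a, i)\<close> with as
  many left labels, none of which is below \<open>i\<close>, so that these triples are not indices, and
  three terms with one left label less. So the rank in this case is the number of left labels.\<close>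

lemma crit_class_trace_independent:
  assumes "(\<Sum>t\<in>crit_index n. c t *\<^sub>Q trace_class (crit_class n t)) = 0"
  shows "\<forall>t\<in>crit_index n. c t = 0"
proof (rule triangular_family[OF finite_crit_index _ _ assms, where p = "\<lambda>t. t"
      and r = "\<lambda>(S, a, b). if a < b then Suc n else card S"])
  fix t assume t: "t \<in> crit_index n"
  obtain S a b where [simp]: "t = (S, a, b)" by (cases t)
  note d = crit_indexD[OF t[simplified]]
  consider "a < b" | "b < a" using d by linarith
  then show "Poly_Mapping.lookup (trace_class (crit_class n t)) t \<noteq> 0"
  proof cases
    case 1
    then show ?thesis using t by (simp add: trace_crit_class_pair lookup_scaleQ lookup_add
          scaleQ_rat_def lookup_basis_elt)
  next
    case 2
    note h = crit_index_hexagon[OF t[simplified] 2]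
    have "S - {Min S} \<noteq> S" using h by blast
    then show ?thesis using t d 2
      by (auto simp add: trace_crit_class_hexagon lookup_scaleQ lookup_add lookup_minus
          scaleQ_rat_def lookup_basis_elt)
  qed
next
  fix s t assume st: "s \<in> crit_index n" "t \<in> crit_index n"
    "Poly_Mapping.lookup (trace_class (crit_class n t)) s \<noteq> 0" "s \<noteq> t"
  obtain S a b where t: "t = (S, a, b)" by (cases t)
  obtain S' a' b' where s: "s = (S', a', b')" by (cases s)
  note d = crit_indexD[OF st(2)[unfolded t]] crit_indexD[OF st(1)[unfolded s]]
  have fol: "\<exists>x\<in>S'. x < b'" if "b' < a'" using that st(1) by (auto simp: s crit_index_def)
  have le: "card S' \<le> n" using card_mono[OF _ d(8)] by simp
  consider "a < b" | "b < a" using d by linarith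
  then have "if a' < b' then a < b \<and> False else if a < b then True else card S' < card S"
  proof cases
    case 1
    then show ?thesis using st d
      by (auto simp: s t trace_crit_class_pair lookup_scaleQ lookup_add
          scaleQ_rat_def lookup_basis_elt split: if_splits)
  next
    case 2
    note h = crit_index_hexagon[OF st(2)[unfolded t] 2]
    have "card (S - {Min S}) < card S" using h by (intro psubset_card_mono) auto
    have "(S', a', b') \<in> {(insert a (S - {Min S}), b, Min S), (insert b (S - {Min S}), a, Min S),
      (S - {Min S}, a, b), (S - {Min S}, a, Min S), (S - {Min S}, b, Min S)}"
      by (rule disj_imp[THEN iffD1, THEN mp, OF lookup_six_terms st(4)[unfolded s t]])
        (rule st(3)[unfolded t s trace_crit_class_hexagon[OF st(2)[unfolded t] 2]])
    moreover have "(S', a', b') \<noteq> (insert a (S - {Min S}), b, Min S)"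
    proof
      assume "(S', a', b') = (insert a (S - {Min S}), b, Min S)"
      then obtain x where "x \<in> insert a (S - {Min S})" "x < Min S" using fol h(2) 2 by auto
      then show False using h(2) h(4)[rule_format, of x] 2 by auto
    qed
    moreover have "(S', a', b') \<noteq> (insert b (S - {Min S}), a, Min S)"
    proof
      assume "(S', a', b') = (insert b (S - {Min S}), a, Min S)"
      then obtain x where "x \<in> insert b (S - {Min S})" "x < Min S" using fol h(2) 2 by auto
      then show False using h(2) h(4)[rule_format, of x] 2 by auto
    qed
    ultimately have "(S', a', b') \<in> {(S - {Min S}, a, b), (S - {Min S}, a, Min S), (S - {Min S}, b, Min S)}"
      by (simp only: insert_iff simp_thms)
    then have "S' = S - {Min S}" "b' < a'" using h(2) 2 by auto
    then show ?thesis using \<open>card (S - {Min S}) < card S\<close> 2 by simp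
  qed
  then show "(case s of (S, a, b) \<Rightarrow> if a < b then Suc n else card S)
      < (case t of (S, a, b) \<Rightarrow> if a < b then Suc n else card S)"
    using le by (auto simp: s t split: if_splits)
qed

lemma family_independent:
  fixes v :: "'i \<Rightarrow> 'v::rat_vector"
  assumes fin: "finite I" and zero: "\<And>c. (\<Sum>t\<in>I. c t *\<^sub>Q v t) = 0 \<Longrightarrow> \<forall>t\<in>I. c t = 0"
  shows "inj_on v I" "rat_vec.independent (v ` I)"
proof -
  show inj: "inj_on v I"
  proof (rule inj_onI, rule ccontr)
    fix s t assume st: "s \<in> I" "t \<in> I" "v s = v t" "s \<noteq> t"
    define c where "c x = (if x = s then 1 else if x = t then - 1 else 0 :: rat)" for x
    have "(\<Sum>x\<in>I. c x *\<^sub>Q v x) = (\<Sum>x\<in>{s, t}. c x *\<^sub>Q v x)"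
      using fin st by (intro sum.mono_neutral_right) (auto simp: c_def)
    also have "\<dots> = 0" using st by (simp add: c_def)
    finally show False using zero[of c] st(1) by (auto simp: c_def)
  qed
  show "rat_vec.independent (v ` I)"
  proof (rule rat_vec.independent_if_scalars_zero)
    show "finite (v ` I)" using fin by simp
    fix f x assume f: "(\<Sum>x\<in>v ` I. f x *\<^sub>Q x) = 0" and x: "x \<in> v ` I"
    have "(\<Sum>t\<in>I. f (v t) *\<^sub>Q v t) = 0"
      using f by (simp add: sum.reindex[OF inj])
    then show "f x = 0" using zero[of "f \<circ> v"] x by auto
  qed
qed

lemma crit_class_independent_family:
  assumes "(\<Sum>t\<in>crit_index n. c t *\<^sub>Q crit_class n t) = 0"
  shows "\<forall>t\<in>crit_index n. c t = 0"
proof -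
  have "trace_class (\<Sum>t\<in>crit_index n. c t *\<^sub>Q crit_class n t) = 0" using assms by simp
  then show ?thesis
    by (intro crit_class_trace_independent) (simp add: trace_class_sum trace_class_scale)
qed

lemma crit_class_inj: "inj_on (crit_class n) (crit_index n)"
  and crit_class_independent: "rat_vec.independent (crit_class n ` crit_index n)"
  using family_independent[OF finite_crit_index, of "crit_class n" n] crit_class_independent_family
  by blast+

definition crit_span :: "nat \<Rightarrow> homology set" where
  "crit_span n = rat_vec.span (crit_class n ` crit_index n)"

lemma subspace_crit_span: "rat_vec.subspace (crit_span n)"
  by (simp add: crit_span_def rat_vec.subspace_span)

lemma crit_class_Hcell: "t \<in> crit_index n \<Longrightarrow> crit_class n t \<in> Hcell 1 n"
  using zcycle_cycles1 unfolding Hcell_1 crit_class_def zclass_def by blast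

lemma crit_span_Hcell: "crit_span n \<subseteq> Hcell 1 n"
  unfolding crit_span_def
  by (rule rat_vec.span_minimal[OF _ Hcell_subspace]) (use crit_class_Hcell in blast)

lemma trace_class_zero_iff:
  assumes "x \<in> crit_span n" "trace_class x = 0"
  shows "x = 0"
proof -
  obtain u where u: "x = (\<Sum>y\<in>crit_class n ` crit_index n. u y *\<^sub>Q y)"
    using assms(1) finite_crit_index unfolding crit_span_def by (auto simp: rat_vec.span_finite)
  then have x: "x = (\<Sum>t\<in>crit_index n. u (crit_class n t) *\<^sub>Q crit_class n t)"
    by (simp add: sum.reindex[OF crit_class_inj])
  then have "(\<Sum>t\<in>crit_index n. u (crit_class n t) *\<^sub>Q trace_class (crit_class n t)) = 0"
    using assms(2) by (simp add: trace_class_sum trace_class_scale)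
  then show ?thesis using crit_class_trace_independent[where c = "\<lambda>t. u (crit_class n t)"] x by simp
qed

text \<open>Equalities between elements of the span of the basis can be checked on traces.\<close>

lemma trace_class_inj:
  assumes "x \<in> crit_span n" "y \<in> crit_span n" "trace_class x = trace_class y"
  shows "x = y"
  using trace_class_zero_iff[of "x - y" n] assms rat_vec.subspace_diff[OF subspace_crit_span]
  by (simp add: trace_class_diff)

section \<open>The high insertion maps\<close>

lemma insert_after_barrier_0: "concat (insert_after_barrier x 0 ps) = [x] # concat ps"
  by (cases ps) auto

lemma insert_after_barrier_1:
  assumes "barrier p"
  shows "insert_after_barrier x (Suc 0) (map (\<lambda>x. [[x]]) \<alpha> @ p # ps) = map (\<lambda>x. [[x]]) \<alpha> @ p # [[x]] # ps"
proof (induction \<alpha>)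
  case Nil
  then show ?case using assms by (cases ps) simp_all
qed (simp add: barrier_def)

lemma concat_singleton_pieces: "concat (map (\<lambda>x. [[x]]) \<alpha>) = singles \<alpha>"
  by (induction \<alpha>) auto

lemma iota_crit_sym:
  assumes "(S, a, b) \<in> crit_index n"
  shows "iota n 0 (crit_sym n (S, a, b)) = crit_sym (Suc n) (insert (Suc n) S, a, b)"
    "iota n (Suc 0) (crit_sym n (S, a, b)) = crit_sym (Suc n) (S, a, b)"
proof -
  note d = crit_indexD[OF assms]
  let ?R = "{1..n} - S - {a, b}"
  have left: "dlist (insert (Suc n) S) = Suc n # dlist S"
    using d by (intro dlist_insert_max) auto
  have "{1..Suc n} - insert (Suc n) S - {a, b} = ?R" by auto
  then have 0: "crit_sym (Suc n) (insert (Suc n) S, a, b) = [Suc n] # crit_sym n (S, a, b)"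
    using left by (simp add: crit_sym_def)
  have "{1..Suc n} - S - {a, b} = insert (Suc n) ?R" using d by auto
  moreover have "dlist (insert (Suc n) ?R) = Suc n # dlist ?R"
    by (intro dlist_insert_max) auto
  ultimately have 1: "crit_sym (Suc n) (S, a, b) = singles (dlist S) @ [a, b] # [Suc n] # singles (dlist ?R)"
    by (simp add: crit_sym_def)
  consider "a < b" | "b < a" using d by linarith
  then have "concat (pieces (crit_sym n (S, a, b))) = crit_sym n (S, a, b) \<and>
    concat (insert_after_barrier (Suc n) (Suc 0) (pieces (crit_sym n (S, a, b))))
      = singles (dlist S) @ [a, b] # [Suc n] # singles (dlist ?R)"
  proof cases
    case A: 1
    have "barrier [[a, b]]" by (simp add: barrier_def)
    then show ?thesis
      by (simp add: crit_sym_def pieces_pair[OF A] insert_after_barrier_1 concat_singleton_pieces)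
  next
    case A: 2
    note h = crit_index_hexagon[OF assms A]
    have "barrier [[Min S], [a, b]]" by (simp add: barrier_def)
    moreover have "singles (dlist S) @ e = singles (dlist (S - {Min S})) @ [Min S] # e" for e
      using dlist_insert_min[of "S - {Min S}" "Min S"] h(1,4) h(5)[symmetric] by simp
    ultimately show ?thesis
      by (simp add: crit_sym_hexagon[OF assms A] pieces_hexagon[OF h(2) A] insert_after_barrier_1
          concat_singleton_pieces)
  qed
  then show "iota n 0 (crit_sym n (S, a, b)) = crit_sym (Suc n) (insert (Suc n) S, a, b)"
    "iota n (Suc 0) (crit_sym n (S, a, b)) = crit_sym (Suc n) (S, a, b)"
    unfolding iota_def insert_after_barrier_0 0 1 by simp_all
qed

lemma crit_index_Suc:
  assumes "(S, a, b) \<in> crit_index n"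
  shows "(insert (Suc n) S, a, b) \<in> crit_index (Suc n)" "(S, a, b) \<in> crit_index (Suc n)"
  using assms unfolding crit_index_def by (auto simp: subset_eq le_Suc_eq)

text \<open>The basis elements are independent, so there is a linear map with the prescribed values,
  and the choice operator in the definition returns such a map.\<close>

lemma high_insertion_basis:
  shows "Vector_Spaces.linear scaleQ scaleQ (high_insertion 1 n j)"
    "t \<in> crit_index n \<Longrightarrow> high_insertion 1 n j (crit_class n t) = zclass (iota n j (crit_sym n t))"
proof -
  interpret vector_space_pair "scaleQ :: rat \<Rightarrow> homology \<Rightarrow> homology" "scaleQ :: rat \<Rightarrow> homology \<Rightarrow> homology"
    by unfold_locales
  obtain g where g: "Vector_Spaces.linear scaleQ scaleQ g"
    "\<forall>x\<in>crit_class n ` crit_index n. g x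
      = zclass (iota n j (crit_sym n (inv_into (crit_index n) (crit_class n) x)))"
    using linear_independent_extend[OF crit_class_independent[of n],
      of "\<lambda>x. zclass (iota n j (crit_sym n (inv_into (crit_index n) (crit_class n) x)))"]
    by blast
  have "\<exists>f. Vector_Spaces.linear scaleQ scaleQ f \<and>
     (\<forall>e. critical n e \<and> num_pairs e = 1 \<longrightarrow> f (zclass e) = zclass (iota n j e))"
  proof (intro exI conjI allI impI)
    show "Vector_Spaces.linear scaleQ scaleQ g" by (rule g(1))
    fix e assume "critical n e \<and> num_pairs e = 1"
    then obtain t where "t \<in> crit_index n" "e = crit_sym n t" using critical_one_pair_eq by blast
    then show "g (zclass e) = zclass (iota n j e)"
      using g(2) by (auto simp: inv_into_f_f[OF crit_class_inj] crit_class_def[symmetric])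
  qed
  note s = someI_ex[OF this, folded high_insertion_def]
  show "Vector_Spaces.linear scaleQ scaleQ (high_insertion 1 n j)" using s by blast
  show "high_insertion 1 n j (crit_class n t) = zclass (iota n j (crit_sym n t))"
    if "t \<in> crit_index n"
    using s crit_sym_critical[OF that] by (simp add: crit_class_def)
qed

lemmas high_insertion_linear =
  high_insertion_basis(1)[THEN Vector_Spaces.linear_iff[THEN iffD1]]

lemma trace_crit_class_insert:
  assumes "(S, a, b) \<in> crit_index n"
  shows "trace_class (crit_class (Suc n) (insert (Suc n) S, a, b))
      = - add_left {Suc n} (trace_class (crit_class n (S, a, b)))"
    "trace_class (crit_class (Suc n) (S, a, b)) = trace_class (crit_class n (S, a, b))"
proof -
  note d = crit_indexD[OF assms] and s = crit_index_Suc[OF assms]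
  consider "a < b" | "b < a" using d by linarith
  then have "trace_class (crit_class (Suc n) (insert (Suc n) S, a, b))
      = - add_left {Suc n} (trace_class (crit_class n (S, a, b))) \<and>
    trace_class (crit_class (Suc n) (S, a, b)) = trace_class (crit_class n (S, a, b))"
  proof cases
    case 1
    have "Suc n \<notin> S" using d by auto
    then show ?thesis
      using 1 d s assms by (simp add: trace_crit_class_pair add_left_linear add_left_basis_elt)
  next
    case 2
    note h = crit_index_hexagon[OF assms 2]
    have S: "Suc n \<notin> S" using d by auto
    have "Min S \<le> n" using h(3) d(1) by auto
    then have "Min (insert (Suc n) S) = Min S" using h by (subst Min_insert) auto
    moreover have "insert (Suc n) S - {Min S} = insert (Suc n) (S - {Min S})"
      using S h(3) by (metis insert_Diff_if singletonD)
    ultimately show ?thesis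
      using 2 d s assms S h
      by (simp add: trace_crit_class_hexagon add_left_linear add_left_basis_elt insert_commute)
  qed
  then show "trace_class (crit_class (Suc n) (insert (Suc n) S, a, b))
      = - add_left {Suc n} (trace_class (crit_class n (S, a, b)))"
    "trace_class (crit_class (Suc n) (S, a, b)) = trace_class (crit_class n (S, a, b))" by auto
qed

text \<open>On the basis elements this is visible from the critical symbols: \<open>n + 1\<close> becomes the
  first of the left labels, or the first of the right ones.\<close>

lemma high_insertion_trace:
  assumes "x \<in> crit_span n"
  shows "high_insertion 1 n 0 x \<in> crit_span (Suc n)"
    "trace_class (high_insertion 1 n 0 x) = - add_left {Suc n} (trace_class x)"
    "high_insertion 1 n 1 x \<in> crit_span (Suc n)"
    "trace_class (high_insertion 1 n 1 x) = trace_class x"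
proof -
  note lin = high_insertion_linear[of n, THEN conjunct2, THEN conjunct2]
  let ?P = "\<lambda>x. high_insertion 1 n 0 x \<in> crit_span (Suc n) \<and>
    trace_class (high_insertion 1 n 0 x) = - add_left {Suc n} (trace_class x) \<and>
    high_insertion 1 n 1 x \<in> crit_span (Suc n) \<and>
    trace_class (high_insertion 1 n 1 x) = trace_class x"
  have sub: "rat_vec.subspace (Collect ?P)"
  proof -
    have "high_insertion 1 n j 0 = 0" for j
      using lin[of j] by (metis rat_vec.scale_zero_left)
    then show ?thesis
      using lin rat_vec.subspace_0[OF subspace_crit_span]
        rat_vec.subspace_add[OF subspace_crit_span] rat_vec.subspace_scale[OF subspace_crit_span]
      by (simp add: rat_vec.subspace_def trace_class_add trace_class_scale add_left_linear)
  qed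
  have "crit_span n \<subseteq> Collect ?P"
    unfolding crit_span_def[of n]
  proof (rule rat_vec.span_minimal[OF _ sub], safe)
    fix S a b assume t: "(S, a, b) \<in> crit_index n"
    have *: "high_insertion 1 n 0 (crit_class n (S, a, b)) = crit_class (Suc n) (insert (Suc n) S, a, b)"
      "high_insertion 1 n 1 (crit_class n (S, a, b)) = crit_class (Suc n) (S, a, b)"
      using high_insertion_basis(2)[OF t] iota_crit_sym[OF t] by (simp_all add: crit_class_def)
    show "high_insertion 1 n 0 (crit_class n (S, a, b)) \<in> crit_span (Suc n)"
      "high_insertion 1 n 1 (crit_class n (S, a, b)) \<in> crit_span (Suc n)"
      unfolding * crit_span_def using crit_index_Suc[OF t] by (auto intro: rat_vec.span_base)
    show "trace_class (high_insertion 1 n 0 (crit_class n (S, a, b))) = - add_left {Suc n} (trace_class (crit_class n (S, a, b)))"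
      "trace_class (high_insertion 1 n 1 (crit_class n (S, a, b))) = trace_class (crit_class n (S, a, b))"
      unfolding * using trace_crit_class_insert[OF t] by simp_all
  qed
  then show "high_insertion 1 n 0 x \<in> crit_span (Suc n)"
    "trace_class (high_insertion 1 n 0 x) = - add_left {Suc n} (trace_class x)"
    "high_insertion 1 n 1 x \<in> crit_span (Suc n)"
    "trace_class (high_insertion 1 n 1 x) = trace_class x" using assms by blast+
qed

section \<open>Commuting singletons past each other\<close>

lemma bd_pair_Cons:
  assumes "x \<noteq> y"
  shows "bd (lin_ext (\<lambda>e. basis_elt ([x, y] # e)) f) = sandwich [x, y] f [] - sandwich [y, x] f []
    - lin_ext (\<lambda>e. basis_elt ([x, y] # e)) (bd f)"
proof -
  have diff: "lin_ext (\<lambda>e. g e - h e - k e) f = lin_ext g f - lin_ext h f - lin_ext k f"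
    for g h k :: "sym \<Rightarrow> chain"
    by (simp add: lin_ext_def rat_vec.scale_right_diff_distrib sum_subtractf)
  show ?thesis
    using assms by (simp add: bd_def sandwich_def lin_ext_lin_ext bd_sym_pair diff del: bd_sym.simps(2))
qed

lemma bd_sym_snoc_pair:
  assumes "x \<noteq> y"
  shows "bd_sym (e @ [[x, y]]) = lin_ext (\<lambda>f. basis_elt (f @ [[x, y]])) (bd_sym e)
    + (- 1) ^ length e *\<^sub>Q (basis_elt (e @ [[x], [y]]) - basis_elt (e @ [[y], [x]]))"
proof (induction e)
  case Nil
  then show ?case using assms by (simp add: bd_sym_pair del: bd_sym.simps(2))
next
  case (Cons g e)
  show ?case
    by (simp add: concat_chain_def lin_ext_lin_ext lin_ext_diff lin_ext_add lin_ext_scale Cons)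
qed

lemma bd_snoc_pair:
  assumes "x \<noteq> y" "\<And>e. e \<in> Poly_Mapping.keys f \<Longrightarrow> length e = k"
  shows "bd (lin_ext (\<lambda>e. basis_elt (e @ [[x, y]])) f)
    = lin_ext (\<lambda>e. basis_elt (e @ [[x, y]])) (bd f)
      + (- 1) ^ k *\<^sub>Q (sandwich [] f [x, y] - sandwich [] f [y, x])"
proof -
  have "bd (lin_ext (\<lambda>e. basis_elt (e @ [[x, y]])) f) =
    lin_ext (\<lambda>e. lin_ext (\<lambda>f. basis_elt (f @ [[x, y]])) (bd_sym e)
      + (- 1) ^ k *\<^sub>Q (basis_elt (e @ [[x], [y]]) - basis_elt (e @ [[y], [x]]))) f"
    unfolding bd_def lin_ext_lin_ext
    by (rule lin_ext_cong) (simp add: bd_sym_snoc_pair assms)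
  also have "\<dots> = lin_ext (\<lambda>e. lin_ext (\<lambda>f. basis_elt (f @ [[x, y]])) (bd_sym e)) f
    + (- 1) ^ k *\<^sub>Q (lin_ext (\<lambda>e. basis_elt (e @ [[x], [y]])) f - lin_ext (\<lambda>e. basis_elt (e @ [[y], [x]])) f)"
    by (simp add: lin_ext_def[of _ f] rat_vec.scale_right_diff_distrib scaleQ_add_right sum.distrib
        sum_subtractf rat_vec.scale_sum_right scaleQ_scaleQ mult.commute)
  finally show ?thesis by (simp add: bd_def sandwich_def lin_ext_lin_ext)
qed

lemma cycles1_length:
  assumes "c \<in> cycles1 C" "e \<in> Poly_Mapping.keys c"
  shows "Suc (length e) = card C"
proof -
  have e: "e \<in> symbols2 C" "cell_dim e = 1" using assms by (auto simp: cycles1_def)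
  then have "length (concat e) = card C"
    using distinct_card[of "concat e"] by (simp add: symbols2_def symbols_def)
  then show ?thesis using e(2) by (simp add: cell_dim_def)
qed

text \<open>The chain \<open>\<alpha>|c|\<beta>\<close> with a pair block among the singletons is a chain of squares; since
  \<open>c\<close> is a cycle, its boundary consists only of the two ways to split that block.\<close>

lemma swap_left:
  assumes c: "c \<in> cycles1 C" and d: "distinct (\<gamma> @ [x, y] @ \<delta> @ \<beta>)"
    and C: "set (\<gamma> @ [x, y] @ \<delta> @ \<beta>) \<inter> C = {}"
  shows "hclass (sandwich (\<gamma> @ [x, y] @ \<delta>) c \<beta>) = hclass (sandwich (\<gamma> @ [y, x] @ \<delta>) c \<beta>)"
proof (rule hclass_eqI)
  let ?D = "set \<gamma> \<union> {x, y} \<union> set \<delta> \<union> C \<union> set \<beta>"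
  have D: "set (\<gamma> @ [x, y] @ \<delta>) \<union> C \<union> set \<beta> = ?D" "set (\<gamma> @ [y, x] @ \<delta>) \<union> C \<union> set \<beta> = ?D"
    by auto
  show "sandwich (\<gamma> @ [x, y] @ \<delta>) c \<beta> \<in> cycles1 ?D"
    using cycles1_sandwich[OF c, of "\<gamma> @ [x, y] @ \<delta>" \<beta>] d C D(1) by auto
  show "sandwich (\<gamma> @ [y, x] @ \<delta>) c \<beta> \<in> cycles1 ?D"
    using cycles1_sandwich[OF c, of "\<gamma> @ [y, x] @ \<delta>" \<beta>] d C D(2) by auto
  define w where "w = (- 1) ^ length \<gamma> *\<^sub>Q
    sandwich \<gamma> (lin_ext (\<lambda>e. basis_elt ([x, y] # e)) (sandwich \<delta> c [])) \<beta>"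
  have w': "w = (- 1) ^ length \<gamma> *\<^sub>Q lin_ext (\<lambda>e. basis_elt (singles \<gamma> @ [x, y] # singles \<delta> @ e @ singles \<beta>)) c"
    by (simp add: w_def sandwich_def lin_ext_lin_ext)
  have "Poly_Mapping.keys (lin_ext (\<lambda>e. basis_elt (singles \<gamma> @ [x, y] # singles \<delta> @ e @ singles \<beta>)) c)
      \<subseteq> (\<lambda>e. singles \<gamma> @ [x, y] # singles \<delta> @ e @ singles \<beta>) ` Poly_Mapping.keys c"
    using keys_lin_ext[of "\<lambda>e. basis_elt (singles \<gamma> @ [x, y] # singles \<delta> @ e @ singles \<beta>)" c] by auto
  also have "\<dots> \<subseteq> symbols2 ?D"
  proof (rule image_subsetI)
    fix e assume "e \<in> Poly_Mapping.keys c"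
    then have "e \<in> symbols2 C" using c by (auto simp: cycles1_def)
    then show "singles \<gamma> @ [x, y] # singles \<delta> @ e @ singles \<beta> \<in> symbols2 ?D"
      using d C by (auto simp: symbols2_def symbols_def)
  qed
  finally have "lin_ext (\<lambda>e. basis_elt (singles \<gamma> @ [x, y] # singles \<delta> @ e @ singles \<beta>)) c \<in> all_chains2"
    by (auto simp: all_chains2_def)
  then show "w \<in> all_chains2"
    unfolding w' by (rule rat_vec.subspace_scale[OF subspace_all_chains2])
  have "bd (sandwich \<delta> c []) = 0"
    using c by (simp add: bd_sandwich cycles1_def sandwich_linear)
  then show "sandwich (\<gamma> @ [x, y] @ \<delta>) c \<beta> - sandwich (\<gamma> @ [y, x] @ \<delta>) c \<beta> = bd w"
    using d by (simp add: w_def bd_scale bd_sandwich bd_pair_Cons scaleQ_scaleQ sandwich_linear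
        sandwich_sandwich flip: power_mult_distrib)
qed

text \<open>The same argument on the other side; the sign of the Leibniz rule is now the number of
  blocks before the new pair, which is constant because all cells of a one-dimensional chain on
  given labels have the same number of blocks.\<close>

lemma swap_right:
  assumes c: "c \<in> cycles1 C" and d: "distinct (\<alpha> @ \<gamma> @ [x, y] @ \<delta>)"
    and C: "set (\<alpha> @ \<gamma> @ [x, y] @ \<delta>) \<inter> C = {}"
  shows "hclass (sandwich \<alpha> c (\<gamma> @ [x, y] @ \<delta>)) = hclass (sandwich \<alpha> c (\<gamma> @ [y, x] @ \<delta>))"
proof (rule hclass_eqI)
  let ?D = "set \<alpha> \<union> C \<union> set \<gamma> \<union> {x, y} \<union> set \<delta>"
  have D: "set \<alpha> \<union> C \<union> set (\<gamma> @ [x, y] @ \<delta>) = ?D" "set \<alpha> \<union> C \<union> set (\<gamma> @ [y, x] @ \<delta>) = ?D"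
    by auto
  show "sandwich \<alpha> c (\<gamma> @ [x, y] @ \<delta>) \<in> cycles1 ?D"
    using cycles1_sandwich[OF c, of \<alpha> "\<gamma> @ [x, y] @ \<delta>"] d C D(1) by auto
  show "sandwich \<alpha> c (\<gamma> @ [y, x] @ \<delta>) \<in> cycles1 ?D"
    using cycles1_sandwich[OF c, of \<alpha> "\<gamma> @ [y, x] @ \<delta>"] d C D(2) by auto
  define k where "k = card C - 1 + length \<gamma>"
  define s where "s = (- 1) ^ length \<alpha> * (- 1 :: rat) ^ k"
  define w where "w = s *\<^sub>Q
    sandwich \<alpha> (lin_ext (\<lambda>e. basis_elt (e @ [[x, y]])) (sandwich [] c \<gamma>)) \<delta>"
  have w': "w = s *\<^sub>Q lin_ext (\<lambda>e. basis_elt (singles \<alpha> @ e @ singles \<gamma> @ [x, y] # singles \<delta>)) c"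
    by (simp add: w_def sandwich_def lin_ext_lin_ext)
  have "Poly_Mapping.keys (lin_ext (\<lambda>e. basis_elt (singles \<alpha> @ e @ singles \<gamma> @ [x, y] # singles \<delta>)) c)
      \<subseteq> (\<lambda>e. singles \<alpha> @ e @ singles \<gamma> @ [x, y] # singles \<delta>) ` Poly_Mapping.keys c"
    using keys_lin_ext[of "\<lambda>e. basis_elt (singles \<alpha> @ e @ singles \<gamma> @ [x, y] # singles \<delta>)" c] by auto
  also have "\<dots> \<subseteq> symbols2 ?D"
  proof (rule image_subsetI)
    fix e assume "e \<in> Poly_Mapping.keys c"
    then have "e \<in> symbols2 C" using c by (auto simp: cycles1_def)
    then show "singles \<alpha> @ e @ singles \<gamma> @ [x, y] # singles \<delta> \<in> symbols2 ?D"
      using d C by (auto simp: symbols2_def symbols_def)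
  qed
  finally have "lin_ext (\<lambda>e. basis_elt (singles \<alpha> @ e @ singles \<gamma> @ [x, y] # singles \<delta>)) c \<in> all_chains2"
    by (auto simp: all_chains2_def)
  then show "w \<in> all_chains2"
    unfolding w' by (rule rat_vec.subspace_scale[OF subspace_all_chains2])
  have z: "bd (sandwich [] c \<gamma>) = 0"
    using c by (simp add: bd_sandwich cycles1_def sandwich_linear)
  have len: "length e = k" if "e \<in> Poly_Mapping.keys (sandwich [] c \<gamma>)" for e
  proof -
    note e = that
    obtain f where f: "f \<in> Poly_Mapping.keys c" "e = f @ singles \<gamma>"
      using subsetD[OF keys_sandwich e] by auto
    then show ?thesis using cycles1_length[OF c f(1)] by (simp add: k_def)
  qed
  have "bd w = (s * (- 1) ^ length \<alpha> * (- 1) ^ k) *\<^sub>Q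
      (sandwich \<alpha> c (\<gamma> @ [x, y] @ \<delta>) - sandwich \<alpha> c (\<gamma> @ [y, x] @ \<delta>))"
    using d z by (simp add: w_def bd_scale bd_sandwich bd_snoc_pair[OF _ len] scaleQ_scaleQ
        sandwich_linear sandwich_sandwich rat_vec.scale_right_diff_distrib mult.assoc)
  moreover have "s * (- 1) ^ length \<alpha> * (- 1) ^ k = 1"
  proof -
    have "(- 1) ^ i * (- 1) ^ i = (1 :: rat)" for i by (simp flip: power_mult_distrib)
    moreover have "s * (- 1) ^ length \<alpha> * (- 1) ^ k
        = ((- 1) ^ length \<alpha> * (- 1) ^ length \<alpha>) * ((- 1) ^ k * (- 1) ^ k)"
      by (simp only: s_def mult.assoc mult.left_commute mult.commute)
    ultimately show ?thesis by simp
  qed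
  ultimately show "sandwich \<alpha> c (\<gamma> @ [x, y] @ \<delta>) - sandwich \<alpha> c (\<gamma> @ [y, x] @ \<delta>) = bd w" by simp
qed

text \<open>Adjacent swaps move the first label of one list to the front of the other one, and the
  rest follows by induction; the prefix \<open>\<gamma>\<close> holds the labels that already agree.\<close>

lemma adjacent_swaps_rearrange:
  assumes swap: "\<And>\<gamma> x y \<delta>. distinct (\<gamma> @ [x, y] @ \<delta>) \<Longrightarrow> set (\<gamma> @ [x, y] @ \<delta>) = A
      \<Longrightarrow> F (\<gamma> @ [x, y] @ \<delta>) = F (\<gamma> @ [y, x] @ \<delta>)"
    and "distinct \<alpha>" "distinct \<beta>" "set \<alpha> = A" "set \<beta> = A"
  shows "F \<alpha> = F \<beta>"
proof -
  have move: "F (\<gamma> @ u @ x # v) = F (\<gamma> @ x # u @ v)"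
    if "distinct (\<gamma> @ u @ x # v)" "set (\<gamma> @ u @ x # v) = A" for \<gamma> u x v
    using that
  proof (induction u arbitrary: \<gamma>)
    case (Cons y u)
    have "F ((\<gamma> @ [y]) @ u @ x # v) = F ((\<gamma> @ [y]) @ x # u @ v)"
      by (rule Cons.IH) (use Cons.prems in auto)
    also have "\<dots> = F (\<gamma> @ [y, x] @ (u @ v))" by simp
    also have "\<dots> = F (\<gamma> @ [x, y] @ (u @ v))"
      by (rule swap) (use Cons.prems in auto)
    finally show ?case by simp
  qed simp
  have "F (\<gamma> @ \<alpha>) = F (\<gamma> @ \<beta>)"
    if "distinct (\<gamma> @ \<alpha>)" "distinct (\<gamma> @ \<beta>)" "set (\<gamma> @ \<alpha>) = A" "set (\<gamma> @ \<beta>) = A" for \<gamma>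
    using that
  proof (induction \<alpha> arbitrary: \<gamma> \<beta>)
    case Nil
    then have "\<beta> = []" by (metis append_Nil2 distinct_append inf.absorb_iff2 le_sup_iff set_append set_empty subset_refl)
    then show ?case by simp
  next
    case (Cons x \<alpha>)
    have "set \<beta> = insert x (set \<alpha>)" using Cons.prems by auto
    then obtain u v where \<beta>: "\<beta> = u @ x # v" by (metis insertI1 split_list)
    have "F (\<gamma> @ \<beta>) = F (\<gamma> @ x # u @ v)"
      unfolding \<beta> by (rule move) (use Cons.prems \<beta> in auto)
    also have "\<dots> = F ((\<gamma> @ [x]) @ \<alpha>)"
      using Cons.IH[of "\<gamma> @ [x]" "u @ v"] Cons.prems \<beta> by auto
    finally show ?case by simp
  qed
  from this[of "[]"] show ?thesis using assms by simp
qed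

lemma hclass_sandwich_cong:
  assumes c: "c \<in> cycles1 C" and a: "distinct (\<alpha> @ \<beta>)" "distinct (\<alpha>' @ \<beta>')"
    and s: "set \<alpha> = set \<alpha>'" "set \<beta> = set \<beta>'" and C: "set (\<alpha> @ \<beta>) \<inter> C = {}"
  shows "hclass (sandwich \<alpha> c \<beta>) = hclass (sandwich \<alpha>' c \<beta>')"
proof -
  have "hclass (sandwich \<alpha> c \<beta>) = hclass (sandwich \<alpha>' c \<beta>)"
    by (rule adjacent_swaps_rearrange[where A = "set \<alpha>" and F = "\<lambda>\<alpha>. hclass (sandwich \<alpha> c \<beta>)"])
      (rule swap_left[OF c], use a s C in auto)
  also have "\<dots> = hclass (sandwich \<alpha>' c \<beta>')"
    by (rule adjacent_swaps_rearrange[where A = "set \<beta>" and F = "\<lambda>\<beta>. hclass (sandwich \<alpha>' c \<beta>)"])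
      (rule swap_right[OF c], use a s C in auto)
  finally show ?thesis .
qed

section \<open>Classes determined by sets of labels\<close>

text \<open>The class of \<open>c\<close> with the labels of \<open>P\<close> to its left and all others to its right. The
  order of the singletons is irrelevant (\<open>hclass_sandwich_cong\<close>), decreasing order is a choice.\<close>

definition placed :: "nat \<Rightarrow> nat set \<Rightarrow> nat set \<Rightarrow> chain \<Rightarrow> homology" where
  "placed n P C c = hclass (sandwich (dlist P) c (dlist ({1..n} - P - C)))"

lemma placed_cycles1:
  assumes "c \<in> cycles1 C" "P \<union> C \<subseteq> {1..n}" "P \<inter> C = {}"
  shows "sandwich (dlist P) c (dlist ({1..n} - P - C)) \<in> cycles1 {1..n}"
proof -
  have fin: "finite P" "finite ({1..n} - P - C)" using assms(2) finite_subset by auto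
  have "P \<union> C \<union> (N - P - C) = N" if "P \<union> C \<subseteq> N" for N using that by blast
  then have *: "set (dlist P) \<union> C \<union> set (dlist ({1..n} - P - C)) = {1..n}"
    unfolding dlist_props(1)[OF fin(1)] dlist_props(1)[OF fin(2)] using assms(2) by blast
  show ?thesis
    using cycles1_sandwich[OF assms(1), of "dlist P" "dlist ({1..n} - P - C)"] unfolding *
    using assms(3) dlist_props[OF fin(1)] dlist_props[OF fin(2)] by auto
qed

lemma placed_eqI:
  assumes "c \<in> cycles1 C" "distinct \<alpha>" "distinct \<beta>" "set \<alpha> = P" "set \<beta> = {1..n} - P - C" "P \<inter> C = {}"
  shows "hclass (sandwich \<alpha> c \<beta>) = placed n P C c"
  unfolding placed_def
  by (rule hclass_sandwich_cong[OF assms(1)])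
    (use assms dlist_props[of P] dlist_props[of "{1..n} - P - C"] in auto)

lemma placed_linear:
  assumes "c \<in> cycles1 C" "d \<in> cycles1 C" "P \<union> C \<subseteq> {1..n}" "P \<inter> C = {}"
  shows "placed n P C (c + d) = placed n P C c + placed n P C d"
    "placed n P C (c - d) = placed n P C c - placed n P C d"
    "placed n P C (- c) = - placed n P C c"
    "placed n P C (r *\<^sub>Q c) = r *\<^sub>Q placed n P C c"
  using hclass_linear_cycles1[OF placed_cycles1[OF assms(1,3,4)] placed_cycles1[OF assms(2,3,4)]]
  by (simp_all add: placed_def sandwich_linear)

lemma trace_placed:
  assumes "c \<in> cycles1 C" "P \<union> C \<subseteq> {1..n}" "P \<inter> C = {}"
  shows "trace_class (placed n P C c) = (- 1) ^ card P *\<^sub>Q add_left P (trace_chain c)"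
proof -
  have "finite P" using assms(2) finite_subset by auto
  then show ?thesis
    using cycles1_homologous[OF placed_cycles1[OF assms]]
    by (simp add: placed_def trace_class_hclass trace_sandwich dlist_props)
qed

lemma cycles1_relabel:
  assumes "c \<in> cycles1 C" "inj \<sigma>"
  shows "relabel \<sigma> c \<in> cycles1 (\<sigma> ` C)"
proof -
  have "Poly_Mapping.keys (relabel \<sigma> c) \<subseteq> map (map \<sigma>) ` Poly_Mapping.keys c"
    using keys_lin_ext[of "\<lambda>e. basis_elt (map (map \<sigma>) e)" c] by (auto simp: relabel_def)
  also have "\<dots> \<subseteq> {e \<in> symbols2 (\<sigma> ` C). cell_dim e = 1}"
  proof safe
    fix e assume "e \<in> Poly_Mapping.keys c"
    then have e: "e \<in> symbols2 C" "cell_dim e = 1" using assms(1) by (auto simp: cycles1_def)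
    have m: "concat (map (map \<sigma>) e) = map \<sigma> (concat e)" by (simp add: map_concat)
    show "map (map \<sigma>) e \<in> symbols2 (\<sigma> ` C)"
      using e(1) assms(2) m by (auto simp: symbols2_def symbols_def distinct_map inj_on_def)
    show "cell_dim (map (map \<sigma>) e) = 1" using e(2) m by (simp add: cell_dim_def)
  qed
  finally show ?thesis
    using assms by (simp add: cycles1_def relabel_bd relabel_linear)
qed

lemma hact_placed:
  assumes "c \<in> cycles1 C" "P \<union> C \<subseteq> {1..n}" "P \<inter> C = {}" "\<sigma> permutes {1..n}"
  shows "hact \<sigma> (placed n P C c) = placed n (\<sigma> ` P) (\<sigma> ` C) (relabel \<sigma> c)"
proof -
  have inj: "inj \<sigma>" using assms(4) permutes_inj by blast
  have fin: "finite P" "finite ({1..n} - P - C)" using assms(2) finite_subset by auto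
  have img: "\<sigma> ` ({1..n} - P - C) = {1..n} - \<sigma> ` P - \<sigma> ` C"
    using permutes_image[OF assms(4)] by (simp add: image_set_diff[OF inj])
  have "hact \<sigma> (placed n P C c)
      = hclass (sandwich (map \<sigma> (dlist P)) (relabel \<sigma> c) (map \<sigma> (dlist ({1..n} - P - C))))"
    using cycles1_homologous[OF placed_cycles1[OF assms(1-3)]]
    by (simp add: placed_def hact_hclass[OF inj] relabel_sandwich)
  also have "\<dots> = placed n (\<sigma> ` P) (\<sigma> ` C) (relabel \<sigma> c)"
    using fin inj img assms(3) image_Int[OF inj, of P C]
    by (intro placed_eqI cycles1_relabel assms(1))
      (simp_all add: dlist_props distinct_map inj_on_subset[OF inj])
  finally show ?thesis .
qed

text \<open>A singleton at the end of the core can be regarded as one of the outer singletons.\<close>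

lemma placed_move:
  assumes "c \<in> cycles1 C" "P \<union> insert x C \<subseteq> {1..n}" "P \<inter> insert x C = {}" "x \<notin> C"
  shows "placed n P (insert x C) (sandwich [x] c []) = placed n (insert x P) C c"
    "placed n P (insert x C) (sandwich [] c [x]) = placed n P C c"
proof -
  have fin: "finite P" "finite ({1..n} - P - insert x C)" using assms(2) finite_subset by auto
  note p = dlist_props[OF fin(1)] dlist_props[OF fin(2)]
  have "placed n P (insert x C) (sandwich [x] c [])
      = hclass (sandwich (dlist P @ [x]) c (dlist ({1..n} - P - insert x C)))"
    by (simp add: placed_def sandwich_sandwich)
  also have "\<dots> = placed n (insert x P) C c"
    using p assms by (intro placed_eqI) auto
  finally show "placed n P (insert x C) (sandwich [x] c []) = placed n (insert x P) C c" .
  have "placed n P (insert x C) (sandwich [] c [x])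
      = hclass (sandwich (dlist P) c ([x] @ dlist ({1..n} - P - insert x C)))"
    by (simp add: placed_def sandwich_sandwich)
  also have "\<dots> = placed n P C c"
    using p assms by (intro placed_eqI) auto
  finally show "placed n P (insert x C) (sandwich [] c [x]) = placed n P C c" .
qed

section \<open>Alternating hexagons and their relations\<close>

text \<open>The hexagon with each pair block replaced by its antisymmetrization. In contrast to
  \<open>hexagon\<close> it is alternating in its three labels already as a chain, and it is compatible with
  all relabelings, monotone or not.\<close>

definition alt_hexagon :: "nat \<Rightarrow> nat \<Rightarrow> nat \<Rightarrow> chain" where
  "alt_hexagon a b c =
     (basis_elt [[a], [c, b]] - basis_elt [[a], [b, c]]) + (basis_elt [[c, b], [a]] - basis_elt [[b, c], [a]])
   + (basis_elt [[b], [a, c]] - basis_elt [[b], [c, a]]) + (basis_elt [[a, c], [b]] - basis_elt [[c, a], [b]])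
   + (basis_elt [[c], [b, a]] - basis_elt [[c], [a, b]]) + (basis_elt [[b, a], [c]] - basis_elt [[a, b], [c]])"

lemma alt_hexagon_swap: "alt_hexagon b a c = - alt_hexagon a b c"
  by (simp add: alt_hexagon_def)

lemma alt_hexagon_rotate: "alt_hexagon b c a = alt_hexagon a b c"
  by (simp add: alt_hexagon_def)

lemma alt_hexagon_zero: "\<not> distinct [a, b, c] \<Longrightarrow> alt_hexagon a b c = 0"
  by (auto simp: alt_hexagon_def)

lemma alt_hexagon_cycles1: "distinct [a, b, c] \<Longrightarrow> alt_hexagon a b c \<in> cycles1 {a, b, c}"
  unfolding cycles1_def alt_hexagon_def mem_Collect_eq
  by (intro conjI keys_closed single_edge)
    (auto simp: bd_edge_simps simp del: bd_sym.simps(2))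

lemma relabel_alt_hexagon: "relabel \<sigma> (alt_hexagon a b c) = alt_hexagon (\<sigma> a) (\<sigma> b) (\<sigma> c)"
  by (simp add: alt_hexagon_def relabel_linear relabel_basis_elt)

text \<open>Apply \<open>2 (a b) = (a b - b a) + (a b + b a)\<close> to the six terms of the hexagon.\<close>

lemma hexagon_alt_hexagon:
  "hexagon i b a + hexagon i b a = alt_hexagon i b a
     + sandwich [i] (pair_cycle a b) [] - sandwich [b] (pair_cycle a i) [] + sandwich [a] (pair_cycle b i) []
     + sandwich [] (pair_cycle a b) [i] - sandwich [] (pair_cycle a i) [b] + sandwich [] (pair_cycle b i) [a]"
  by (simp add: hexagon_def alt_hexagon_def pair_cycle_def sandwich_linear sandwich_basis_elt)

text \<open>The product of the antisymmetrized edges \<open>a b - b a\<close> and \<open>c d - d c\<close>.\<close>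

definition squares :: "nat \<Rightarrow> nat \<Rightarrow> nat \<Rightarrow> nat \<Rightarrow> chain" where
  "squares a b c d = basis_elt [[a, b], [c, d]] - basis_elt [[b, a], [c, d]]
     - basis_elt [[a, b], [d, c]] + basis_elt [[b, a], [d, c]]"

lemma bd_squares:
  assumes "a \<noteq> b" "c \<noteq> d"
  shows "bd (squares a b c d) = 2 *\<^sub>Q
    (basis_elt [[a], [b], [c, d]] - basis_elt [[b], [a], [c, d]]
     - basis_elt [[a], [b], [d, c]] + basis_elt [[b], [a], [d, c]]
     - basis_elt [[a, b], [c], [d]] + basis_elt [[a, b], [d], [c]]
     + basis_elt [[b, a], [c], [d]] - basis_elt [[b, a], [d], [c]])"
proof -
  have two: "(2 :: rat) *\<^sub>Q x = x + x" for x :: chain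
    using scaleQ_add_left[of 1 1 x] by simp
  show ?thesis
    using assms unfolding two
    by (simp add: squares_def bd_edge_simps del: bd_sym.simps(2))
qed

definition hexagon_sum :: "nat \<Rightarrow> nat \<Rightarrow> nat \<Rightarrow> nat \<Rightarrow> chain" where
  "hexagon_sum a b c d =
     (sandwich [a] (alt_hexagon b c d) [] + sandwich [] (alt_hexagon b c d) [a])
   - (sandwich [b] (alt_hexagon a c d) [] + sandwich [] (alt_hexagon a c d) [b])
   + (sandwich [c] (alt_hexagon a b d) [] + sandwich [] (alt_hexagon a b d) [c])
   - (sandwich [d] (alt_hexagon a b c) [] + sandwich [] (alt_hexagon a b c) [d])"

text \<open>The permutohedron of order four has eight hexagonal and six square faces, and its boundary is a
  sphere: with suitable signs the boundaries of all faces add up to zero.  The hexagonal faces are not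
  cells here, but the squares are, so the sum of the eight hexagons bounds.\<close>

lemma hexagon_sum_boundary:
  assumes "distinct [a, b, c, d]"
  shows "2 *\<^sub>Q hexagon_sum a b c d = bd (squares a b d c + squares a c b d + squares a d c b
     + squares b c d a + squares b d a c + squares c d b a)"
  using assms
  by (simp add: hexagon_sum_def alt_hexagon_def sandwich_linear sandwich_basis_elt bd_add bd_squares
      flip: scaleQ_add_right)

lemma keys_squares:
  assumes "distinct [a, b, c, d]"
  shows "Poly_Mapping.keys (squares a b c d) \<subseteq> symbols2 {a, b, c, d}"
  unfolding squares_def
  by (intro keys_closed) (use assms in \<open>auto simp: symbols2_def symbols_def\<close>)

text \<open>The set \<open>T\<close> contains the labels of the hexagon and those to its left.\<close>

definition hex :: "nat \<Rightarrow> nat set \<Rightarrow> nat \<Rightarrow> nat \<Rightarrow> nat \<Rightarrow> homology" where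
  "hex n T a b c = placed n (T - {a, b, c}) {a, b, c} (alt_hexagon a b c)"

lemma hex_zero: "\<not> distinct [a, b, c] \<Longrightarrow> hex n T a b c = 0"
  by (simp add: hex_def alt_hexagon_zero placed_def sandwich_linear hclass_0)

lemma hex_rotate: "hex n T b c a = hex n T a b c"
  by (simp add: hex_def alt_hexagon_rotate insert_commute)

lemma hex_swap:
  assumes "T \<subseteq> {1..n}" "a \<in> T" "b \<in> T" "c \<in> T"
  shows "hex n T b a c = - hex n T a b c"
proof (cases "distinct [a, b, c]")
  case True
  have "placed n (T - {a, b, c}) {a, b, c} (- alt_hexagon a b c)
      = - placed n (T - {a, b, c}) {a, b, c} (alt_hexagon a b c)"
    using assms by (intro placed_linear(3)[OF alt_hexagon_cycles1[OF True] alt_hexagon_cycles1[OF True]]) auto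
  then show ?thesis by (simp add: hex_def alt_hexagon_swap[of b a c] insert_commute)
next
  case False
  then have "\<not> distinct [b, a, c]" by auto
  then show ?thesis using False hex_zero by simp
qed

text \<open>With \<open>hex_rotate\<close> and \<open>hex_swap\<close> this makes \<open>hex n T\<close> alternating in its three labels.\<close>

lemma hex_swap':
  assumes "T \<subseteq> {1..n}" "a \<in> T" "b \<in> T" "c \<in> T"
  shows "hex n T a c b = - hex n T a b c"
  using hex_swap[OF assms(1,3,4,2)] hex_rotate by metis

lemma hact_0: "hact \<sigma> 0 = 0"
  by transfer (auto simp: homologous_def relabel_linear subspace_all_chains2[THEN rat_vec.subspace_0]
      subspace_boundaries[THEN rat_vec.subspace_0])

lemma hact_hex:
  assumes "T \<subseteq> {1..n}" "a \<in> T" "b \<in> T" "c \<in> T" "\<sigma> permutes {1..n}"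
  shows "hact \<sigma> (hex n T a b c) = hex n (\<sigma> ` T) (\<sigma> a) (\<sigma> b) (\<sigma> c)"
proof (cases "distinct [a, b, c]")
  case True
  have inj: "inj \<sigma>" using assms(5) permutes_inj by blast
  have "hact \<sigma> (placed n (T - {a, b, c}) {a, b, c} (alt_hexagon a b c))
     = placed n (\<sigma> ` (T - {a, b, c})) (\<sigma> ` {a, b, c}) (relabel \<sigma> (alt_hexagon a b c))"
    using assms by (intro hact_placed alt_hexagon_cycles1[OF True]) auto
  then show ?thesis by (simp add: hex_def relabel_alt_hexagon image_set_diff[OF inj])
next
  case False
  then show ?thesis using hex_zero[OF False] hex_zero[of "\<sigma> a" "\<sigma> b" "\<sigma> c" n "\<sigma> ` T"]
    by (auto simp: hact_0)
qed

lemma sandwich_all_chains2: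
  assumes "Poly_Mapping.keys c \<subseteq> symbols2 C" "distinct (\<alpha> @ \<beta>)" "set (\<alpha> @ \<beta>) \<inter> C = {}"
  shows "sandwich \<alpha> c \<beta> \<in> all_chains2"
  unfolding all_chains2_def mem_Collect_eq
proof
  fix f assume "f \<in> Poly_Mapping.keys (sandwich \<alpha> c \<beta>)"
  from subsetD[OF keys_sandwich this] obtain e
    where e: "e \<in> Poly_Mapping.keys c" "f = singles \<alpha> @ e @ singles \<beta>" by blast
  then show "f \<in> (\<Union>S. symbols2 S)"
    using symbols2_sandwich(1)[OF _ assms(2,3)] assms(1) by blast
qed

text \<open>Twice the sum of the hexagons bounds, and the coefficients are rational.\<close>

lemma placed_hexagon_sum:
  assumes d: "distinct [a, b, c, d]" and R: "R \<union> {a, b, c, d} \<subseteq> {1..n}" "R \<inter> {a, b, c, d} = {}"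
    and c1: "hexagon_sum a b c d \<in> cycles1 {a, b, c, d}"
  shows "placed n R {a, b, c, d} (hexagon_sum a b c d) = 0"
proof -
  let ?C = "{a, b, c, d}"
  let ?s = "\<lambda>x. sandwich (dlist R) x (dlist ({1..n} - R - ?C))"
  \<comment> \<open>the chain whose boundary is twice the hexagon sum\<close>
  define W where "W = squares a b d c + squares a c b d + squares a d c b
     + squares b c d a + squares b d a c + squares c d b a"
  have fin: "finite R" "finite ({1..n} - R - ?C)" using R(1) finite_subset by auto
  have "Poly_Mapping.keys W \<subseteq> symbols2 ?C"
    unfolding W_def
    using keys_squares[of a b d c] keys_squares[of a c b d] keys_squares[of a d c b]
      keys_squares[of b c d a] keys_squares[of b d a c] keys_squares[of c d b a] d
    by (intro keys_closed) (auto simp: insert_commute)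
  then have "?s W \<in> all_chains2"
    by (rule sandwich_all_chains2) (use R(2) dlist_props[OF fin(1)] dlist_props[OF fin(2)] in auto)
  then have W: "(- 1) ^ card R *\<^sub>Q ?s W \<in> all_chains2"
    by (rule rat_vec.subspace_scale[OF subspace_all_chains2])
  have cyc: "?s (hexagon_sum a b c d) \<in> cycles1 {1..n}" by (rule placed_cycles1[OF c1 R])
  have "hclass (2 *\<^sub>Q ?s (hexagon_sum a b c d)) = hclass 0"
  proof (rule hclass_eqI[OF cycles1_scale[OF cyc] cycles1_0 W])
    have "2 *\<^sub>Q ?s (hexagon_sum a b c d) = ?s (bd W)"
      by (simp add: W_def flip: hexagon_sum_boundary[OF d] sandwich_linear(4))
    then show "2 *\<^sub>Q ?s (hexagon_sum a b c d) - 0 = bd ((- 1) ^ card R *\<^sub>Q ?s W)"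
      by (simp add: bd_scale bd_sandwich dlist_props[OF fin(1)] scaleQ_scaleQ flip: power_mult_distrib)
  qed
  then have "2 *\<^sub>Q hclass (?s (hexagon_sum a b c d)) = 0"
    unfolding hclass_linear_cycles1(2)[OF cyc cyc] hclass_0 .
  then show ?thesis unfolding placed_def by simp
qed

text \<open>Moving the fourth label to the outer left or right turns the relation between
  hexagons into one between the classes \<open>hex\<close>: outside left it joins the left labels, outside right
  it leaves the set \<open>T\<close>.\<close>

lemma hex_relation:
  assumes T: "T \<subseteq> {1..n}" "{a, b, c, d} \<subseteq> T" and d: "distinct [a, b, c, d]"
  shows "hex n T a b c = hex n T d a b + hex n T d b c + hex n T d c a
    + (hex n (T - {a}) d b c + hex n (T - {b}) d c a + hex n (T - {c}) d a b - hex n (T - {d}) a b c)"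
proof -
  define R where "R = T - {a, b, c, d}"
  have R: "R \<union> {a, b, c, d} \<subseteq> {1..n}" "R \<inter> {a, b, c, d} = {}" using T by (auto simp: R_def)
  have step: "sandwich [x] (alt_hexagon p q r) [] \<in> cycles1 {a, b, c, d} \<and>
      sandwich [] (alt_hexagon p q r) [x] \<in> cycles1 {a, b, c, d} \<and>
      placed n R {a, b, c, d} (sandwich [x] (alt_hexagon p q r) []) = hex n T p q r \<and>
      placed n R {a, b, c, d} (sandwich [] (alt_hexagon p q r) [x]) = hex n (T - {x}) p q r"
    if x: "distinct [x, p, q, r]" "{x, p, q, r} = {a, b, c, d}" for x p q r
  proof -
    have alt: "alt_hexagon p q r \<in> cycles1 {p, q, r}" using x by (intro alt_hexagon_cycles1) auto
    have u: "set [x] \<union> {p, q, r} \<union> set [] = {a, b, c, d}" "set [] \<union> {p, q, r} \<union> set [x] = {a, b, c, d}"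
      unfolding x(2)[symmetric] by auto
    have "sandwich [x] (alt_hexagon p q r) [] \<in> cycles1 {a, b, c, d}"
      "sandwich [] (alt_hexagon p q r) [x] \<in> cycles1 {a, b, c, d}"
      using cycles1_sandwich[OF alt, of "[x]" "[]", unfolded u(1)]
        cycles1_sandwich[OF alt, of "[]" "[x]", unfolded u(2)] x(1) by simp_all
    moreover have "insert x R = T - {p, q, r}" "R = T - {x} - {p, q, r}"
      using x T unfolding R_def x(2)[symmetric] by auto
    moreover have "placed n R (insert x {p, q, r}) (sandwich [x] (alt_hexagon p q r) [])
        = placed n (insert x R) {p, q, r} (alt_hexagon p q r)"
      "placed n R (insert x {p, q, r}) (sandwich [] (alt_hexagon p q r) [x])
        = placed n R {p, q, r} (alt_hexagon p q r)"
      using placed_move[OF alt, of R x n] R[folded x(2)] x(1) by simp_all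
    ultimately show ?thesis unfolding hex_def x(2) by metis
  qed
  have s1: "{b, a, c, d} = {a, b, c, d}" "{c, a, b, d} = {a, b, c, d}" "{d, a, b, c} = {a, b, c, d}"
    by auto
  note s = step[of a b c d, OF d refl] step[of b a c d, OF _ s1(1)] step[of c a b d, OF _ s1(2)]
    step[of d a b c, OF _ s1(3)]
  have c1: "hexagon_sum a b c d \<in> cycles1 {a, b, c, d}"
    unfolding hexagon_sum_def using s d by (intro cycles1_add cycles1_diff) auto
  have "placed n R {a, b, c, d} (hexagon_sum a b c d) = 
      (hex n T b c d + hex n (T - {a}) b c d) - (hex n T a c d + hex n (T - {b}) a c d)
      + (hex n T a b d + hex n (T - {c}) a b d) - (hex n T a b c + hex n (T - {d}) a b c)"
    unfolding hexagon_sum_def using s d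
    by (simp add: placed_linear(1,2)[OF _ _ R] cycles1_add cycles1_diff)
  then have eq: "(hex n T b c d + hex n (T - {a}) b c d) - (hex n T a c d + hex n (T - {b}) a c d)
      + (hex n T a b d + hex n (T - {c}) a b d) - (hex n T a b c + hex n (T - {d}) a b c) = 0"
    using placed_hexagon_sum[OF d R c1] by simp
  have r: "hex n U b c d = hex n U d b c" "hex n U a b d = hex n U d a b" for U
    by (metis hex_rotate)+
  have l: "hex n U a c d = - hex n U d c a" if "U \<subseteq> {1..n}" "a \<in> U" "c \<in> U" "d \<in> U" for U
    using hex_swap'[OF that(1,4,2,3)] hex_rotate[of n U d a c] hex_rotate[of n U a c d] by simp
  have "T - {b} \<subseteq> {1..n}" using T by auto
  then have lb: "hex n (T - {b}) a c d = - hex n (T - {b}) d c a" using T d by (intro l) auto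
  have lT: "hex n T a c d = - hex n T d c a" using T by (intro l) auto
  show ?thesis using eq unfolding r lT lb by (simp add: algebra_simps)
qed

section \<open>Basis elements with few labels to the left of the pair\<close>

lemma shape_singles:
  "shape n m i = singles (map i [1..<m + 1]) @ [i (m + 1), i (m + 2)] # singles (map i [m + 3..<n + 1])"
  by (simp add: shape_def)

lemma singles_pair_eq_iff:
  "singles \<alpha> @ [a, b] # singles \<beta> = singles \<alpha>' @ [a', b'] # singles \<beta>'
    \<longleftrightarrow> \<alpha> = \<alpha>' \<and> a = a' \<and> b = b' \<and> \<beta> = \<beta>'"
proof (induction \<alpha> arbitrary: \<alpha>')
  case Nil
  then show ?case by (cases \<alpha>') (auto simp: inj_map_eq_map inj_def)
next
  case (Cons x \<alpha>)
  then show ?case by (cases \<alpha>') auto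
qed

text \<open>The enumeration lists the left labels, the pair and the right labels in the order of the
  critical symbol; since it is a permutation of all natural numbers it is the identity outside
  \<open>{1..n}\<close>.\<close>

lemma shape_of_crit_index:
  assumes t: "(S, a, b) \<in> crit_index n" and m: "card S = m"
  obtains i where "i permutes {1..n}" "shape n m i = crit_sym n (S, a, b)" "decreasing_ends n m i"
    "i (m + 1) = a" "i (m + 2) = b" "m \<ge> 1 \<Longrightarrow> i m = Min S"
proof -
  note d = crit_indexD[OF t]
  let ?R = "{1..n} - S - {a, b}"
  define xs where "xs = dlist S @ [a, b] @ dlist ?R"
  have finR: "finite ?R" by simp
  note p = dlist_props[OF d(7)] dlist_props[OF finR]
  have set: "set xs = {1..n}"
  proof -
    have "S \<union> ({a, b} \<union> (N - S - {a, b})) = N" if "S \<subseteq> N" "a \<in> N" "b \<in> N" for N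
      using that by blast
    then show ?thesis
      using d(1-3) unfolding xs_def set_append p(1) p(5) by simp
  qed
  have dist: "distinct xs" using p d by (auto simp: xs_def)
  have len: "length xs = n" using distinct_card[OF dist] set by simp
  then have lR: "m + 2 + length (dlist ?R) = n" using p(4) m by (simp add: xs_def)
  \<comment> \<open>positions in \<open>xs\<close> start from 0, while the enumeration starts from 1\<close>
  define i where "i j = (if j \<in> {1..n} then xs ! (j - 1) else j)" for j
  have perm: "i permutes {1..n}"
  proof (rule bij_imp_permutes)
    have "bij_betw ((!) xs \<circ> (\<lambda>j. j - 1)) {1..n} {1..n}"
    proof (rule bij_betw_trans)
      show "bij_betw (\<lambda>j. j - 1) {1..n} {..<n}"
        by (rule bij_betwI[where g = Suc]) auto
      show "bij_betw ((!) xs) {..<n} {1..n}"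
        using bij_betw_nth[OF dist] set len by simp
    qed
    moreover have "bij_betw i {1..n} {1..n} = bij_betw ((!) xs \<circ> (\<lambda>j. j - 1)) {1..n} {1..n}"
      by (rule bij_betw_cong) (simp add: i_def)
    ultimately show "bij_betw i {1..n} {1..n}" by simp
  qed (auto simp: i_def)
  have lS: "length (dlist S) = m" using p(4) m by simp
  have ia: "i j = dlist S ! (j - 1)" if "1 \<le> j" "j \<le> m" for j
  proof -
    have "j - 1 < m" using that by simp
    then show ?thesis using that lR lS by (simp add: i_def xs_def nth_append)
  qed
  have iR: "i j = dlist ?R ! (j - (m + 3))" if "m + 3 \<le> j" "j \<le> n" for j
  proof -
    have "j - 1 - m = Suc (Suc (j - (m + 3)))" "\<not> j - 1 < m" using that by simp_all
    then show ?thesis using that lR lS by (simp add: i_def xs_def nth_append)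
  qed
  have ab: "i (m + 1) = a" "i (m + 2) = b"
    using lR lS by (simp_all add: i_def xs_def nth_append)
  have left: "map i [1..<m + 1] = dlist S"
    by (rule nth_equalityI) (simp_all add: lS ia del: upt_Suc)
  have right: "map i [m + 3..<n + 1] = dlist ?R"
    using lR by (intro nth_equalityI) (simp_all add: iR del: upt_Suc)
  show thesis
  proof
    show "i permutes {1..n}" by (rule perm)
    show "shape n m i = crit_sym n (S, a, b)"
      unfolding shape_singles left right ab by (simp add: crit_sym_def)
    show "i (m + 1) = a" "i (m + 2) = b" by (rule ab)+
    show "decreasing_ends n m i"
      unfolding decreasing_ends_def
    proof (intro conjI allI impI)
      fix j assume j: "1 \<le> j \<and> j < m"
      have "dlist S ! (j - 1) > dlist S ! j"
        using sorted_wrt_nth_less[OF p(3), of "j - 1" j] j lS by simp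
      then show "i j > i (j + 1)" using ia[of j] ia[of "j + 1"] j by simp
    next
      fix j assume j: "m + 3 \<le> j \<and> j < n"
      have "dlist ?R ! (j - (m + 3)) > dlist ?R ! (Suc j - (m + 3))"
        using sorted_wrt_nth_less[OF p(7), of "j - (m + 3)" "Suc j - (m + 3)"] j lR by linarith
      then show "i j > i (j + 1)" using iR[of j] iR[of "j + 1"] j by simp
    qed
    show "i m = Min S" if "m \<ge> 1"
    proof -
      have "S \<noteq> {}" using that m by auto
      then have "last (dlist S) = Min S" "dlist S \<noteq> []"
        using last_dlist[OF d(7)] dlist_Nil[OF d(7)] by auto
      then show ?thesis using ia[of m] that lS by (simp add: last_conv_nth)
    qed
  qed
qed

lemma crit_index_of_shape:
  assumes i: "i permutes {1..n}" "critical n (shape n m i)" and m: "m + 2 \<le> n"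
  obtains S where "(S, i (m + 1), i (m + 2)) \<in> crit_index n" "card S = m"
    "shape n m i = crit_sym n (S, i (m + 1), i (m + 2))"
proof -
  have "num_pairs (shape n m i) = 1" unfolding shape_singles by (rule num_pairs_pair)
  with i(2) have "shape n m i \<in> crit_sym n ` crit_index n"
    using critical_one_pair_eq by blast
  then obtain S a b where t: "(S, a, b) \<in> crit_index n" "shape n m i = crit_sym n (S, a, b)" by auto
  have "map i [1..<m + 1] = dlist S" "i (m + 1) = a" "i (m + 2) = b"
    using t(2)[unfolded shape_singles] unfolding crit_sym_def case_prod_conv singles_pair_eq_iff
    by auto
  moreover have "length (map i [1..<m + 1]) = m" by simp
  ultimately show thesis using that t dlist_props(4)[OF crit_indexD(7)[OF t(1)]] by metis
qed

lemma setB_eq: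
  assumes "m + 2 \<le> n"
  shows "setB n m = crit_class n ` {(S, a, b) \<in> crit_index n. card S = m \<and> a < b}"
proof
  show "setB n m \<subseteq> crit_class n ` {(S, a, b) \<in> crit_index n. card S = m \<and> a < b}"
  proof
    fix x assume "x \<in> setB n m"
    then obtain i where i: "x = zclass (shape n m i)" "i permutes {1..n}" "critical n (shape n m i)"
      "i (m + 2) > i (m + 1)" by (auto simp: setB_def)
    from crit_index_of_shape[OF i(2,3) assms] obtain S where
      "(S, i (m + 1), i (m + 2)) \<in> crit_index n" "card S = m"
      "shape n m i = crit_sym n (S, i (m + 1), i (m + 2))" by metis
    then show "x \<in> crit_class n ` {(S, a, b) \<in> crit_index n. card S = m \<and> a < b}"
      using i(1,4) unfolding crit_class_def
      by (intro image_eqI[of _ _ "(S, i (m + 1), i (m + 2))"]) simp_all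
  qed
  show "crit_class n ` {(S, a, b) \<in> crit_index n. card S = m \<and> a < b} \<subseteq> setB n m"
  proof safe
    fix S a b assume t: "(S, a, b) \<in> crit_index n" "a < b" "m = card S"
    from shape_of_crit_index[OF t(1) refl] obtain i where
      i: "i permutes {1..n}" "shape n (card S) i = crit_sym n (S, a, b)" "decreasing_ends n (card S) i"
        "i (card S + 1) = a" "i (card S + 2) = b" by metis
    then show "crit_class n (S, a, b) \<in> setB n (card S)"
      using t(2) crit_sym_critical(1)[OF t(1)] unfolding setB_def crit_class_def
      by (intro CollectI exI[of _ i]) simp
  qed
qed

lemma setA_eq:
  assumes "m + 2 \<le> n" "1 \<le> m"
  shows "setA n m = crit_class n ` {(S, a, b) \<in> crit_index n. card S = m \<and> b < a}"
proof
  show "setA n m \<subseteq> crit_class n ` {(S, a, b) \<in> crit_index n. card S = m \<and> b < a}"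
  proof
    fix x assume "x \<in> setA n m"
    then obtain i where i: "x = zclass (shape n m i)" "i permutes {1..n}" "critical n (shape n m i)"
      "i (m + 1) > i (m + 2)" by (auto simp: setA_def)
    from crit_index_of_shape[OF i(2,3) assms(1)] obtain S where
      "(S, i (m + 1), i (m + 2)) \<in> crit_index n" "card S = m"
      "shape n m i = crit_sym n (S, i (m + 1), i (m + 2))" by metis
    then show "x \<in> crit_class n ` {(S, a, b) \<in> crit_index n. card S = m \<and> b < a}"
      using i(1,4) unfolding crit_class_def
      by (intro image_eqI[of _ _ "(S, i (m + 1), i (m + 2))"]) simp_all
  qed
  show "crit_class n ` {(S, a, b) \<in> crit_index n. card S = m \<and> b < a} \<subseteq> setA n m"
  proof safe
    fix S a b assume t: "(S, a, b) \<in> crit_index n" "b < a" "m = card S"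
    have "1 \<le> card S" using assms(2) t(3) by simp
    with shape_of_crit_index[OF t(1) refl] obtain i where
      i: "i permutes {1..n}" "shape n (card S) i = crit_sym n (S, a, b)" "decreasing_ends n (card S) i"
        "i (card S + 1) = a" "i (card S + 2) = b" "i (card S) = Min S" by metis
    then show "crit_class n (S, a, b) \<in> setA n (card S)"
      using t(2) crit_sym_critical(1)[OF t(1)] crit_index_hexagon(2)[OF t(1,2)]
      unfolding setA_def crit_class_def
      by (intro CollectI exI[of _ i]) simp
  qed
qed

text \<open>The span in the second claim of the theorem (\<open>span_setA_setB\<close>): elements of type A with
  an empty set of left labels do not exist, because the label before a decreasing pair is part
  of the piece.\<close>

definition low :: "nat \<Rightarrow> nat \<Rightarrow> homology set" where
  "low n m = rat_vec.span (crit_class n ` {(S, a, b) \<in> crit_index n. card S \<le> m})"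

lemma subspace_low: "rat_vec.subspace (low n m)"
  by (simp add: low_def rat_vec.subspace_span)

lemma low_crit_span: "low n m \<subseteq> crit_span n"
  unfolding low_def crit_span_def by (intro rat_vec.span_mono image_mono) auto

lemma span_setA_setB:
  assumes "m + 2 \<le> n"
  shows "rat_vec.span (setB n 0 \<union> (\<Union>l\<in>{1..m}. setA n l \<union> setB n l)) = low n m"
proof -
  have A: "setA n l = crit_class n ` {(S, a, b) \<in> crit_index n. card S = l \<and> b < a}" if "l \<in> {1..m}" for l
    using that assms by (intro setA_eq) auto
  have B: "setB n l = crit_class n ` {(S, a, b) \<in> crit_index n. card S = l \<and> a < b}" if "l \<le> m" for l
    using that assms by (intro setB_eq) auto
  have "setB n 0 \<union> (\<Union>l\<in>{1..m}. setA n l \<union> setB n l)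
      = crit_class n ` {(S, a, b) \<in> crit_index n. card S \<le> m}"
  proof
    show "setB n 0 \<union> (\<Union>l\<in>{1..m}. setA n l \<union> setB n l)
        \<subseteq> crit_class n ` {(S, a, b) \<in> crit_index n. card S \<le> m}"
      using A B by fastforce
    show "crit_class n ` {(S, a, b) \<in> crit_index n. card S \<le> m}
        \<subseteq> setB n 0 \<union> (\<Union>l\<in>{1..m}. setA n l \<union> setB n l)"
    proof safe
      fix S a b assume t: "(S, a, b) \<in> crit_index n" "card S \<le> m"
        "crit_class n (S, a, b) \<notin> (\<Union>l\<in>{1..m}. setA n l \<union> setB n l)"
      have B': "crit_class n (S, a, b) \<in> setB n (card S)" if "a < b"
        using t(1) that unfolding B[OF t(2)] by blast
      have A': "1 \<le> card S \<and> crit_class n (S, a, b) \<in> setA n (card S)" if "b < a"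
      proof -
        have "1 \<le> card S" using crit_index_hexagon(1,3)[OF t(1) that]
          by (metis One_nat_def Suc_leI card_gt_0_iff empty_iff)
        then show ?thesis using t(1,2) that A[of "card S"] by auto
      qed
      have "a \<noteq> b" using crit_indexD(6)[OF t(1)] .
      then consider "a < b" | "b < a" by linarith
      then show "crit_class n (S, a, b) \<in> setB n 0"
      proof cases
        case 1
        then show ?thesis using B' t(2,3) by (cases "card S") auto
      next
        case 2
        then show ?thesis using A' t(2,3) by auto
      qed
    qed
  qed
  then show ?thesis by (simp add: low_def)
qed

definition pair_class :: "nat \<Rightarrow> nat set \<Rightarrow> nat \<Rightarrow> nat \<Rightarrow> homology" where
  "pair_class n P a b = placed n P {a, b} (pair_cycle a b)"

lemma pair_class_crit_class:
  assumes "P \<subseteq> {1..n}" "a \<in> {1..n} - P" "b \<in> {1..n} - P" "a \<noteq> b"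
  shows "(P, min a b, max a b) \<in> crit_index n"
    "pair_class n P a b = crit_class n (P, min a b, max a b)"
proof -
  show "(P, min a b, max a b) \<in> crit_index n"
    using assms by (auto simp: crit_index_def min_def max_def)
  have less: "pair_class n P a b = crit_class n (P, a, b)" if "a < b" for a b
    by (simp add: pair_class_def placed_def crit_class_def zclass_def zcycle_crit_sym_pair[OF that])
  have "pair_class n P a b = pair_class n P b a"
    by (simp add: pair_class_def pair_cycle_def insert_commute add.commute)
  then show "pair_class n P a b = crit_class n (P, min a b, max a b)"
    using less[of a b] less[of b a] assms(4) by (cases "a < b") (simp_all add: min_def max_def)
qed

lemma pair_class_low:
  assumes "P \<subseteq> {1..n}" "a \<in> {1..n} - P" "b \<in> {1..n} - P" "a \<noteq> b" "card P \<le> m"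
  shows "pair_class n P a b \<in> low n m"
  unfolding pair_class_crit_class(2)[OF assms(1-4)] low_def
  using pair_class_crit_class(1)[OF assms(1-4)] assms(5) by (auto intro!: rat_vec.span_base)

text \<open>The alternating hexagon contributes the class on \<open>T = S \<union> {a, b}\<close>; the symmetric
  remainders are pairs \<open>a b + b a\<close> next to a third label, which may join the singletons on its
  side.\<close>

lemma two_crit_class:
  assumes t: "(S, a, b) \<in> crit_index n" "b < a"
  defines "i \<equiv> Min S"
  defines "P \<equiv> S - {i}"
  shows "crit_class n (S, a, b) + crit_class n (S, a, b) = hex n (S \<union> {a, b}) i b a
    + pair_class n (insert i P) a b - pair_class n (insert b P) a i + pair_class n (insert a P) b i
    + pair_class n P a b - pair_class n P a i + pair_class n P b i"
proof -
  note h = crit_index_hexagon[OF t, folded i_def, folded P_def] and d = crit_indexD[OF t(1)]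
  let ?C = "{i, b, a}"
  have dist: "distinct [i, b, a]" using h t(2) by auto
  have i: "i \<notin> P" "a \<notin> P" "b \<notin> P" using d by (auto simp: P_def)
  have P: "P \<union> ?C \<subseteq> {1..n}" "P \<inter> ?C = {}" using d(1-3) h(3) i by (auto simp: P_def)
  have crit: "crit_class n (S, a, b) = placed n P ?C (hexagon i b a)"
  proof -
    have "N - insert i P - {a, b} = N - P - ?C" for N by auto
    then have "{1..n} - S - {a, b} = {1..n} - P - ?C" using h(5) by metis
    then show ?thesis
      by (simp add: crit_class_def zclass_def zcycle_crit_sym_hexagon[OF t] placed_def i_def P_def)
  qed
  have hex: "hex n (S \<union> {a, b}) i b a = placed n P ?C (alt_hexagon i b a)"
  proof -
    have "insert i P \<union> {a, b} - ?C = P" using i by auto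
    then have "S \<union> {a, b} - ?C = P" using h(5) by simp
    then show ?thesis by (simp add: hex_def)
  qed
  have step: "sandwich [x] (pair_cycle p q) [] \<in> cycles1 ?C \<and>
      sandwich [] (pair_cycle p q) [x] \<in> cycles1 ?C \<and>
      placed n P ?C (sandwich [x] (pair_cycle p q) []) = pair_class n (insert x P) p q \<and>
      placed n P ?C (sandwich [] (pair_cycle p q) [x]) = pair_class n P p q"
    if x: "distinct [x, p, q]" "{x, p, q} = ?C" for x p q
  proof -
    have c: "pair_cycle p q \<in> cycles1 {p, q}" using x by (intro pair_cycle_cycles1) auto
    have u: "set [x] \<union> {p, q} \<union> set [] = ?C" "set [] \<union> {p, q} \<union> set [x] = ?C"
      unfolding x(2)[symmetric] by auto
    have "sandwich [x] (pair_cycle p q) [] \<in> cycles1 ?C" "sandwich [] (pair_cycle p q) [x] \<in> cycles1 ?C"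
      using cycles1_sandwich[OF c, of "[x]" "[]", unfolded u(1)]
        cycles1_sandwich[OF c, of "[]" "[x]", unfolded u(2)] x(1) by simp_all
    moreover have "placed n P (insert x {p, q}) (sandwich [x] (pair_cycle p q) [])
        = placed n (insert x P) {p, q} (pair_cycle p q)"
      "placed n P (insert x {p, q}) (sandwich [] (pair_cycle p q) [x]) = placed n P {p, q} (pair_cycle p q)"
      using placed_move[OF c, of P x n] P[folded x(2)] x(1) by simp_all
    ultimately show ?thesis unfolding pair_class_def x(2) by metis
  qed
  have e: "{b, a, i} = ?C" "{i, a, b} = ?C" "{a, b, i} = ?C" by auto
  note s = step[of i a b, OF _ e(2)] step[of b a i, OF _ e(1)] step[of a b i, OF _ e(3)]
  have hc: "hexagon i b a \<in> cycles1 ?C" "alt_hexagon i b a \<in> cycles1 ?C"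
    using dist by (intro hexagon_cycles1 alt_hexagon_cycles1; simp)+
  have "placed n P ?C (hexagon i b a + hexagon i b a) = placed n P ?C (alt_hexagon i b a)
    + pair_class n (insert i P) a b - pair_class n (insert b P) a i + pair_class n (insert a P) b i
    + pair_class n P a b - pair_class n P a i + pair_class n P b i"
    unfolding hexagon_alt_hexagon using s dist hc
    by (simp add: placed_linear(1,2)[OF _ _ P] cycles1_add cycles1_diff)
  then show ?thesis
    unfolding crit hex by (simp add: placed_linear(1)[OF hc(1,1) P])
qed

text \<open>A hexagon containing the smallest label of \<open>T\<close> is, up to sign, twice a basis element plus
  symmetric cycles of pairs (\<open>two_crit_class\<close>).\<close>

lemma hex_min_low:
  assumes T: "T \<subseteq> {1..n}" and bc: "b \<in> T - {Min T}" "c \<in> T - {Min T}" and m: "card T \<le> m + 2"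
  shows "hex n T (Min T) b c \<in> low n m"
proof -
  have fin: "finite T" using T finite_subset by auto
  define i where "i = Min T"
  have "T \<noteq> {}" using bc by auto
  then have i: "i \<in> T" "\<forall>x\<in>T - {i}. i < x"
    using Min_in[OF fin] Min_le[OF fin] by (auto simp: i_def le_less)
  have less: "hex n T i b a \<in> low n m" if ba: "b \<in> T - {i}" "a \<in> T - {i}" "b < a" for a b
  proof -
    define S where "S = T - {a, b}"
    define P where "P = S - {i}"
    have S: "S \<union> {a, b} = T" "i \<in> S" "finite S" using ba i fin by (auto simp: S_def)
    have minS: "Min S = i" using S i by (intro Min_eqI) (auto simp: le_less S_def)
    have ab: "a \<notin> S" "b \<notin> S" by (simp_all add: S_def)
    have "S \<subseteq> {1..n}" "a \<in> {1..n}" "b \<in> {1..n}" "i < b" using T ba i(2) by (auto simp: S_def)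
    then have t: "(S, a, b) \<in> crit_index n"
      unfolding crit_index_def using ab ba(3) S(2) by blast
    from ab have "card (S \<union> {a, b}) = card S + 2" using S(3) ba(3) by simp
    then have cT: "card T = card S + 2" using S(1) by simp
    have cP: "card S = card P + 1"
      using card.remove[OF S(3,2)] by (simp add: P_def)
    have pc: "pair_class n (insert x P) p q \<in> low n m" if "{x, p, q} = {i, a, b}" "distinct [x, p, q]" for x p q
    proof (rule pair_class_low)
      show "card (insert x P) \<le> m" using cP cT m by (intro le_trans[OF card_insert_le_m1]) auto
      have "p \<in> {i, a, b}" "q \<in> {i, a, b}" "x \<in> {i, a, b}" using that(1) by blast+
      then show "insert x P \<subseteq> {1..n}" "p \<in> {1..n} - insert x P" "q \<in> {1..n} - insert x P" "p \<noteq> q"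
        using T ba i that(2) by (auto simp: P_def S_def)
    qed
    have pc': "pair_class n P p q \<in> low n m" if "{p, q} \<subseteq> {i, a, b}" "p \<noteq> q" for p q
    proof (rule pair_class_low)
      show "card P \<le> m" using cP cT m by simp
      show "P \<subseteq> {1..n}" "p \<in> {1..n} - P" "q \<in> {1..n} - P" "p \<noteq> q"
        using T ba i that by (auto simp: P_def S_def)
    qed
    have "crit_class n (S, a, b) \<in> low n m"
      using t cT m unfolding low_def by (auto intro!: rat_vec.span_base)
    then have two: "crit_class n (S, a, b) + crit_class n (S, a, b) \<in> low n m"
      using rat_vec.subspace_add[OF subspace_low] by blast
    have iab: "i \<noteq> a" "i \<noteq> b" "a \<noteq> b" using ba by auto
    have "hex n T i b a = crit_class n (S, a, b) + crit_class n (S, a, b)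
      - (pair_class n (insert i P) a b - pair_class n (insert b P) a i + pair_class n (insert a P) b i
         + pair_class n P a b - pair_class n P a i + pair_class n P b i)"
      using two_crit_class[OF t ba(3)] unfolding minS S(1) P_def by (simp add: algebra_simps)
    also have "\<dots> \<in> low n m"
      using iab by (intro rat_vec.subspace_diff[OF subspace_low] rat_vec.subspace_add[OF subspace_low] two
          pc pc') auto
    finally show ?thesis .
  qed
  show ?thesis
  proof (cases "b = c")
    case True
    then show ?thesis using hex_zero[of "Min T" b c n T] rat_vec.subspace_0[OF subspace_low] by simp
  next
    case False
    have "hex n T i b c = - hex n T i c b"
      using hex_swap'[OF T, of i c b] i bc by auto
    then show ?thesis
      using less[of b c] less[of c b] False bc rat_vec.subspace_neg[OF subspace_low]
      unfolding i_def by (cases "b < c") auto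
  qed
qed

text \<open>The relation between hexagons, with the smallest label as the fourth one, expresses any
  other hexagon by those and by hexagons on fewer labels.\<close>

lemma hex_low:
  assumes "T \<subseteq> {1..n}" "a \<in> T" "b \<in> T" "c \<in> T" "card T \<le> m + 2"
  shows "hex n T a b c \<in> low n m"
  using assms
proof (induction "card T" arbitrary: T a b c m rule: less_induct)
  case less
  have fin: "finite T" using less.prems(1) finite_subset by auto
  show ?case
  proof (cases "distinct [a, b, c]")
    case False
    then show ?thesis using hex_zero[OF False] rat_vec.subspace_0[OF subspace_low] by simp
  next
    case True
    define i where "i = Min T"
    have "T \<noteq> {}" using less.prems(2) by auto
    then have i: "i \<in> T" using Min_in[OF fin] by (simp add: i_def)
    have imin: "hex n T i p q \<in> low n m" if "p \<in> T - {i}" "q \<in> T - {i}" for p q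
      using hex_min_low[OF less.prems(1), of p q] that less.prems(5) unfolding i_def by blast
    consider "i = a" | "i = b" | "i = c" | "i \<notin> {a, b, c}" by blast
    then show ?thesis
    proof cases
      case 1
      then show ?thesis using imin[of b c] less.prems True by auto
    next
      case 2
      then have "hex n T b c a \<in> low n m" using imin[of c a] less.prems True by auto
      then show ?thesis by (simp only: hex_rotate[of n T b c a])
    next
      case 3
      then have "hex n T c a b \<in> low n m" using imin[of a b] less.prems True by auto
      then show ?thesis by (simp only: hex_rotate[of n T a b c])
    next
      case 4
      have four: "card {a, b, c, i} \<le> card T" using less.prems i fin by (intro card_mono) auto
      then have m: "4 \<le> card T" using 4 True by (auto simp: card_insert_if)
      have lower: "hex n (T - {x}) p q r \<in> low n m"
        if "x \<in> T" "p \<in> T - {x}" "q \<in> T - {x}" "r \<in> T - {x}" for x p q r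
        using that less.prems fin m by (intro less.hyps) (auto simp: card_gt_0_iff)
      have "hex n T a b c = hex n T i a b + hex n T i b c + hex n T i c a
        + (hex n (T - {a}) i b c + hex n (T - {b}) i c a + hex n (T - {c}) i a b - hex n (T - {i}) a b c)"
        using less.prems i 4 True by (intro hex_relation) auto
      also have "\<dots> \<in> low n m"
        using less.prems i 4 True
        by (intro rat_vec.subspace_add[OF subspace_low] rat_vec.subspace_diff[OF subspace_low]
            imin lower) auto
      finally show ?thesis .
    qed
  qed
qed

section \<open>The new classes\<close>

text \<open>If \<open>hex n T a b c\<close> is thought of as \<open>a \<and> b \<and> c\<close> in the exterior cube of \<open>\<rat>\<^sup>T\<close>, this
  is \<open>e \<and> a \<and> b\<close> for the sum \<open>e\<close> of all labels of \<open>T\<close>.\<close>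

definition eta :: "nat \<Rightarrow> nat set \<Rightarrow> nat \<Rightarrow> nat \<Rightarrow> homology" where
  "eta n T a b = (\<Sum>c\<in>T. hex n T c a b)"

lemma hex_crit_span:
  assumes "T \<subseteq> {1..n}" "a \<in> T" "b \<in> T" "c \<in> T"
  shows "hex n T a b c \<in> crit_span n"
  using hex_low[OF assms, of "card T"] low_crit_span by auto

lemma eta_crit_span:
  assumes "T \<subseteq> {1..n}" "a \<in> T" "b \<in> T"
  shows "eta n T a b \<in> crit_span n"
  unfolding eta_def
  by (intro rat_vec.subspace_sum[OF subspace_crit_span] hex_crit_span) (use assms in auto)

lemma eta_swap:
  assumes "T \<subseteq> {1..n}" "a \<in> T" "b \<in> T"
  shows "eta n T b a = - eta n T a b"
  unfolding eta_def sum_negf[symmetric]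
  by (rule sum.cong[OF refl], rule hex_swap'[OF assms(1) _ assms(2,3)])

lemma eta_same: "eta n T a a = 0"
  by (simp add: eta_def hex_zero)

lemma hact_linear: "hact \<sigma> (x + y) = hact \<sigma> x + hact \<sigma> y" "hact \<sigma> (r *\<^sub>Q x) = r *\<^sub>Q hact \<sigma> x"
  by (transfer, auto simp: relabel_linear homologous_cycles cycle_closure relabel_all_chains2 relabel_bd)+

lemma hact_sum: "hact \<sigma> (sum g A) = (\<Sum>a\<in>A. hact \<sigma> (g a))"
  by (induction A rule: infinite_finite_induct) (simp_all add: hact_linear hact_0)

lemma hact_eta:
  assumes "T \<subseteq> {1..n}" "a \<in> T" "b \<in> T" "\<sigma> permutes {1..n}"
  shows "hact \<sigma> (eta n T a b) = eta n (\<sigma> ` T) (\<sigma> a) (\<sigma> b)"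
proof -
  have inj: "inj_on \<sigma> T" using permutes_inj_on[OF assms(4)] .
  have "hact \<sigma> (eta n T a b) = (\<Sum>c\<in>T. hex n (\<sigma> ` T) (\<sigma> c) (\<sigma> a) (\<sigma> b))"
    unfolding eta_def hact_sum by (rule sum.cong[OF refl], rule hact_hex[OF assms(1) _ assms(2-4)])
  then show ?thesis by (simp add: eta_def sum.reindex[OF inj])
qed

text \<open>This is \<open>e \<and> a \<and> e = 0\<close>.\<close>

lemma sum_eta_zero:
  assumes "T \<subseteq> {1..n}" "a \<in> T"
  shows "(\<Sum>b\<in>T. eta n T a b) = 0"
proof -
  have "(\<Sum>b\<in>T. eta n T a b) = (\<Sum>b\<in>T. \<Sum>c\<in>T. hex n T c a b)" by (simp add: eta_def)
  also have "\<dots> = (\<Sum>c\<in>T. \<Sum>b\<in>T. hex n T c a b)" by (rule sum.swap)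
  also have "\<dots> = (\<Sum>c\<in>T. \<Sum>b\<in>T. - hex n T b a c)"
  proof (intro sum.cong refl)
    fix c b assume "c \<in> T" "b \<in> T"
    then have "hex n T a b c = - hex n T a c b" by (intro hex_swap'[OF assms]) auto
    then show "hex n T c a b = - hex n T b a c" by (metis hex_rotate)
  qed
  also have "\<dots> = - (\<Sum>b\<in>T. eta n T a b)" by (simp add: eta_def sum_negf)
  finally have "2 *\<^sub>Q (\<Sum>b\<in>T. eta n T a b) = 0"
    using scaleQ_add_left[of 1 1 "\<Sum>b\<in>T. eta n T a b"] by (simp add: eq_neg_iff_add_eq_0)
  then show ?thesis by simp
qed

text \<open>The labels of \<open>T\<close> other than its minimum are a basis of \<open>\<rat>\<^sup>T\<close> modulo \<open>e\<close>.\<close>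

definition new_index :: "nat \<Rightarrow> nat \<Rightarrow> (nat set \<times> nat \<times> nat) set" where
  "new_index n m = {(T, a, b). T \<subseteq> {1..n} \<and> card T = m + 2 \<and> a \<in> T - {Min T} \<and> b \<in> T - {Min T} \<and> a < b}"

definition new_basis :: "nat \<Rightarrow> nat \<Rightarrow> homology set" where
  "new_basis n m = (\<lambda>(T, a, b). eta n T a b) ` new_index n m"

definition eta_span :: "nat \<Rightarrow> nat \<Rightarrow> homology set" where
  "eta_span m n = rat_vec.span {eta n T a b |T a b. T \<subseteq> {1..n} \<and> card T = m + 2 \<and> a \<in> T \<and> b \<in> T}"

lemma subspace_eta_span: "rat_vec.subspace (eta_span m n)"
  by (simp add: eta_span_def rat_vec.subspace_span)

lemma eta_in_eta_span:
  "T \<subseteq> {1..n} \<Longrightarrow> card T = m + 2 \<Longrightarrow> a \<in> T \<Longrightarrow> b \<in> T \<Longrightarrow> eta n T a b \<in> eta_span m n"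
  unfolding eta_span_def by (rule rat_vec.span_base) auto

lemma eta_span_crit_span: "eta_span m n \<subseteq> crit_span n"
  unfolding eta_span_def
  by (rule rat_vec.span_minimal[OF _ subspace_crit_span]) (use eta_crit_span in blast)

lemma finite_new_index: "finite (new_index n m)"
  by (rule finite_subset[of _ "Pow {1..n} \<times> {1..n} \<times> {1..n}"]) (auto simp: new_index_def)

text \<open>The minimum of \<open>T\<close> can be eliminated by \<open>sum_eta_zero\<close>.\<close>

lemma span_new_basis: "rat_vec.span (new_basis n m) = eta_span m n"
proof
  show "rat_vec.span (new_basis n m) \<subseteq> eta_span m n"
    unfolding eta_span_def new_basis_def by (rule rat_vec.span_mono) (auto simp: new_index_def)
  show "eta_span m n \<subseteq> rat_vec.span (new_basis n m)"
    unfolding eta_span_def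
  proof (rule rat_vec.span_minimal[OF _ rat_vec.subspace_span], safe)
    fix T a b assume T: "T \<subseteq> {1..n}" "card T = m + 2" "a \<in> T" "b \<in> T"
    define i where "i = Min T"
    have fin: "finite T" using T(1) finite_subset by auto
    have i: "i \<in> T" using Min_in[OF fin] T(3) by (auto simp: i_def)
    let ?V = "rat_vec.span (new_basis n m)"
    have less: "eta n T a b \<in> ?V" if "a \<in> T - {i}" "b \<in> T - {i}" "a < b" for a b
      using that T unfolding new_basis_def new_index_def i_def
      by (intro rat_vec.span_base image_eqI[of _ _ "(T, a, b)"]) auto
    have nomin: "eta n T a b \<in> ?V" if ab: "a \<in> T - {i}" "b \<in> T - {i}" for a b
    proof -
      have "eta n T a b = - eta n T b a" using ab by (intro eta_swap[OF T(1)]) auto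
      then have "eta n T a b \<in> ?V" if "b < a"
        using rat_vec.span_neg[OF less[OF ab(2,1) that]] by simp
      then show ?thesis
        using less[OF ab] by (cases rule: linorder_cases[of a b]) (simp_all add: eta_same rat_vec.span_zero)
    qed
    have right: "eta n T a i \<in> ?V" if a: "a \<in> T - {i}" for a
    proof -
      have "0 = eta n T a i + (\<Sum>b\<in>T - {i}. eta n T a b)"
        using sum_eta_zero[OF T(1), of a] sum.remove[OF fin i, of "eta n T a"] a by auto
      then have "eta n T a i = - (\<Sum>b\<in>T - {i}. eta n T a b)"
        by (simp add: eq_neg_iff_add_eq_0)
      also have "\<dots> \<in> ?V" using nomin a by (intro rat_vec.span_neg rat_vec.span_sum) auto
      finally show ?thesis .
    qed
    show "eta n T a b \<in> ?V"
    proof (cases "a = i \<or> b = i")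
      case True
      have "eta n T i i \<in> ?V" by (simp add: eta_same rat_vec.span_zero)
      moreover have "eta n T i b \<in> ?V" if "b \<noteq> i"
        using rat_vec.span_neg[OF right[of b]] eta_swap[OF T(1,4) i] T(4) that by simp
      moreover have "eta n T a i \<in> ?V" if "a \<noteq> i" using right[of a] T(3) that by simp
      ultimately show ?thesis using True by (cases "a = i"; cases "b = i") simp_all
    next
      case False
      then show ?thesis using nomin[of a b] T by simp
    qed
  qed
qed

text \<open>For \<open>w = a \<and> b \<and> c\<close> with contraction \<open>\<partial>w = a \<and> b + b \<and> c + c \<and> a\<close> this is the identity
  \<open>\<partial>(e \<and> w) = |T| w - e \<and> \<partial>w\<close>: the contraction on the left is a sum of relations between hexagons
  (\<open>hex_relation\<close>), so it only leaves classes on smaller sets.\<close>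

lemma hex_eta:
  assumes T: "T \<subseteq> {1..n}" "a \<in> T" "b \<in> T" "c \<in> T" and d: "distinct [a, b, c]"
  shows "of_nat (card T) *\<^sub>Q hex n T a b c = eta n T a b + eta n T b c + eta n T c a
    + (\<Sum>x\<in>T - {a, b, c}. hex n (T - {a}) x b c + hex n (T - {b}) x c a + hex n (T - {c}) x a b
        - hex n (T - {x}) a b c)"
proof -
  have fin: "finite T" using T(1) finite_subset by auto
  define L where "L x = (if x \<in> {a, b, c} then 0 else hex n (T - {a}) x b c + hex n (T - {b}) x c a
    + hex n (T - {c}) x a b - hex n (T - {x}) a b c)" for x
  have step: "hex n T a b c = (hex n T x a b + hex n T x b c + hex n T x c a) + L x" if "x \<in> T" for x
  proof -
    consider "x = a" | "x = b" | "x = c" | "x \<notin> {a, b, c}" by blast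
    then show ?thesis
    proof cases
      case 1
      then show ?thesis by (simp add: L_def hex_zero)
    next
      case 2
      then show ?thesis by (simp add: L_def hex_zero hex_rotate[of n T b c a])
    next
      case 3
      then show ?thesis by (simp add: L_def hex_zero hex_rotate[of n T a b c])
    next
      case 4
      then show ?thesis using hex_relation[of T n a b c x] T d that by (auto simp: L_def)
    qed
  qed
  have cs: "(\<Sum>x\<in>T. h) = of_nat (card T) *\<^sub>Q h" for h :: homology
    using fin by (induction T) (simp_all add: scaleQ_add_left)
  have "of_nat (card T) *\<^sub>Q hex n T a b c = (\<Sum>x\<in>T. hex n T a b c)" by (rule cs[symmetric])
  also have "\<dots> = (\<Sum>x\<in>T. (hex n T x a b + hex n T x b c + hex n T x c a) + L x)"
    using step by (rule sum.cong[OF refl])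
  also have "\<dots> = eta n T a b + eta n T b c + eta n T c a + (\<Sum>x\<in>T. L x)"
    by (simp add: eta_def sum.distrib)
  also have "(\<Sum>x\<in>T. L x) = (\<Sum>x\<in>T - {a, b, c}. L x)"
    by (rule sum.mono_neutral_right) (auto simp: L_def fin)
  also have "\<dots> = (\<Sum>x\<in>T - {a, b, c}. hex n (T - {a}) x b c + hex n (T - {b}) x c a
      + hex n (T - {c}) x a b - hex n (T - {x}) a b c)"
    by (rule sum.cong) (auto simp: L_def)
  finally show ?thesis .
qed

text \<open>Solve \<open>hex_eta\<close> for the hexagon: the remaining hexagons live on sets with one label less.\<close>

lemma hex_in_new_span:
  assumes "T \<subseteq> {1..n}" "a \<in> T" "b \<in> T" "c \<in> T" "card T \<le> m + 2"
  shows "hex n T a b c \<in> rat_vec.span (\<Union>l\<in>{1..m}. new_basis n l)"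
  using assms
proof (induction "card T" arbitrary: T a b c m rule: less_induct)
  case less
  let ?V = "rat_vec.span (\<Union>l\<in>{1..m}. new_basis n l)"
  have fin: "finite T" using less.prems(1) finite_subset by auto
  show ?case
  proof (cases "distinct [a, b, c]")
    case False
    then show ?thesis using hex_zero[OF False] rat_vec.span_zero by simp
  next
    case True
    have "card {a, b, c} \<le> card T" using less.prems fin by (intro card_mono) auto
    then have three: "3 \<le> card T" using True by (auto simp: card_insert_if)
    have eta: "eta n T p q \<in> ?V" if "p \<in> T" "q \<in> T" for p q
    proof -
      have "eta_span (card T - 2) n \<subseteq> ?V"
        unfolding span_new_basis[symmetric]
        using three less.prems(5) by (intro rat_vec.span_mono UN_upper) auto
      then show ?thesis using eta_in_eta_span[of T n "card T - 2" p q] that less.prems(1) three by auto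
    qed
    have lower: "hex n (T - {x}) p q r \<in> ?V"
      if "x \<in> T" "p \<in> T - {x}" "q \<in> T - {x}" "r \<in> T - {x}" for x p q r
      using that less.prems fin three by (intro less.hyps) (auto simp: card_gt_0_iff)
    have "of_nat (card T) *\<^sub>Q hex n T a b c \<in> ?V"
      unfolding hex_eta[OF less.prems(1-4) True]
      using less.prems True
      by (intro rat_vec.span_add rat_vec.span_sum rat_vec.span_diff eta lower) auto
    then have "inverse (of_nat (card T)) *\<^sub>Q of_nat (card T) *\<^sub>Q hex n T a b c \<in> ?V"
      by (rule rat_vec.span_scale)
    then show ?thesis using three by (simp add: scaleQ_scaleQ)
  qed
qed

text \<open>One inclusion holds because the new classes are sums of hexagons (\<open>hex_low\<close>); for the
  other one, an element of type A is half a hexagon up to elements of type B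
  (\<open>two_crit_class\<close>).\<close>

lemma span_new_basis_setB:
  assumes m: "m + 2 \<le> n"
  shows "rat_vec.span (setB n 0 \<union> (\<Union>l\<in>{1..m}. new_basis n l \<union> setB n l)) = low n m"
    (is "?V = _")
proof
  show "?V \<subseteq> low n m"
  proof (rule rat_vec.span_minimal[OF _ subspace_low])
    have "setB n l \<subseteq> low n m" if "l \<le> m" for l
      using that m setB_eq[of l n] unfolding low_def by (auto intro!: rat_vec.span_base)
    moreover have "new_basis n l \<subseteq> low n m" if "l \<le> m" for l
      using that unfolding new_basis_def new_index_def eta_def
      by (auto intro!: rat_vec.subspace_sum[OF subspace_low] hex_low)
    ultimately show "setB n 0 \<union> (\<Union>l\<in>{1..m}. new_basis n l \<union> setB n l) \<subseteq> low n m"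
      by fastforce
  qed
  show "low n m \<subseteq> ?V"
    unfolding low_def
  proof (rule rat_vec.span_minimal[OF _ rat_vec.subspace_span], safe)
    fix S a b assume t: "(S, a, b) \<in> crit_index n" "card S \<le> m"
    note d = crit_indexD[OF t(1)]
    have B: "crit_class n (P, p, q) \<in> ?V" if "(P, p, q) \<in> crit_index n" "card P \<le> m" "p < q" for P p q
    proof (rule rat_vec.span_base)
      have "crit_class n (P, p, q) \<in> setB n (card P)"
        using setB_eq[of "card P" n] m that by auto
      then show "crit_class n (P, p, q) \<in> setB n 0 \<union> (\<Union>l\<in>{1..m}. new_basis n l \<union> setB n l)"
        using that(2) by (cases "card P") auto
    qed
    have pc: "pair_class n P p q \<in> ?V"
      if "P \<subseteq> {1..n}" "p \<in> {1..n} - P" "q \<in> {1..n} - P" "p \<noteq> q" "card P \<le> m" for P p q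
      unfolding pair_class_crit_class(2)[OF that(1-4)]
      using that(4) by (intro B pair_class_crit_class(1)[OF that(1-4)] that(5)) (simp add: min_def max_def)
    consider "a < b" | "b < a" using d by linarith
    then show "crit_class n (S, a, b) \<in> ?V"
    proof cases
      case 1
      then show ?thesis using B t by blast
    next
      case 2
      note h = crit_index_hexagon[OF t(1) 2]
      define i where "i = Min S"
      define P where "P = S - {i}"
      have iP: "S = insert i P" "i \<notin> P" "finite P" "a \<notin> P" "b \<notin> P" "i \<noteq> a" "i \<noteq> b" "i \<in> {1..n}" "P \<subseteq> {1..n}"
        using h d by (auto simp: i_def P_def)
      have cS: "card S = Suc (card P)" using iP(1-3) by simp
      have cT: "card (S \<union> {a, b}) \<le> m + 2" using d t(2) by simp
      have cP: "card P \<le> m" using cS t(2) by simp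
      have cI: "card (insert x P) \<le> m" for x using cS t(2) card_insert_le_m1[of m P x] by simp
      have hexV: "hex n (S \<union> {a, b}) i b a \<in> ?V"
      proof -
        have "(\<Union>l\<in>{1..m}. new_basis n l) \<subseteq> setB n 0 \<union> (\<Union>l\<in>{1..m}. new_basis n l \<union> setB n l)" by blast
        moreover have "hex n (S \<union> {a, b}) i b a \<in> rat_vec.span (\<Union>l\<in>{1..m}. new_basis n l)"
          using d iP cT by (intro hex_in_new_span) auto
        ultimately show ?thesis using rat_vec.span_mono by blast
      qed
      have "2 *\<^sub>Q crit_class n (S, a, b) = crit_class n (S, a, b) + crit_class n (S, a, b)"
        using scaleQ_add_left[of 1 1 "crit_class n (S, a, b)"] by simp
      also have "\<dots> \<in> ?V"
        unfolding two_crit_class[OF t(1) 2, folded i_def, folded P_def]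
        using iP(2,4-9) d(2,3,6) cI cP
        by (intro rat_vec.span_add rat_vec.span_diff hexV pc) simp_all
      finally have "(1 / 2) *\<^sub>Q 2 *\<^sub>Q crit_class n (S, a, b) \<in> ?V" by (rule rat_vec.span_scale)
      then show ?thesis by (simp add: scaleQ_scaleQ)
    qed
  qed
qed

section \<open>Functionals dual to the new classes\<close>

text \<open>The coefficient of a triple whose left labels together with the pair \<open>p q\<close> are exactly
  the labels of \<open>T\<close>.\<close>

definition coeff_at :: "nat set \<Rightarrow> nat \<Rightarrow> nat \<Rightarrow> trace \<Rightarrow> rat" where
  "coeff_at T p q x = Poly_Mapping.lookup x (T - {p, q}, p, q)"

text \<open>Up to sign, the part of the trace of \<open>hex n T a b c\<close> with label set \<open>T\<close> is the
  contraction \<open>b \<and> c + c \<and> a + a \<and> b\<close> in the exterior square of \<open>\<rat>\<^sup>T\<close>. The functional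
  adds the coefficients of \<open>p \<and> q\<close>, \<open>q \<and> r\<close> and \<open>r \<and> p\<close>, which is a functional that vanishes on
  all \<open>e \<and> b\<close>.\<close>

definition theta :: "nat set \<Rightarrow> nat \<Rightarrow> nat \<Rightarrow> nat \<Rightarrow> homology \<Rightarrow> rat" where
  "theta T p q r h = coeff_at T p q (trace_class h) + coeff_at T q r (trace_class h)
     + coeff_at T r p (trace_class h)"

text \<open>The coefficient of \<open>p \<and> q\<close> in \<open>a \<and> b\<close>.\<close>

definition alt2 :: "nat \<Rightarrow> nat \<Rightarrow> nat \<Rightarrow> nat \<Rightarrow> rat" where
  "alt2 a b p q = (if a = p \<and> b = q then 1 else 0) - (if a = q \<and> b = p then 1 else 0)"

lemma coeff_at_sum: "coeff_at T p q (sum g A) = (\<Sum>a\<in>A. coeff_at T p q (g a))"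
  by (simp add: coeff_at_def lookup_sum)

lemma theta_linear:
  "theta T p q r (x + y) = theta T p q r x + theta T p q r y"
  "theta T p q r (s *\<^sub>Q x) = s * theta T p q r x"
  "theta T p q r 0 = 0"
  by (simp_all add: theta_def coeff_at_def trace_class_add trace_class_scale lookup_add lookup_scaleQ
      scaleQ_rat_def algebra_simps)

lemma theta_sum: "theta T p q r (sum g A) = (\<Sum>a\<in>A. theta T p q r (g a))"
  by (induction A rule: infinite_finite_induct) (simp_all add: theta_linear)

lemma trace_hex:
  assumes "T \<subseteq> {1..n}" "a \<in> T" "b \<in> T" "c \<in> T" "distinct [a, b, c]"
  shows "trace_class (hex n T a b c) = (- 1) ^ card (T - {a, b, c}) *\<^sub>Q (
       (basis_elt (T - {b, c}, b, c) - basis_elt (T - {b, c}, c, b))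
     + (basis_elt (T - {c, a}, c, a) - basis_elt (T - {c, a}, a, c))
     + (basis_elt (T - {a, b}, a, b) - basis_elt (T - {a, b}, b, a))
     - (basis_elt (T - {a, b, c}, b, c) - basis_elt (T - {a, b, c}, c, b))
     - (basis_elt (T - {a, b, c}, c, a) - basis_elt (T - {a, b, c}, a, c))
     - (basis_elt (T - {a, b, c}, a, b) - basis_elt (T - {a, b, c}, b, a)))"
proof -
  have P: "T - {a, b, c} \<union> {a, b, c} \<subseteq> {1..n}" "(T - {a, b, c}) \<inter> {a, b, c} = {}" using assms by auto
  have e: "insert a (T - {a, b, c}) = T - {b, c}" "insert b (T - {a, b, c}) = T - {c, a}"
    "insert c (T - {a, b, c}) = T - {a, b}" using assms by auto
  show ?thesis
    unfolding hex_def trace_placed[OF alt_hexagon_cycles1[OF assms(5)] P]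
    by (simp add: alt_hexagon_def trace_chain_linear trace_chain_basis_elt all_singletons_simps
        add_left_linear add_left_basis_elt e algebra_simps)
qed

lemma coeff_at_hex:
  assumes T: "T \<subseteq> {1..n}" "a \<in> T" "b \<in> T" "c \<in> T" "p \<in> T" "q \<in> T" and pq: "p \<noteq> q"
  shows "coeff_at T p q (trace_class (hex n T a b c))
    = - ((- 1) ^ card T) * (alt2 c a p q + alt2 a b p q + alt2 b c p q)"
proof (cases "distinct [a, b, c]")
  case True
  have fin: "finite T" using T(1) finite_subset by auto
  have "card {a, b, c} = 3" using True by simp
  moreover have "card {a, b, c} \<le> card T" using T fin by (intro card_mono) auto
  ultimately have "card T = card (T - {a, b, c}) + 3"
    using T fin card_Diff_subset[of "{a, b, c}" T] by simp
  then have sign: "(- 1) ^ card (T - {a, b, c}) = - ((- 1 :: rat) ^ card T)"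
    by (simp add: power_add power3_eq_cube)
  have deep: "T - {a, b, c} \<noteq> T - {b, c}" "T - {a, b, c} \<noteq> T - {a, b}" "T - {a, b, c} \<noteq> T - {c, a}"
     "T - {a, b, c} \<noteq> T - {c, b}" "T - {a, b, c} \<noteq> T - {b, a}" "T - {a, b, c} \<noteq> T - {a, c}"
    using T True by auto
  have low: "(T - {x, y}, x, y) = (T - {p, q}, p, q) \<longleftrightarrow> x = p \<and> y = q"
      "(T - {y, x}, x, y) = (T - {p, q}, p, q) \<longleftrightarrow> x = p \<and> y = q" for x y
    unfolding insert_commute[of y x "{}"] prod.inject by (rule iffI; elim conjE; simp)+
  have low': "(T - {a, b, c}, x, y) = (T - {p, q}, p, q) \<longleftrightarrow> False" if "T - {a, b, c} \<noteq> T - {x, y}" for x y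
    using that by auto
  note lows = low'[OF deep(1)] low'[OF deep(2)] low'[OF deep(3)] low'[OF deep(4)] low'[OF deep(5)]
    low'[OF deep(6)]
  show ?thesis
    unfolding trace_hex[OF T(1-4) True] coeff_at_def sign lookup_scaleQ lookup_add lookup_minus
      lookup_basis_elt scaleQ_rat_def low lows alt2_def if_False
    by (simp add: conj_commute)
next
  case False
  have "alt2 c a p q + alt2 a b p q + alt2 b c p q = 0"
    using False pq by (auto simp: alt2_def)
  then show ?thesis by (simp add: hex_zero[OF False] coeff_at_def)
qed

text \<open>The contraction of \<open>e \<and> a \<and> b\<close> is \<open>|T| a \<and> b - e \<and> b + e \<and> a\<close>, and \<open>theta\<close> kills the last
  two terms.\<close>

lemma theta_eta:
  assumes T: "T \<subseteq> {1..n}" "a \<in> T" "b \<in> T" "p \<in> T" "q \<in> T" "r \<in> T" and d: "distinct [p, q, r]"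
  shows "theta T p q r (eta n T a b)
    = - ((- 1) ^ card T) * of_nat (card T) * (alt2 a b p q + alt2 a b q r + alt2 a b r p)"
proof -
  have fin: "finite T" using T(1) finite_subset by auto
  have delta: "(\<Sum>c\<in>T. if c = x \<and> Q then 1 else 0 :: rat) = (if Q then 1 else 0)" if "x \<in> T" for x Q
    using that fin by (cases Q) simp_all
  have coeff: "coeff_at T x y (trace_class (eta n T a b)) = - ((- 1) ^ card T) *
      (of_nat (card T) * alt2 a b x y + ((if a = y then 1 else 0) - (if a = x then 1 else 0))
       + ((if b = x then 1 else 0) - (if b = y then 1 else 0)))" if xy: "x \<in> T" "y \<in> T" "x \<noteq> y" for x y
  proof -
    have "coeff_at T x y (trace_class (eta n T a b))
        = (\<Sum>c\<in>T. - ((- 1) ^ card T) * (alt2 b c x y + alt2 c a x y + alt2 a b x y))"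
      unfolding eta_def trace_class_sum coeff_at_sum
      by (rule sum.cong) (use T xy in \<open>auto simp: coeff_at_hex\<close>)
    also have "\<dots> = - ((- 1) ^ card T) * ((\<Sum>c\<in>T. alt2 b c x y) + (\<Sum>c\<in>T. alt2 c a x y) + of_nat (card T) * alt2 a b x y)"
      by (simp add: sum_distrib_left[symmetric] sum.distrib sum_negf)
    also have "(\<Sum>c\<in>T. alt2 c a x y) = (if a = y then 1 else 0) - (if a = x then 1 else 0)"
      using delta xy by (simp add: alt2_def sum_subtractf)
    also have "(\<Sum>c\<in>T. alt2 b c x y) = (\<Sum>c\<in>T. (if c = y \<and> b = x then 1 else 0) - (if c = x \<and> b = y then 1 else 0))"
      by (simp add: alt2_def conj_commute)
    also have "\<dots> = (if b = x then 1 else 0) - (if b = y then 1 else 0)"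
      using delta xy by (simp add: sum_subtractf)
    finally show ?thesis by (simp add: add_ac)
  qed
  show ?thesis
    using d T by (simp add: theta_def coeff algebra_simps)
qed

text \<open>The trace of \<open>hex n T\<close> only involves labels of \<open>T\<close>, and the functional for \<open>T\<close> looks at
  entries involving exactly the labels of \<open>T\<close>.\<close>

lemma keys_trace_eta:
  assumes "T \<subseteq> {1..n}" "a \<in> T" "b \<in> T"
  shows "Poly_Mapping.keys (trace_class (eta n T a b)) \<subseteq> {(S, x, y). S \<union> {x, y} \<subseteq> T}"
proof -
  let ?K = "{x :: trace. Poly_Mapping.keys x \<subseteq> {(S, x, y). S \<union> {x, y} \<subseteq> T}}"
  have "trace_class (hex n T c a b) \<in> ?K" if "c \<in> T" for c
  proof (cases "distinct [c, a, b]")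
    case True
    show ?thesis
      unfolding trace_hex[OF assms(1) that assms(2,3) True]
      by (intro rat_vec.subspace_scale[OF subspace_keys] rat_vec.subspace_add[OF subspace_keys]
          rat_vec.subspace_diff[OF subspace_keys]) (use assms that in auto)
  next
    case False
    then show ?thesis by (simp add: hex_zero)
  qed
  then have "trace_class (eta n T a b) \<in> ?K"
    unfolding eta_def trace_class_sum by (intro rat_vec.subspace_sum[OF subspace_keys])
  then show ?thesis by simp
qed

lemma theta_eta_other:
  assumes "T' \<subseteq> {1..n}" "a \<in> T'" "b \<in> T'" "card T' = card T" "T' \<noteq> T" "p \<in> T" "q \<in> T" "r \<in> T"
  shows "theta T p q r (eta n T' a b) = 0"
proof -
  have fin: "finite T'" using assms(1) finite_subset by auto
  have "coeff_at T x y (trace_class (eta n T' a b)) = 0" if "x \<in> T" "y \<in> T" for x y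
  proof (rule ccontr)
    assume "coeff_at T x y (trace_class (eta n T' a b)) \<noteq> 0"
    then have "(T - {x, y}, x, y) \<in> Poly_Mapping.keys (trace_class (eta n T' a b))"
      by (simp add: coeff_at_def in_keys_iff)
    then have "T \<subseteq> T'" using keys_trace_eta[OF assms(1-3)] that by auto
    then show False using card_subset_eq[OF fin] assms(4,5) by metis
  qed
  then show ?thesis using assms by (simp add: theta_def)
qed

text \<open>With \<open>r = Min T\<close> the terms \<open>alt2 a b q r\<close> and \<open>alt2 a b r p\<close> vanish, because \<open>a\<close> and \<open>b\<close>
  differ from \<open>Min T\<close>.\<close>

lemma theta_dual:
  assumes t: "(T, p, q) \<in> new_index n m" and s: "(T', a, b) \<in> new_index n m"
  shows "theta T p q (Min T) (eta n T' a b)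
    = (if (T', a, b) = (T, p, q) then - ((- 1) ^ card T) * of_nat (card T) else 0)"
proof -
  define i where "i = Min T"
  have T: "T \<subseteq> {1..n}" "card T = m + 2" "p \<in> T" "q \<in> T" "p \<noteq> i" "q \<noteq> i" "p < q"
    using t by (auto simp: new_index_def i_def)
  have "T \<noteq> {}" "finite T" using T finite_subset by auto
  then have i: "i \<in> T" using Min_in[of T] by (simp add: i_def)
  have T': "T' \<subseteq> {1..n}" "card T' = m + 2" "a \<in> T'" "b \<in> T'" "a \<noteq> Min T'" "b \<noteq> Min T'" "a < b"
    using s by (auto simp: new_index_def)
  show ?thesis
  proof (cases "T' = T")
    case True
    have "theta T p q i (eta n T a b)
        = - ((- 1) ^ card T) * of_nat (card T) * (alt2 a b p q + alt2 a b q i + alt2 a b i p)"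
      using T T' True i by (intro theta_eta) auto
    also have "alt2 a b p q + alt2 a b q i + alt2 a b i p = (if a = p \<and> b = q then 1 else 0)"
      using T T' True by (auto simp: alt2_def i_def)
    finally show ?thesis using True by (simp add: i_def)
  next
    case False
    then show ?thesis using theta_eta_other[of T' n a b T p q i] T T' i by (simp add: i_def)
  qed
qed

lemma theta_dual_sum:
  assumes t: "(T, p, q) \<in> new_index n m"
  shows "theta T p q (Min T) (\<Sum>t\<in>new_index n m. c t *\<^sub>Q (\<lambda>(T, a, b). eta n T a b) t)
    = c (T, p, q) * (- ((- 1) ^ card T) * of_nat (card T))"
proof -
  have "theta T p q (Min T) (\<Sum>t\<in>new_index n m. c t *\<^sub>Q (\<lambda>(T, a, b). eta n T a b) t)
      = (\<Sum>s\<in>new_index n m. c s * theta T p q (Min T) ((\<lambda>(T, a, b). eta n T a b) s))"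
    by (simp only: theta_sum theta_linear)
  also have "\<dots> = (\<Sum>s\<in>new_index n m. if s = (T, p, q) then c s * (- ((- 1) ^ card T) * of_nat (card T)) else 0)"
  proof (rule sum.cong[OF refl])
    fix s assume "s \<in> new_index n m"
    then show "c s * theta T p q (Min T) ((\<lambda>(T, a, b). eta n T a b) s)
      = (if s = (T, p, q) then c s * (- ((- 1) ^ card T) * of_nat (card T)) else 0)"
      using theta_dual[OF t] by (cases s) auto
  qed
  also have "\<dots> = c (T, p, q) * (- ((- 1) ^ card T) * of_nat (card T))"
    using t finite_new_index by simp
  finally show ?thesis .
qed

lemma new_independent_family:
  assumes zero: "(\<Sum>t\<in>new_index n m. c t *\<^sub>Q (\<lambda>(T, a, b). eta n T a b) t) = 0"
  shows "\<forall>t\<in>new_index n m. c t = 0"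
proof safe
  fix T p q assume t: "(T, p, q) \<in> new_index n m"
  then have "card T = m + 2" by (simp add: new_index_def)
  then show "c (T, p, q) = 0"
    using theta_dual_sum[OF t, of c] by (simp add: zero theta_linear(3))
qed

lemma new_basis_independent: "rat_vec.independent (new_basis n m)"
  unfolding new_basis_def
  by (rule family_independent(2)[OF finite_new_index]) (rule new_independent_family)

text \<open>An element of type A with left labels \<open>S\<close> and pair \<open>a b\<close> corresponds to \<open>T = S \<union> {a, b}\<close>
  and \<open>b < a\<close>. That some label of \<open>S\<close> is below \<open>b\<close> says that neither label of the pair is the
  minimum of \<open>T\<close>.\<close>

lemma card_new_basis:
  assumes "m + 2 \<le> n" "1 \<le> m"
  shows "card (new_basis n m) = card (setA n m)"
proof -
  let ?A = "{(S, a, b) \<in> crit_index n. card S = m \<and> b < a}"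
  have "card (new_basis n m) = card (new_index n m)"
    unfolding new_basis_def
    by (rule card_image, rule family_independent(1)[OF finite_new_index]) (rule new_independent_family)
  also have "\<dots> = card ?A"
  proof (rule bij_betw_same_card)
    show "bij_betw (\<lambda>(T, a, b). (T - {a, b}, b, a)) (new_index n m) ?A"
    proof (rule bij_betwI[where g = "\<lambda>(S, a, b). (S \<union> {a, b}, b, a)"])
      show "(\<lambda>(T, a, b). (T - {a, b}, b, a)) \<in> new_index n m \<rightarrow> ?A"
      proof safe
        fix T a b assume "(T, a, b) \<in> new_index n m"
        then have T: "T \<subseteq> {1..n}" "card T = m + 2" "a \<in> T" "b \<in> T" "a \<noteq> Min T" "b \<noteq> Min T" "a < b"
          by (auto simp: new_index_def)
        have fin: "finite T" using T(1) finite_subset by auto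
        have "Min T \<in> T" using Min_in[OF fin] T(3) by auto
        moreover have "Min T < a" using Min_le[OF fin T(3)] T(5) by simp
        ultimately have "Min T \<in> T - {a, b}" using T by auto
        then show "(T - {a, b}, b, a) \<in> crit_index n"
          using T \<open>Min T < a\<close> unfolding crit_index_def by auto
        show "card (T - {a, b}) = m" using T fin by (simp add: card_Diff_subset)
        show "a < b" by (rule T(7))
      qed
      show "(\<lambda>(S, a, b). (S \<union> {a, b}, b, a)) \<in> ?A \<rightarrow> new_index n m"
      proof safe
        fix S a b assume t: "(S, a, b) \<in> crit_index n" "b < a" "m = card S"
        note h = crit_index_hexagon[OF t(1,2)] and d = crit_indexD[OF t(1)]
        have "Min (S \<union> {a, b}) = Min S"
          using h t(2) by (intro Min_eqI) (auto simp: Min_le)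
        then show "(S \<union> {a, b}, b, a) \<in> new_index n (card S)"
          using d h t(2) by (auto simp: new_index_def)
      qed
    qed (auto simp: new_index_def crit_index_def)
  qed
  also have "\<dots> = card (setA n m)"
    unfolding setA_eq[OF assms]
    by (rule card_image[symmetric]) (rule inj_on_subset[OF crit_class_inj], auto)
  finally show ?thesis .
qed

section \<open>Linear maps on subspaces and quotients\<close>

lemma lin_on_zero: "lin_on V f \<Longrightarrow> 0 \<in> V \<Longrightarrow> f 0 = 0"
  unfolding lin_on_def by (metis rat_vec.scale_zero_left)

lemma lin_on_sum:
  assumes "lin_on V f" "rat_vec.subspace V" "\<And>a. a \<in> A \<Longrightarrow> g a \<in> V"
  shows "f (sum g A) = (\<Sum>a\<in>A. f (g a))"
  using assms(3)
proof (induction A rule: infinite_finite_induct)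
  case (insert a A)
  then have "g a \<in> V" "sum g A \<in> V" by (auto intro!: rat_vec.subspace_sum[OF assms(2)])
  then have "f (g a + sum g A) = f (g a) + f (sum g A)" using assms(1) by (simp add: lin_on_def)
  then show ?case using insert by simp
qed (simp_all add: lin_on_zero[OF assms(1) rat_vec.subspace_0[OF assms(2)]])

lemma lin_on_diff:
  assumes "lin_on V f" "rat_vec.subspace V" "x \<in> V" "y \<in> V"
  shows "f (x - y) = f x - f y"
proof -
  have "f ((x - y) + y) = f (x - y) + f y"
    using assms(1,4) rat_vec.subspace_diff[OF assms(2-4)] unfolding lin_on_def by blast
  then show ?thesis by simp
qed

lemma subspace_preimage:
  assumes "lin_on V f" "rat_vec.subspace V" "rat_vec.subspace W"
  shows "rat_vec.subspace {x \<in> V. f x \<in> W}"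
  using assms lin_on_zero[OF assms(1)]
  unfolding rat_vec.subspace_def lin_on_def by auto

lemma subspace_image_lin_on:
  assumes "lin_on V f" "rat_vec.subspace V"
  shows "rat_vec.subspace (f ` V)"
  unfolding rat_vec.subspace_def
proof (intro conjI ballI allI)
  show "0 \<in> f ` V"
    using lin_on_zero[OF assms(1)] rat_vec.subspace_0[OF assms(2)] by (metis image_eqI)
  show "x + y \<in> f ` V" if xy: "x \<in> f ` V" "y \<in> f ` V" for x y
  proof -
    obtain x' y' where "x = f x'" "x' \<in> V" "y = f y'" "y' \<in> V" using xy by blast
    then show ?thesis using assms(1) rat_vec.subspace_add[OF assms(2)]
      by (intro image_eqI[of _ _ "x' + y'"]) (auto simp: lin_on_def)
  qed
  show "c *\<^sub>Q x \<in> f ` V" if x: "x \<in> f ` V" for c x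
  proof -
    obtain x' where "x = f x'" "x' \<in> V" using x by blast
    then show ?thesis using assms(1) rat_vec.subspace_scale[OF assms(2)]
      by (intro image_eqI[of _ _ "c *\<^sub>Q x'"]) (auto simp: lin_on_def)
  qed
qed

text \<open>The first isomorphism theorem, for linear maps on subspaces.\<close>

lemma quotient_iso_of_linear:
  assumes V: "rat_vec.subspace V" and K: "rat_vec.subspace K" "K \<subseteq> V"
    and F: "lin_on V F" "F ` V = W" "\<And>x. x \<in> V \<Longrightarrow> F x = 0 \<longleftrightarrow> x \<in> K"
  obtains \<phi> where "quotient_iso V K \<phi> W" "\<And>x. x \<in> V \<Longrightarrow> \<phi> (coset K x) = F x"
proof -
  define \<phi> where "\<phi> C = F (SOME x. x \<in> V \<and> coset K x = C)" for C
  have eq: "F x = F y" if xy: "x \<in> V" "y \<in> V" "coset K x = coset K y" for x y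
  proof -
    have "x \<in> coset K x" using rat_vec.subspace_0[OF K(1)] by (force simp: coset_def)
    then have "x \<in> coset K y" using xy(3) by simp
    then obtain k where "k \<in> K" "x = y + k" by (auto simp: coset_def)
    then show ?thesis using F(1) F(3)[of k] K(2) xy(2) by (auto simp: lin_on_def)
  qed
  have \<phi>: "\<phi> (coset K x) = F x" if "x \<in> V" for x
  proof -
    have "\<exists>y. y \<in> V \<and> coset K y = coset K x" using that by blast
    from someI_ex[OF this] show ?thesis unfolding \<phi>_def using eq that by blast
  qed
  have inj: "coset K x = coset K y" if xy: "x \<in> V" "y \<in> V" "F x = F y" for x y
  proof -
    have "F (x - y) = 0" using lin_on_diff[OF F(1) V xy(1,2)] xy(3) by simp
    then have k: "x - y \<in> K" using F(3) rat_vec.subspace_diff[OF V xy(1,2)] by blast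
    show ?thesis
    proof (intro set_eqI iffI)
      fix z assume "z \<in> coset K x"
      then obtain k' where k': "k' \<in> K" "z = x + k'" by (auto simp: coset_def)
      then have "z = y + ((x - y) + k')" by simp
      then show "z \<in> coset K y"
        using rat_vec.subspace_add[OF K(1) k k'(1)] unfolding coset_def by blast
    next
      fix z assume "z \<in> coset K y"
      then obtain k' where k': "k' \<in> K" "z = y + k'" by (auto simp: coset_def)
      then have "z = x + (k' - (x - y))" by simp
      then show "z \<in> coset K x"
        using rat_vec.subspace_diff[OF K(1) k'(1) k] unfolding coset_def by blast
    qed
  qed
  have "quotient_iso V K \<phi> W"
    unfolding quotient_iso_def
  proof
    show "bij_betw \<phi> (coset K ` V) W"
      unfolding bij_betw_def
    proof
      show "inj_on \<phi> (coset K ` V)"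
      proof (rule inj_onI)
        fix C D assume CD: "C \<in> coset K ` V" "D \<in> coset K ` V" "\<phi> C = \<phi> D"
        then obtain x y where "x \<in> V" "C = coset K x" "y \<in> V" "D = coset K y" by blast
        then show "C = D" using CD(3) \<phi> inj[of x y] by simp
      qed
      show "\<phi> ` coset K ` V = W"
        unfolding F(2)[symmetric] image_image by (rule image_cong[OF refl \<phi>])
    qed
    show "lin_on V (\<lambda>x. \<phi> (coset K x))"
      using F(1) \<phi> rat_vec.subspace_add[OF V] rat_vec.subspace_scale[OF V] by (simp add: lin_on_def)
  qed
  with \<phi> show thesis using that by blast
qed

section \<open>The action of injections\<close>

lemma hact_id: "x \<in> Hcell 1 n \<Longrightarrow> hact id x = x"
  unfolding Hcell_1
  by (auto simp: hact_hclass cycles1_homologous relabel_def lin_ext_basis_elt)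

lemma hact_comp:
  assumes "x \<in> Hcell 1 n" "\<sigma> permutes {1..n}" "\<tau> permutes {1..n}"
  shows "hact (\<sigma> \<circ> \<tau>) x = hact \<sigma> (hact \<tau> x)"
proof -
  have inj: "inj \<sigma>" "inj \<tau>" "inj (\<sigma> \<circ> \<tau>)" using assms permutes_inj inj_compose by blast+
  obtain c where c: "c \<in> cycles1 {1..n}" "x = hclass c" using assms(1) unfolding Hcell_1 by blast
  have "hact \<tau> x = hclass (relabel \<tau> c)"
    using c inj by (simp add: hact_hclass cycles1_homologous)
  moreover have "relabel \<sigma> (relabel \<tau> c) = relabel (\<sigma> \<circ> \<tau>) c"
    by (simp add: relabel_def lin_ext_lin_ext o_def)
  ultimately show ?thesis
    using c inj cycles1_homologous[OF cycles1_relabel[OF c(1) inj(2)]]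
    by (simp add: hact_hclass cycles1_homologous)
qed

lemma trace_hex_relabel:
  assumes T: "T \<subseteq> {1..k}" "a \<in> T" "b \<in> T" "c \<in> T" and f: "inj_on f T" "f ` T \<subseteq> {1..n}"
  shows "trace_class (hex n (f ` T) (f a) (f b) (f c)) = relabel_trace f (trace_class (hex k T a b c))"
proof (cases "distinct [a, b, c]")
  case True
  have d: "distinct [f a, f b, f c]" using True T f(1) by (auto simp: inj_on_def)
  have img: "f ` (T - B) = f ` T - f ` B" if "B \<subseteq> T" for B
    using inj_on_image_set_diff[OF f(1) _ that, of T] by simp
  have i: "f ` (T - {a, b, c}) = f ` T - {f a, f b, f c}" "f ` (T - {b, c}) = f ` T - {f b, f c}"
    "f ` (T - {c, a}) = f ` T - {f c, f a}" "f ` (T - {a, b}) = f ` T - {f a, f b}"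
    using T by (simp_all add: img)
  have "card (f ` (T - {a, b, c})) = card (T - {a, b, c})"
    using f(1) by (intro card_image) (auto intro: inj_on_subset)
  then have card: "card (f ` T - {f a, f b, f c}) = card (T - {a, b, c})" unfolding i(1) .
  show ?thesis
    using T f
    by (subst trace_hex[OF f(2) _ _ _ d]) (simp_all add: trace_hex[OF T True] relabel_trace_linear
        relabel_trace_basis_elt i card)
next
  case False
  then have "\<not> distinct [f a, f b, f c]" by auto
  then show ?thesis using False by (simp add: hex_zero relabel_trace_linear)
qed

lemma trace_eta_relabel:
  assumes T: "T \<subseteq> {1..k}" "a \<in> T" "b \<in> T" and f: "inj_on f T" "f ` T \<subseteq> {1..n}"
  shows "trace_class (eta n (f ` T) (f a) (f b)) = relabel_trace f (trace_class (eta k T a b))"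
proof -
  have "trace_class (eta n (f ` T) (f a) (f b)) = (\<Sum>c\<in>T. trace_class (hex n (f ` T) (f c) (f a) (f b)))"
    by (simp add: eta_def trace_class_sum sum.reindex[OF f(1)])
  also have "\<dots> = (\<Sum>c\<in>T. relabel_trace f (trace_class (hex k T c a b)))"
    by (rule sum.cong[OF refl], rule trace_hex_relabel[OF T(1) _ T(2,3) f])
  finally show ?thesis by (simp add: eta_def trace_class_sum relabel_trace_linear)
qed

lemma eta_span_subset:
  assumes "rat_vec.subspace V"
    "\<And>T a b. T \<subseteq> {1..n} \<Longrightarrow> card T = m + 2 \<Longrightarrow> a \<in> T \<Longrightarrow> b \<in> T \<Longrightarrow> eta n T a b \<in> V"
  shows "eta_span m n \<subseteq> V"
  unfolding eta_span_def by (rule rat_vec.span_minimal[OF _ assms(1)]) (use assms(2) in blast)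

text \<open>On the spans of the classes \<open>eta\<close> the trace is injective, and the traces are permuted by
  injections of labels.  So injections act by transport of structure.\<close>

definition push :: "nat \<Rightarrow> nat \<Rightarrow> (nat \<Rightarrow> nat) \<Rightarrow> homology \<Rightarrow> homology" where
  "push m n f h = (THE h'. h' \<in> eta_span m n \<and> trace_class h' = relabel_trace f (trace_class h))"

lemma push_eqI:
  assumes "h' \<in> eta_span m n" "trace_class h' = relabel_trace f (trace_class h)"
  shows "push m n f h = h'"
  unfolding push_def
proof (rule the_equality)
  show "h' \<in> eta_span m n \<and> trace_class h' = relabel_trace f (trace_class h)" using assms by simp
  fix x assume "x \<in> eta_span m n \<and> trace_class x = relabel_trace f (trace_class h)"
  then show "x = h'"
    using assms subsetD[OF eta_span_crit_span] by (intro trace_class_inj[of x n h']) auto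
qed

lemma push_ex:
  assumes f: "inj_on f {1..k}" "f ` {1..k} \<subseteq> {1..n}" and h: "h \<in> eta_span m k"
  shows "\<exists>h'\<in>eta_span m n. trace_class h' = relabel_trace f (trace_class h)"
proof -
  let ?P = "{h. \<exists>h'\<in>eta_span m n. trace_class h' = relabel_trace f (trace_class h)}"
  have "rat_vec.subspace ?P"
    unfolding rat_vec.subspace_def mem_Collect_eq
  proof (intro conjI ballI allI)
    show "\<exists>h'\<in>eta_span m n. trace_class h' = relabel_trace f (trace_class 0)"
      using rat_vec.subspace_0[OF subspace_eta_span] by (intro bexI[of _ 0]) (simp_all add: relabel_trace_linear)
  next
    fix x y assume "x \<in> ?P" "y \<in> ?P"
    then obtain x' y' where "x' \<in> eta_span m n" "trace_class x' = relabel_trace f (trace_class x)"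
      "y' \<in> eta_span m n" "trace_class y' = relabel_trace f (trace_class y)" by blast
    then show "\<exists>h'\<in>eta_span m n. trace_class h' = relabel_trace f (trace_class (x + y))"
      using rat_vec.subspace_add[OF subspace_eta_span]
      by (intro bexI[of _ "x' + y'"]) (simp_all add: relabel_trace_linear trace_class_add)
  next
    fix c x assume "x \<in> ?P"
    then obtain x' where "x' \<in> eta_span m n" "trace_class x' = relabel_trace f (trace_class x)" by blast
    then show "\<exists>h'\<in>eta_span m n. trace_class h' = relabel_trace f (trace_class (c *\<^sub>Q x))"
      using rat_vec.subspace_scale[OF subspace_eta_span]
      by (intro bexI[of _ "c *\<^sub>Q x'"]) (simp_all add: relabel_trace_linear trace_class_scale)
  qed
  moreover have "eta k T a b \<in> ?P" if T: "T \<subseteq> {1..k}" "card T = m + 2" "a \<in> T" "b \<in> T" for T a b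
  proof -
    have inj: "inj_on f T" and img: "f ` T \<subseteq> {1..n}" using f T(1) by (auto intro: inj_on_subset)
    have "eta n (f ` T) (f a) (f b) \<in> eta_span m n"
      using T img by (intro eta_in_eta_span) (auto simp: card_image[OF inj])
    then show ?thesis using trace_eta_relabel[OF T(1,3,4) inj img] by blast
  qed
  ultimately have "eta_span m k \<subseteq> ?P"
    by (rule eta_span_subset)
  then show ?thesis using h by blast
qed

lemma push_spec:
  assumes "inj_on f {1..k}" "f ` {1..k} \<subseteq> {1..n}" "h \<in> eta_span m k"
  shows "push m n f h \<in> eta_span m n" "trace_class (push m n f h) = relabel_trace f (trace_class h)"
proof -
  obtain h' where h': "h' \<in> eta_span m n" "trace_class h' = relabel_trace f (trace_class h)"
    using push_ex[OF assms] by blast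
  show "push m n f h \<in> eta_span m n" "trace_class (push m n f h) = relabel_trace f (trace_class h)"
    unfolding push_eqI[OF h'] by (rule h')+
qed

lemma push_eta:
  assumes "inj_on f {1..k}" "f ` {1..k} \<subseteq> {1..n}" "T \<subseteq> {1..k}" "card T = m + 2" "a \<in> T" "b \<in> T"
  shows "push m n f (eta k T a b) = eta n (f ` T) (f a) (f b)"
proof (rule push_eqI)
  have inj: "inj_on f T" and img: "f ` T \<subseteq> {1..n}" using assms by (auto intro: inj_on_subset)
  show "eta n (f ` T) (f a) (f b) \<in> eta_span m n"
    using assms img by (intro eta_in_eta_span) (auto simp: card_image[OF inj])
  show "trace_class (eta n (f ` T) (f a) (f b)) = relabel_trace f (trace_class (eta k T a b))"
    by (rule trace_eta_relabel[OF assms(3,5,6) inj img])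
qed

lemma push_linear:
  assumes f: "inj_on f {1..k}" "f ` {1..k} \<subseteq> {1..n}"
  shows "lin_on (eta_span m k) (push m n f)"
  unfolding lin_on_def
proof (intro conjI ballI allI)
  fix x y assume "x \<in> eta_span m k" "y \<in> eta_span m k"
  then show "push m n f (x + y) = push m n f x + push m n f y"
    using push_spec[OF f] rat_vec.subspace_add[OF subspace_eta_span]
    by (intro push_eqI) (simp_all add: trace_class_add relabel_trace_linear)
next
  fix c x assume "x \<in> eta_span m k"
  then show "push m n f (c *\<^sub>Q x) = c *\<^sub>Q push m n f x"
    using push_spec[OF f] rat_vec.subspace_scale[OF subspace_eta_span]
    by (intro push_eqI) (simp_all add: trace_class_scale relabel_trace_linear)
qed

lemma keys_trace_eta_span:
  assumes "h \<in> eta_span m k"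
  shows "Poly_Mapping.keys (trace_class h) \<subseteq> {(S, x, y). S \<union> {x, y} \<subseteq> {1..k}}"
proof -
  let ?K = "{x :: trace. Poly_Mapping.keys x \<subseteq> {(S, x, y). S \<union> {x, y} \<subseteq> {1..k}}}"
  have K: "rat_vec.subspace ?K" by (rule subspace_keys)
  have "rat_vec.subspace {h. trace_class h \<in> ?K}"
    using rat_vec.subspace_0[OF K] rat_vec.subspace_add[OF K] rat_vec.subspace_scale[OF K]
    unfolding rat_vec.subspace_def by (simp add: trace_class_add trace_class_scale)
  moreover have "eta k T a b \<in> {h. trace_class h \<in> ?K}"
    if "T \<subseteq> {1..k}" "card T = m + 2" "a \<in> T" "b \<in> T" for T a b
    using keys_trace_eta[OF that(1,3,4)] that(1) by blast
  ultimately have "eta_span m k \<subseteq> {h. trace_class h \<in> ?K}"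
    by (rule eta_span_subset)
  then show ?thesis using assms by blast
qed

lemma relabel_trace_cong:
  assumes "Poly_Mapping.keys x \<subseteq> {(S, x, y). S \<union> {x, y} \<subseteq> A}" "\<And>a. a \<in> A \<Longrightarrow> f a = g a"
  shows "relabel_trace f x = relabel_trace g x"
  unfolding relabel_trace_def
proof (rule lin_ext_cong)
  fix t assume "t \<in> Poly_Mapping.keys x"
  moreover obtain S a b where t: "t = (S, a, b)" by (cases t)
  ultimately have "S \<subseteq> A" "a \<in> A" "b \<in> A" using assms(1) by auto
  moreover from this have "f ` S = g ` S" using assms(2) by (intro image_cong) auto
  ultimately have "f ` S = g ` S" "f a = g a" "f b = g b" using assms(2) by simp_all
  then show "(case t of (S, a, b) \<Rightarrow> basis_elt (f ` S, f a, f b))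
      = (case t of (S, a, b) \<Rightarrow> basis_elt (g ` S, g a, g b))" by (simp add: t)
qed

lemma relabel_trace_id: "relabel_trace id x = x"
  by (simp add: relabel_trace_def case_prod_unfold lin_ext_basis_elt)

section \<open>The spans of the new classes as a module over injections\<close>

lemma FI_homD:
  assumes "p \<in> FI_hom d k n"
  shows "inj_on (fst p) {1..k}" "fst p ` {1..k} \<subseteq> {1..n}" "fst p \<in> {1..k} \<rightarrow>\<^sub>E {1..n}"
    "snd p \<in> ({1..n} - fst p ` {1..k}) \<rightarrow>\<^sub>E {..<d}"
proof -
  obtain f g where p: "p = (f, g)" by (cases p)
  have h: "f \<in> {1..k} \<rightarrow>\<^sub>E {1..n}" "inj_on f {1..k}"
    "g \<in> ({1..n} - f ` {1..k}) \<rightarrow>\<^sub>E {..<d}"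
    using assms unfolding FI_hom_def p mem_Collect_eq case_prod_conv by blast+
  show "inj_on (fst p) {1..k}" "fst p \<in> {1..k} \<rightarrow>\<^sub>E {1..n}"
    "snd p \<in> ({1..n} - fst p ` {1..k}) \<rightarrow>\<^sub>E {..<d}"
    unfolding p fst_conv snd_conv using h by blast+
  show "fst p ` {1..k} \<subseteq> {1..n}"
    unfolding p fst_conv using PiE_mem[OF h(1)] by (rule image_subsetI)
qed

lemma FI_comp_hom:
  assumes "p \<in> FI_hom d k n" "p' \<in> FI_hom d l k"
  shows "FI_comp l k n p p' \<in> FI_hom d l n"
proof -
  obtain f g where p: "p = (f, g)" by (cases p)
  obtain f' g' where p': "p' = (f', g')" by (cases p')
  note h = FI_homD[OF assms(1), unfolded p fst_conv snd_conv] FI_homD[OF assms(2), unfolded p' fst_conv snd_conv]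
  have img: "compose {1..l} f f' ` {1..l} = (f \<circ> f') ` {1..l}" by (auto simp: compose_def)
  have "inj_on (f \<circ> f') {1..l}" using h(1,5,6) by (meson comp_inj_on inj_on_subset)
  moreover have "inj_on (compose {1..l} f f') {1..l} = inj_on (f \<circ> f') {1..l}"
    by (rule inj_on_cong) (simp add: compose_def)
  ultimately have "inj_on (compose {1..l} f f') {1..l}" by simp
  moreover have "compose {1..l} f f' \<in> {1..l} \<rightarrow>\<^sub>E {1..n}"
    using h(2,6) by (auto simp: compose_def PiE_def extensional_def)
  moreover have "restrict (\<lambda>x. if x \<notin> f ` {1..k} then g x else g' (inv_into {1..k} f x))
        ({1..n} - (f \<circ> f') ` {1..l}) \<in> ({1..n} - (f \<circ> f') ` {1..l}) \<rightarrow>\<^sub>E {..<d}"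
  proof (rule restrict_PiE_iff[THEN iffD2], rule ballI)
    fix x assume x: "x \<in> {1..n} - (f \<circ> f') ` {1..l}"
    show "(if x \<notin> f ` {1..k} then g x else g' (inv_into {1..k} f x)) \<in> {..<d}"
    proof (cases "x \<in> f ` {1..k}")
      case True
      have "inv_into {1..k} f x \<in> {1..k}" "f (inv_into {1..k} f x) = x"
        using inv_into_into[OF True] f_inv_into_f[OF True] by simp_all
      then have "inv_into {1..k} f x \<in> {1..k} - f' ` {1..l}" using x by auto
      then show ?thesis using h(8) True by (auto simp: PiE_def)
    next
      case False
      then show ?thesis using h(4) x by (auto simp: PiE_def)
    qed
  qed
  ultimately show ?thesis unfolding p p' FI_comp_def FI_hom_def
    by (simp only: mem_Collect_eq case_prod_conv img simp_thms)
qed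

lemma FI_perm_hom:
  assumes "\<sigma> permutes {1..n}"
  shows "FI_perm n \<sigma> \<in> FI_hom d n n"
proof -
  have img: "restrict \<sigma> {1..n} ` {1..n} = {1..n}"
    unfolding image_restrict_eq by (rule permutes_image[OF assms])
  have inj: "inj_on (restrict \<sigma> {1..n}) {1..n}"
    unfolding inj_on_restrict_eq by (rule permutes_inj_on[OF assms])
  have fst: "restrict \<sigma> {1..n} \<in> {1..n} \<rightarrow>\<^sub>E {1..n}"
    unfolding restrict_PiE_iff using permutes_in_image[OF assms] by blast
  have "(\<lambda>_. undefined) \<in> ({1..n} - {1..n} :: nat set) \<rightarrow>\<^sub>E {..<d}"
    unfolding Diff_cancel PiE_empty_domain by (rule singletonI)
  then show ?thesis
    unfolding FI_perm_def FI_hom_def mem_Collect_eq case_prod_conv img using inj fst by blast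
qed

definition FI_push :: "nat \<Rightarrow> nat \<Rightarrow> nat \<Rightarrow> fimor \<Rightarrow> homology \<Rightarrow> homology" where
  "FI_push m k n p = push m n (fst p)"

lemma eta_span_Hcell: "eta_span m n \<subseteq> Hcell 1 n"
  using eta_span_crit_span crit_span_Hcell by blast

lemma hact_eta_span:
  assumes "\<sigma> permutes {1..n}" "x \<in> eta_span m n"
  shows "hact \<sigma> x \<in> eta_span m n"
proof -
  have "rat_vec.subspace {x. hact \<sigma> x \<in> eta_span m n}"
    using subspace_eta_span[of m n] by (simp add: rat_vec.subspace_def hact_linear hact_0)
  moreover have "eta n T a b \<in> {x. hact \<sigma> x \<in> eta_span m n}"
    if T: "T \<subseteq> {1..n}" "card T = m + 2" "a \<in> T" "b \<in> T" for T a b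
  proof -
    have "\<sigma> ` T \<subseteq> {1..n}" using T(1) permutes_image[OF assms(1)] by blast
    moreover have "card (\<sigma> ` T) = m + 2" using T(2) card_image[OF permutes_inj_on[OF assms(1)]] by simp
    ultimately show ?thesis
      using T hact_eta[OF T(1,3,4) assms(1)] eta_in_eta_span[of "\<sigma> ` T" n m "\<sigma> a" "\<sigma> b"] by simp
  qed
  ultimately have "eta_span m n \<subseteq> {x. hact \<sigma> x \<in> eta_span m n}"
    by (rule eta_span_subset)
  then show ?thesis using assms(2) by blast
qed

lemma rep_on_hact:
  assumes "rat_vec.subspace V" "V \<subseteq> Hcell 1 n" "\<And>\<sigma> x. \<sigma> permutes {1..n} \<Longrightarrow> x \<in> V \<Longrightarrow> hact \<sigma> x \<in> V"
  shows "rep_on n V hact"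
  unfolding rep_on_def lin_on_def
proof (intro conjI allI impI ballI)
  show "rat_vec.subspace V" by (rule assms(1))
  show "hact \<sigma> ` V \<subseteq> V" if "\<sigma> permutes {1..n}" for \<sigma> using assms(3)[OF that] by blast
  show "hact id x = x" if "x \<in> V" for x using hact_id that assms(2) by blast
  show "hact (\<sigma> \<circ> \<tau>) x = hact \<sigma> (hact \<tau> x)" if "\<sigma> permutes {1..n} \<and> \<tau> permutes {1..n}" "x \<in> V" for \<sigma> \<tau> x
    using hact_comp that assms(2) by blast
qed (rule hact_linear)+

lemma rep_on_eta_span: "rep_on n (eta_span m n) hact"
  by (rule rep_on_hact[OF subspace_eta_span eta_span_Hcell hact_eta_span])

text \<open>The trace of \<open>eta n T a b\<close> does not involve \<open>n\<close>.\<close>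

lemma high_insertion_1_eta:
  assumes "T \<subseteq> {1..n}" "a \<in> T" "b \<in> T"
  shows "high_insertion 1 n 1 (eta n T a b) = eta (Suc n) T a b"
proof (rule trace_class_inj[of _ "Suc n"])
  note e = eta_crit_span[OF assms]
  show "high_insertion 1 n 1 (eta n T a b) \<in> crit_span (Suc n)" by (rule high_insertion_trace(3)[OF e])
  have T: "T \<subseteq> {1..Suc n}" using assms(1) by auto
  then show "eta (Suc n) T a b \<in> crit_span (Suc n)" using assms by (intro eta_crit_span)
  show "trace_class (high_insertion 1 n 1 (eta n T a b)) = trace_class (eta (Suc n) T a b)"
    using trace_eta_relabel[OF assms, of id "Suc n"] T
    unfolding high_insertion_trace(4)[OF e] by (simp add: relabel_trace_id)
qed

lemma high_insertion_1_eta_span: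
  assumes "x \<in> eta_span m n"
  shows "high_insertion 1 n 1 x \<in> eta_span m (Suc n)"
proof -
  note lin = high_insertion_linear[of n 1, THEN conjunct2, THEN conjunct2]
  have "high_insertion 1 n 1 0 = 0" using lin by (metis rat_vec.scale_zero_left)
  then have "rat_vec.subspace {x. high_insertion 1 n 1 x \<in> eta_span m (Suc n)}"
    using lin subspace_eta_span[of m "Suc n"] by (simp add: rat_vec.subspace_def)
  moreover have "eta n T a b \<in> {x. high_insertion 1 n 1 x \<in> eta_span m (Suc n)}"
    if T: "T \<subseteq> {1..n}" "card T = m + 2" "a \<in> T" "b \<in> T" for T a b
  proof -
    have "T \<subseteq> {1..Suc n}" using T(1) by auto
    then show ?thesis
      using high_insertion_1_eta[OF T(1,3,4)] T eta_in_eta_span[of T "Suc n" m a b] by simp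
  qed
  ultimately have "eta_span m n \<subseteq> {x. high_insertion 1 n 1 x \<in> eta_span m (Suc n)}"
    by (rule eta_span_subset)
  then show ?thesis using assms by blast
qed

lemma FI_closed_eta_span: "FI_closed 1 [1] (eta_span m)"
  unfolding FI_closed_def
  using eta_span_Hcell rep_on_eta_span high_insertion_1_eta_span by auto

text \<open>Functoriality is that of relabeling traces, by injectivity of the trace.\<close>

lemma FI_module_eta_span: "FI_module 1 (eta_span m) (FI_push m)"
  unfolding FI_module_def
proof (intro conjI allI ballI)
  show "rat_vec.subspace (eta_span m n)" for n by (rule subspace_eta_span)
  show "FI_push m k n p ` eta_span m k \<subseteq> eta_span m n" if "p \<in> FI_hom 1 k n" for k n p
    using push_spec(1)[OF FI_homD(1,2)[OF that]] by (auto simp: FI_push_def)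
  show "lin_on (eta_span m k) (FI_push m k n p)" if "p \<in> FI_hom 1 k n" for k n p
    using push_linear[OF FI_homD(1,2)[OF that]] by (simp add: FI_push_def)
  show "FI_push m n n (FI_perm n id) x = x" if "x \<in> eta_span m n" for n x
    unfolding FI_push_def FI_perm_def fst_conv
  proof (rule push_eqI[OF that])
    show "trace_class x = relabel_trace (restrict id {1..n}) (trace_class x)"
      using relabel_trace_cong[OF keys_trace_eta_span[OF that], of "restrict id {1..n}" id]
      by (simp add: relabel_trace_id)
  qed
next
  fix l k n p p' x
  assume p: "p \<in> FI_hom 1 k n" and p': "p' \<in> FI_hom 1 l k" and x: "x \<in> eta_span m l"
  note s' = push_spec[OF FI_homD(1,2)[OF p'] x] 
  note s = push_spec[OF FI_homD(1,2)[OF p] s'(1)]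
  show "FI_push m l n (FI_comp l k n p p') x = FI_push m k n p (FI_push m l k p' x)"
    unfolding FI_push_def
  proof (rule push_eqI[OF s(1)])
    have "relabel_trace (fst (FI_comp l k n p p')) (trace_class x) = relabel_trace (fst p \<circ> fst p') (trace_class x)"
      by (rule relabel_trace_cong[OF keys_trace_eta_span[OF x]])
        (simp add: FI_comp_def case_prod_unfold compose_def)
    then show "trace_class (push m n (fst p) (push m k (fst p') x))
        = relabel_trace (fst (FI_comp l k n p p')) (trace_class x)"
      unfolding s(2) s'(2) relabel_trace_comp by simp
  qed
qed

lemma FI_push_perm:
  assumes "\<sigma> permutes {1..n}" "x \<in> eta_span m n"
  shows "FI_push m n n (FI_perm n \<sigma>) x = hact \<sigma> x"
  unfolding FI_push_def FI_perm_def fst_conv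
proof (rule push_eqI[OF hact_eta_span[OF assms]])
  show "trace_class (hact \<sigma> x) = relabel_trace (restrict \<sigma> {1..n}) (trace_class x)"
    using relabel_trace_cong[OF keys_trace_eta_span[OF assms(2)], of "restrict \<sigma> {1..n}" \<sigma>]
    by (simp add: trace_class_hact permutes_inj[OF assms(1)])
qed

lemma FI_action_eta_span: "FI_action 1 [1] (eta_span m) (FI_push m)"
  unfolding FI_action_def
proof (intro conjI allI impI ballI)
  show "FI_module (length [1]) (eta_span m) (FI_push m)" using FI_module_eta_span by simp
  show "FI_push m n n (FI_perm n \<sigma>) x = hact \<sigma> x" if "\<sigma> permutes {1..n}" "x \<in> eta_span m n" for n \<sigma> x
    by (rule FI_push_perm[OF that])
next
  fix n c x assume c: "c < length [1 :: nat]" and x: "x \<in> eta_span m n"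
  have "[1 :: nat] ! c = 1" using c by simp
  have "push m (Suc n) (restrict id {1..n}) x = high_insertion 1 n 1 x"
  proof (rule push_eqI[OF high_insertion_1_eta_span[OF x]])
    show "trace_class (high_insertion 1 n 1 x) = relabel_trace (restrict id {1..n}) (trace_class x)"
      using relabel_trace_cong[OF keys_trace_eta_span[OF x], of "restrict id {1..n}" id]
        high_insertion_trace(4)[of x n] x eta_span_crit_span by (auto simp: relabel_trace_id)
  qed
  then show "FI_push m n (Suc n) (FI_incl n c) x = high_insertion 1 n ([1] ! c) x"
    using \<open>[1 :: nat] ! c = 1\<close> by (simp add: FI_push_def FI_incl_def)
qed

section \<open>Generation\<close>

lemma ex_permutation_extending:
  assumes A: "A \<subseteq> {1..n}" and f: "inj_on f A" "f ` A \<subseteq> {1..n :: nat}"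
  obtains \<sigma> where "\<sigma> permutes {1..n}" "\<And>x. x \<in> A \<Longrightarrow> \<sigma> x = f x"
proof -
  have fin: "finite ({1..n} - A)" "finite ({1..n} - f ` A)" by simp_all
  have "card ({1..n} - A) = card ({1..n} - f ` A)"
    using A f finite_subset[OF A] by (simp add: card_Diff_subset finite_subset[OF f(2)] card_image)
  from finite_same_card_bij[OF fin this] obtain g where
    g: "bij_betw g ({1..n} - A) ({1..n} - f ` A)" by blast
  define \<sigma> where "\<sigma> x = (if x \<in> A then f x else if x \<in> {1..n} then g x else x)" for x
  have "bij_betw \<sigma> (A \<union> ({1..n} - A)) (f ` A \<union> ({1..n} - f ` A))"
  proof (rule bij_betw_combine)
    have "bij_betw \<sigma> A (f ` A) = bij_betw f A (f ` A)"
      by (rule bij_betw_cong) (simp add: \<sigma>_def)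
    then show "bij_betw \<sigma> A (f ` A)" using f(1) by (simp add: bij_betw_def)
    have "bij_betw \<sigma> ({1..n} - A) ({1..n} - f ` A) = bij_betw g ({1..n} - A) ({1..n} - f ` A)"
      by (rule bij_betw_cong) (simp add: \<sigma>_def)
    then show "bij_betw \<sigma> ({1..n} - A) ({1..n} - f ` A)" using g by simp
  qed blast
  moreover have "A \<union> ({1..n} - A) = {1..n}" "f ` A \<union> ({1..n} - f ` A) = {1..n}" using A f(2) by blast+
  ultimately have b: "bij_betw \<sigma> {1..n} {1..n}" by simp
  have perm: "\<sigma> permutes {1..n}"
  proof (rule bij_imp_permutes[OF b])
    fix x assume "x \<notin> {1..n}"
    then show "\<sigma> x = x" using A by (auto simp: \<sigma>_def)
  qed
  show thesis by (rule that[OF perm]) (simp add: \<sigma>_def)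
qed

lemma ex_permutation_image:
  assumes "T \<subseteq> {1..n}" "card T = k" "k \<le> n"
  obtains \<sigma> where "\<sigma> permutes {1..n}" "\<sigma> ` {1..k} = T"
proof -
  have "finite T" using assms(1) finite_subset by auto
  from ex_bij_betw_nat_finite_1[OF this] obtain f where "bij_betw f {1..k} T" using assms(2) by auto
  then have f: "inj_on f {1..k}" "f ` {1..k} = T" by (simp_all add: bij_betw_def)
  have A: "{1..k} \<subseteq> {1..n}" using assms(3) by auto
  have im: "f ` {1..k} \<subseteq> {1..n}" using f(2) assms(1) by blast
  obtain \<sigma> where \<sigma>: "\<sigma> permutes {1..n}" "\<And>x. x \<in> {1..k} \<Longrightarrow> \<sigma> x = f x"
    using ex_permutation_extending[OF A f(1) im] by metis
  have "\<sigma> ` {1..k} = f ` {1..k}" by (rule image_cong[OF refl \<sigma>(2)])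
  then show thesis using that \<sigma>(1) f(2) by blast
qed

lemma FI_closedD:
  assumes "FI_closed 1 js W"
  shows "rat_vec.subspace (W n)" "\<sigma> permutes {1..n} \<Longrightarrow> x \<in> W n \<Longrightarrow> hact \<sigma> x \<in> W n"
    "j \<in> set js \<Longrightarrow> x \<in> W n \<Longrightarrow> high_insertion 1 n j x \<in> W (Suc n)"
  using assms unfolding FI_closed_def rep_on_def by blast+

text \<open>Each \<open>eta n T a b\<close> is obtained from a class on the labels \<open>{1..m + 2}\<close> by raising the
  degree with the insertion map and applying a permutation that takes \<open>{1..m + 2}\<close> to \<open>T\<close>.\<close>

lemma generated_eta_span: "generated 1 [1] (m + 2) (eta_span m (m + 2)) = eta_span m"
proof (rule ext, rule equalityI)
  fix n
  show "generated 1 [1] (m + 2) (eta_span m (m + 2)) n \<subseteq> eta_span m n"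
    unfolding generated_def using FI_closed_eta_span by blast
  show "eta_span m n \<subseteq> generated 1 [1] (m + 2) (eta_span m (m + 2)) n"
    unfolding generated_def
  proof (rule Inter_greatest)
    fix X assume "X \<in> {W n |W. FI_closed 1 [1] W \<and> eta_span m (m + 2) \<subseteq> W (m + 2)}"
    then obtain W where W: "X = W n" "FI_closed 1 [1] W" "eta_span m (m + 2) \<subseteq> W (m + 2)" by blast
    note c = FI_closedD[OF W(2)]
    let ?K = "{1..m + 2}"
    have K: "eta (m + 2 + j) ?K a b \<in> W (m + 2 + j)" if "a \<in> ?K" "b \<in> ?K" for j a b
    proof (induction j)
      case 0
      have "eta (m + 2) ?K a b \<in> eta_span m (m + 2)" using that by (intro eta_in_eta_span) auto
      then show ?case using W(3) by auto
    next
      case (Suc j)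
      have "?K \<subseteq> {1..m + 2 + j}" by auto
      from high_insertion_1_eta[OF this that] c(3)[OF _ Suc, of 1] show ?case by simp
    qed
    show "eta_span m n \<subseteq> X"
      unfolding W(1)
    proof (rule eta_span_subset[OF c(1)])
      fix T a b assume T: "T \<subseteq> {1..n}" "card T = m + 2" "a \<in> T" "b \<in> T"
      have n: "m + 2 \<le> n" using card_mono[OF _ T(1)] T(2) by simp
      obtain \<sigma> where \<sigma>: "\<sigma> permutes {1..n}" "\<sigma> ` ?K = T"
        using ex_permutation_image[OF T(1,2) n] by metis
      obtain a' b' where ab: "a' \<in> ?K" "a = \<sigma> a'" "b' \<in> ?K" "b = \<sigma> b'"
        using T(3,4) unfolding \<sigma>(2)[symmetric] by blast
      have "?K \<subseteq> {1..n}" using n by auto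
      then have "hact \<sigma> (eta n ?K a' b') = eta n T a b"
        using hact_eta[OF _ ab(1,3) \<sigma>(1)] \<sigma>(2) ab(2,4) by simp
      moreover have "eta n ?K a' b' \<in> W n" using K[OF ab(1,3), of "n - (m + 2)"] unfolding le_add_diff_inverse[OF n] .
      ultimately show "eta n T a b \<in> W n" using c(2)[OF \<sigma>(1)] by metis
    qed
  qed
qed

text \<open>The new largest label is added to the left of the hexagon, so it belongs to the new set
  \<open>T\<close>.\<close>

lemma high_insertion_0_hex:
  assumes "T \<subseteq> {1..n}" "a \<in> T" "b \<in> T" "c \<in> T" "distinct [a, b, c]"
  shows "high_insertion 1 n 0 (hex n T a b c) = hex (Suc n) (insert (Suc n) T) a b c"
proof (rule trace_class_inj[of _ "Suc n"])
  note e = hex_crit_span[OF assms(1-4)]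
  show "high_insertion 1 n 0 (hex n T a b c) \<in> crit_span (Suc n)" by (rule high_insertion_trace(1)[OF e])
  have T: "insert (Suc n) T \<subseteq> {1..Suc n}" using assms(1) by auto
  then show "hex (Suc n) (insert (Suc n) T) a b c \<in> crit_span (Suc n)"
    using assms by (intro hex_crit_span) auto
  have n: "Suc n \<notin> T" using assms(1) by auto
  have fin: "finite (T - {a, b, c})" using assms(1) finite_subset by auto
  have i: "insert (Suc n) T - {x, y} = insert (Suc n) (T - {x, y})" if "x \<in> T" "y \<in> T" for x y
    using that n by auto
  have i3: "insert (Suc n) T - {a, b, c} = insert (Suc n) (T - {a, b, c})" using n assms by auto
  have "card (insert (Suc n) T - {a, b, c}) = Suc (card (T - {a, b, c}))"
    unfolding i3 using fin n by simp
  then show "trace_class (high_insertion 1 n 0 (hex n T a b c))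
      = trace_class (hex (Suc n) (insert (Suc n) T) a b c)"
    unfolding high_insertion_trace(2)[OF e] trace_hex[OF assms]
    using assms T
    by (subst trace_hex[OF T]) (simp_all add: i i3 add_left_linear add_left_basis_elt)
qed

text \<open>In degree 3 the classes \<open>hex\<close> and \<open>eta\<close> agree, because only one of the three labels is
  left for the sum. Every hexagon with all labels in \<open>T\<close> is a permutation of the one on \<open>1, 2,
  3\<close>, which is inserted from the previous degree.\<close>

lemma eta_span_sub_generated_0:
  assumes "1 \<le> m"
  shows "eta_span m (m + 2) \<subseteq> generated 1 [0] 3 (eta_span 1 3) (m + 2)"
  unfolding generated_def
proof (rule Inter_greatest)
  fix X assume "X \<in> {W (m + 2) |W. FI_closed 1 [0] W \<and> eta_span 1 3 \<subseteq> W 3}"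
  then obtain W where W: "X = W (m + 2)" "FI_closed 1 [0] W" "eta_span 1 3 \<subseteq> W 3" by blast
  note c = FI_closedD[OF W(2)]
  have hex: "hex (3 + j) {1..3 + j} a b c \<in> W (3 + j)"
    if "a \<in> {1..3 + j}" "b \<in> {1..3 + j}" "c \<in> {1..3 + j}" "distinct [a, b, c]" for j a b c
    using that
  proof (induction j arbitrary: a b c)
    case 0
    let ?T = "{1..3 :: nat}"
    have abc: "{a, b, c} = ?T"
      by (rule card_subset_eq) (use 0 in auto)
    have "eta 3 ?T b c = (\<Sum>x\<in>{a, b, c}. hex 3 ?T x b c)" by (simp only: eta_def abc)
    also have "\<dots> = hex 3 ?T a b c" using 0(4) by (simp add: hex_zero)
    finally have "hex 3 ?T a b c = eta 3 ?T b c" by simp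
    moreover have "eta 3 ?T b c \<in> eta_span 1 3" using 0 by (intro eta_in_eta_span) auto
    ultimately show ?case using W(3) by auto
  next
    case (Suc j)
    let ?T = "{1..3 + j}"
    have "hex (3 + j) ?T 1 2 3 \<in> W (3 + j)" by (rule Suc.IH) auto
    then have "high_insertion 1 (3 + j) 0 (hex (3 + j) ?T 1 2 3) \<in> W (Suc (3 + j))" by (intro c(3)) simp
    moreover have "insert (Suc (3 + j)) ?T = {1..3 + Suc j}" by auto
    ultimately have base: "hex (3 + Suc j) {1..3 + Suc j} 1 2 3 \<in> W (3 + Suc j)"
      using high_insertion_0_hex[of ?T "3 + j" 1 2 3] by simp
    define f where "f x = (if x = 1 then a else if x = 2 then b else c)" for x :: nat
    have "{1, 2, 3} \<subseteq> {1..3 + Suc j}" "inj_on f {1, 2, 3}" "f ` {1, 2, 3} \<subseteq> {1..3 + Suc j}"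
      using Suc.prems by (auto simp: f_def inj_on_def)
    from ex_permutation_extending[OF this] obtain \<sigma> where
      \<sigma>: "\<sigma> permutes {1..3 + Suc j}" "\<And>x. x \<in> {1, 2, 3} \<Longrightarrow> \<sigma> x = f x" by metis
    have "\<sigma> 1 = a" "\<sigma> 2 = b" "\<sigma> 3 = c" using \<sigma>(2) by (auto simp: f_def)
    moreover have "hact \<sigma> (hex (3 + Suc j) {1..3 + Suc j} 1 2 3)
        = hex (3 + Suc j) (\<sigma> ` {1..3 + Suc j}) (\<sigma> 1) (\<sigma> 2) (\<sigma> 3)"
      by (rule hact_hex[OF _ _ _ _ \<sigma>(1)]) auto
    ultimately show ?case using c(2)[OF \<sigma>(1) base] permutes_image[OF \<sigma>(1)] by simp
  qed
  show "eta_span m (m + 2) \<subseteq> X"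
    unfolding W(1)
  proof (rule eta_span_subset[OF c(1)])
    fix T a b assume T: "T \<subseteq> {1..m + 2}" "card T = m + 2" "a \<in> T" "b \<in> T"
    have TK: "T = {1..m + 2}" by (rule card_subset_eq) (use T in auto)
    have m: "m + 2 = 3 + (m - 1)" using assms by simp
    have "hex (m + 2) T x a b \<in> W (m + 2)" if "x \<in> T" for x
    proof (cases "distinct [x, a, b]")
      case True
      show ?thesis
        using hex[of x "m - 1" a b, folded m] that T(3,4) True unfolding TK by blast
    next
      case False
      then show ?thesis using rat_vec.subspace_0[OF c(1)] by (simp add: hex_zero)
    qed
    then show "eta (m + 2) T a b \<in> W (m + 2)"
      unfolding eta_def by (intro rat_vec.subspace_sum[OF c(1)])
  qed
qed

section \<open>Freeness\<close>

lemma eta_span_zero_by_theta: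
  assumes u: "u \<in> eta_span m (m + 2)"
    and zero: "\<And>p q r. distinct [p, q, r] \<Longrightarrow> {p, q, r} \<subseteq> {1..m + 2} \<Longrightarrow> theta {1..m + 2} p q r u = 0"
  shows "u = 0"
proof -
  let ?e = "\<lambda>(T, a, b). eta (m + 2) T a b"
  let ?I = "new_index (m + 2) m"
  have inj: "inj_on ?e ?I"
    by (rule family_independent(1)[OF finite_new_index]) (rule new_independent_family)
  have "u \<in> rat_vec.span (?e ` ?I)"
    using u unfolding span_new_basis[symmetric] new_basis_def .
  then obtain c where "u = (\<Sum>x\<in>?e ` ?I. c x *\<^sub>Q x)"
    using finite_new_index by (auto simp: rat_vec.span_finite)
  also have "(\<Sum>x\<in>?e ` ?I. c x *\<^sub>Q x) = (\<Sum>t\<in>?I. (c \<circ> ?e) t *\<^sub>Q ?e t)"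
    by (subst sum.reindex[OF inj]) (simp only: o_def)
  finally have us: "u = (\<Sum>t\<in>?I. (c \<circ> ?e) t *\<^sub>Q ?e t)" .
  have "(c \<circ> ?e) t = 0" if "t \<in> ?I" for t
  proof -
    obtain T p q where t: "t = (T, p, q)" by (cases t)
    have T: "T \<subseteq> {1..m + 2}" "card T = m + 2" "p \<in> T" "q \<in> T" "p \<noteq> Min T" "q \<noteq> Min T" "p < q"
      using that by (auto simp: new_index_def t)
    have TK: "T = {1..m + 2}" by (rule card_subset_eq) (use T in auto)
    have "Min T \<in> T" by (rule Min_in) (use TK in auto)
    then have "theta T p q (Min T) u = 0" unfolding TK using T TK by (intro zero) auto
    then have "(c \<circ> ?e) t * (- ((- 1) ^ card T) * of_nat (card T)) = 0"
      using theta_dual_sum[OF that[unfolded t], of "c \<circ> ?e"] unfolding us t by metis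
    then show ?thesis using T(2) by simp
  qed
  then show ?thesis unfolding us by (intro sum.neutral) auto
qed

text \<open>Injections with different images have outputs that are seen by the functionals of
  different sets.\<close>

lemma theta_push:
  assumes f: "inj_on f {1..m + 2}" "f ` {1..m + 2} \<subseteq> {1..n}" and u: "u \<in> eta_span m (m + 2)"
  shows "distinct [p, q, r] \<Longrightarrow> {p, q, r} \<subseteq> {1..m + 2} \<Longrightarrow>
      theta (f ` {1..m + 2}) (f p) (f q) (f r) (push m n f u) = theta {1..m + 2} p q r u"
    "T \<subseteq> {1..n} \<Longrightarrow> card T = m + 2 \<Longrightarrow> T \<noteq> f ` {1..m + 2} \<Longrightarrow> {p, q, r} \<subseteq> T \<Longrightarrow>
      theta T p q r (push m n f u) = 0"
proof -
  let ?K = "{1..m + 2}"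
  note lin = push_linear[OF f, of m]
  have sub: "rat_vec.subspace {u \<in> eta_span m (m + 2). theta A x y z (push m n f u) = s * theta B x' y' z' u}"
    for A x y z B x' y' z' s
    using lin subspace_eta_span[of m "m + 2"] lin_on_zero[OF lin]
    unfolding rat_vec.subspace_def lin_on_def
    by (simp add: theta_linear algebra_simps)
  have TK: "T = ?K" if "T \<subseteq> ?K" "card T = m + 2" for T
    by (rule card_subset_eq) (use that in auto)
  have cK: "card (f ` ?K) = m + 2" using card_image[OF f(1)] by simp
  show "theta (f ` ?K) (f p) (f q) (f r) (push m n f u) = theta ?K p q r u"
    if pqr: "distinct [p, q, r]" "{p, q, r} \<subseteq> ?K"
  proof -
    have "eta_span m (m + 2)
        \<subseteq> {u \<in> eta_span m (m + 2). theta (f ` ?K) (f p) (f q) (f r) (push m n f u) = 1 * theta ?K p q r u}"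
    proof (rule eta_span_subset[OF sub])
      fix T a b assume T: "T \<subseteq> ?K" "card T = m + 2" "a \<in> T" "b \<in> T"
      note TK = TK[OF T(1,2)]
      have eq: "f x = f y \<longleftrightarrow> x = y" if "x \<in> ?K" "y \<in> ?K" for x y
        using inj_on_eq_iff[OF f(1) that] .
      have "push m n f (eta (m + 2) T a b) = eta n (f ` ?K) (f a) (f b)"
        using push_eta[OF f T] TK by simp
      moreover have "theta (f ` ?K) (f p) (f q) (f r) (eta n (f ` ?K) (f a) (f b))
        = - ((- 1) ^ card (f ` ?K)) * of_nat (card (f ` ?K))
          * (alt2 (f a) (f b) (f p) (f q) + alt2 (f a) (f b) (f q) (f r) + alt2 (f a) (f b) (f r) (f p))"
        using f(2) T(3,4) pqr unfolding TK by (intro theta_eta) (auto simp: eq)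
      moreover have "theta ?K p q r (eta (m + 2) ?K a b)
        = - ((- 1) ^ card ?K) * of_nat (card ?K) * (alt2 a b p q + alt2 a b q r + alt2 a b r p)"
        using T(3,4) pqr unfolding TK by (intro theta_eta) auto
      moreover have "alt2 (f a) (f b) (f x) (f y) = alt2 a b x y" if "x \<in> ?K" "y \<in> ?K" for x y
        using T(3,4) that unfolding TK alt2_def by (simp add: eq)
      ultimately show "eta (m + 2) T a b \<in> {u \<in> eta_span m (m + 2).
          theta (f ` ?K) (f p) (f q) (f r) (push m n f u) = 1 * theta ?K p q r u}"
        using eta_in_eta_span[OF T] cK pqr(2) TK by simp
    qed
    then show ?thesis using u by auto
  qed
  show "theta T p q r (push m n f u) = 0"
    if T: "T \<subseteq> {1..n}" "card T = m + 2" "T \<noteq> f ` ?K" "{p, q, r} \<subseteq> T" for T p q r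
  proof -
    have "eta_span m (m + 2)
        \<subseteq> {u \<in> eta_span m (m + 2). theta T p q r (push m n f u) = 0 * theta T p q r u}"
    proof (rule eta_span_subset[OF sub])
      fix T' a b assume T': "T' \<subseteq> ?K" "card T' = m + 2" "a \<in> T'" "b \<in> T'"
      note TK = TK[OF T'(1,2)]
      have "theta T p q r (eta n (f ` ?K) (f a) (f b)) = 0"
        using f(2) T T' TK cK by (intro theta_eta_other) auto
      then show "eta (m + 2) T' a b
          \<in> {u \<in> eta_span m (m + 2). theta T p q r (push m n f u) = 0 * theta T p q r u}"
        using eta_in_eta_span[OF T'] push_eta[OF f T'] TK by simp
    qed
    then show ?thesis using u by auto
  qed
qed

text \<open>With a single color the coloring carries no information, so a morphism is determined by
  its injection, and injections with the same image differ by a permutation of the source.\<close>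

lemma FI_hom_same_image:
  assumes p: "p \<in> FI_hom 1 k n" and e: "e \<in> FI_hom 1 k n" and im: "fst p ` {1..k} = fst e ` {1..k}"
  obtains \<sigma> where "\<sigma> permutes {1..k}" "p = FI_comp k k n e (FI_perm k \<sigma>)"
proof -
  obtain f g where p': "p = (f, g)" by (cases p)
  obtain h g' where e': "e = (h, g')" by (cases e)
  note P = FI_homD[OF p, unfolded p' fst_conv snd_conv] and E = FI_homD[OF e, unfolded e' fst_conv snd_conv]
  let ?K = "{1..k}"
  let ?i = "inv_into ?K h"
  have im': "f ` ?K = h ` ?K" using im p' e' by simp
  define \<sigma> where "\<sigma> x = (if x \<in> ?K then ?i (f x) else x)" for x
  have "bij_betw f ?K (h ` ?K)" using P(1) im' by (simp add: bij_betw_def)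
  moreover have "bij_betw ?i (h ` ?K) ?K" using E(1) by (intro bij_betw_inv_into) (simp add: bij_betw_def)
  ultimately have "bij_betw (?i \<circ> f) ?K ?K" by (rule bij_betw_trans)
  moreover have "bij_betw \<sigma> ?K ?K = bij_betw (?i \<circ> f) ?K ?K" by (rule bij_betw_cong) (simp add: \<sigma>_def)
  ultimately have b: "bij_betw \<sigma> ?K ?K" by simp
  have perm: "\<sigma> permutes ?K"
    by (rule bij_imp_permutes[OF b]) (simp only: \<sigma>_def if_False)
  have h\<sigma>: "h (\<sigma> x) = f x" if "x \<in> ?K" for x
  proof -
    have "f x \<in> h ` ?K" using that im' by blast
    then show ?thesis using that f_inv_into_f[of "f x" h ?K] unfolding \<sigma>_def by simp
  qed
  have c: "compose ?K h (restrict \<sigma> ?K) = f"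
  proof
    fix x
    show "compose ?K h (restrict \<sigma> ?K) x = f x"
    proof (cases "x \<in> ?K")
      case True
      then show ?thesis using h\<sigma> by (simp add: compose_def)
    next
      case False
      then show ?thesis
        using PiE_arb[OF P(3) False] unfolding compose_def restrict_def by (simp only: if_False)
    qed
  qed
  have img: "(h \<circ> restrict \<sigma> ?K) ` ?K = f ` ?K" by (rule image_cong[OF refl]) (simp add: h\<sigma>)
  have r: "restrict (\<lambda>x. if x \<notin> h ` ?K then g' x else undefined) ({1..n} - f ` ?K) = g"
  proof
    fix x
    show "restrict (\<lambda>x. if x \<notin> h ` ?K then g' x else undefined) ({1..n} - f ` ?K) x = g x"
    proof (cases "x \<in> {1..n} - f ` ?K")
      case True
      then have "g x = 0" "g' x = 0" using PiE_mem[OF P(4) True] PiE_mem[OF E(4), of x] im' by auto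
      then show ?thesis using True im' by simp
    next
      case False
      then show ?thesis using PiE_arb[OF P(4) False] unfolding restrict_def by (simp only: if_False)
    qed
  qed
  have "p = FI_comp k k n e (FI_perm k \<sigma>)"
    unfolding p' e' FI_comp_def FI_perm_def case_prod_conv c img r ..
  then show thesis using that perm by blast
qed

lemma poly_mapping_sum_single:
  fixes x :: "'a \<Rightarrow>\<^sub>0 'v::rat_vector"
  shows "x = (\<Sum>t\<in>Poly_Mapping.keys x. Poly_Mapping.single t (Poly_Mapping.lookup x t))"
proof (rule poly_mapping_eqI)
  fix s
  have "Poly_Mapping.lookup (\<Sum>t\<in>Poly_Mapping.keys x. Poly_Mapping.single t (Poly_Mapping.lookup x t)) s
      = (\<Sum>t\<in>Poly_Mapping.keys x. if t = s then Poly_Mapping.lookup x t else 0)"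
    by (simp add: lookup_sum lookup_single when_def)
  also have "\<dots> = Poly_Mapping.lookup x s" by (simp add: in_keys_iff)
  finally show "Poly_Mapping.lookup x s
      = Poly_Mapping.lookup (\<Sum>t\<in>Poly_Mapping.keys x. Poly_Mapping.single t (Poly_Mapping.lookup x t)) s" by simp
qed

text \<open>The free module is generated in degree \<open>m + 2\<close> alone.\<close>

definition gen_at :: "nat \<Rightarrow> nat \<Rightarrow> homology set" where
  "gen_at m k = (if k = m + 2 then eta_span m (m + 2) else {0})"

text \<open>The canonical map from the free module, which takes \<open>p \<otimes> u\<close> to \<open>p\<close> applied to \<open>u\<close>.\<close>

definition FI_eval :: "nat \<Rightarrow> nat \<Rightarrow> (nat \<times> fimor \<Rightarrow>\<^sub>0 homology) \<Rightarrow> homology" where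
  "FI_eval m n x = (\<Sum>(k, p)\<in>Poly_Mapping.keys x. FI_push m k n p (Poly_Mapping.lookup x (k, p)))"

abbreviation gens :: "nat \<Rightarrow> nat \<Rightarrow> (nat \<times> fimor \<Rightarrow>\<^sub>0 homology) set" where
  "gens m n \<equiv> free_FI_gens 1 (gen_at m) n"

abbreviation rels :: "nat \<Rightarrow> nat \<Rightarrow> (nat \<times> fimor \<Rightarrow>\<^sub>0 homology) set" where
  "rels m n \<equiv> free_FI_rels 1 (gen_at m) (\<lambda>_. hact) n"

lemma subspace_gen_at: "rat_vec.subspace (gen_at m k)"
  by (simp add: gen_at_def subspace_eta_span rat_vec.subspace_single_0)

lemma gen_at_eta_span: "gen_at m k \<subseteq> eta_span m k"
  using rat_vec.subspace_0[OF subspace_eta_span] by (simp add: gen_at_def)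

lemma FI_push_simps:
  assumes "p \<in> FI_hom 1 k n"
  shows "x \<in> eta_span m k \<Longrightarrow> FI_push m k n p x \<in> eta_span m n"
    "lin_on (eta_span m k) (FI_push m k n p)" "FI_push m k n p 0 = 0"
proof -
  show "x \<in> eta_span m k \<Longrightarrow> FI_push m k n p x \<in> eta_span m n"
    and l: "lin_on (eta_span m k) (FI_push m k n p)"
    using FI_module_eta_span[of m] assms unfolding FI_module_def by blast+
  show "FI_push m k n p 0 = 0"
    by (rule lin_on_zero[OF l rat_vec.subspace_0[OF subspace_eta_span]])
qed

lemma FI_push_comp:
  "p \<in> FI_hom 1 k n \<Longrightarrow> p' \<in> FI_hom 1 l k \<Longrightarrow> x \<in> eta_span m l \<Longrightarrow>
    FI_push m l n (FI_comp l k n p p') x = FI_push m k n p (FI_push m l k p' x)"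
  using FI_module_eta_span[of m] unfolding FI_module_def by blast

lemma gensD:
  assumes "x \<in> gens m n" "(k, p) \<in> Poly_Mapping.keys x"
  shows "p \<in> FI_hom 1 k n" "Poly_Mapping.lookup x (k, p) \<in> gen_at m k" "k = m + 2"
    "Poly_Mapping.lookup x (k, p) \<in> eta_span m k"
proof -
  show p: "p \<in> FI_hom 1 k n" and u: "Poly_Mapping.lookup x (k, p) \<in> gen_at m k"
    using assms unfolding free_FI_gens_def by blast+
  show "k = m + 2"
    using u assms(2) by (auto simp: gen_at_def in_keys_iff split: if_splits)
  show "Poly_Mapping.lookup x (k, p) \<in> eta_span m k" using u gen_at_eta_span by blast
qed

lemma gens_lookup: "x \<in> gens m n \<Longrightarrow> Poly_Mapping.lookup x (k, p) \<in> gen_at m k"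
  using gensD(2)[of x m n k p] rat_vec.subspace_0[OF subspace_gen_at]
  by (cases "(k, p) \<in> Poly_Mapping.keys x") (auto simp: in_keys_iff)

lemma subspace_gens: "rat_vec.subspace (gens m n)"
  unfolding rat_vec.subspace_def
proof (intro conjI ballI allI)
  show "0 \<in> gens m n" by (simp add: free_FI_gens_def)
  show "x + y \<in> gens m n" if xy: "x \<in> gens m n" "y \<in> gens m n" for x y
    unfolding free_FI_gens_def
  proof (rule CollectI, safe)
    fix k p assume "(k, p) \<in> Poly_Mapping.keys (x + y)"
    then have "(k, p) \<in> Poly_Mapping.keys x \<or> (k, p) \<in> Poly_Mapping.keys y"
      using Poly_Mapping.keys_add[of x y] by blast
    then show "p \<in> FI_hom 1 k n" using gensD(1) xy by blast
    show "Poly_Mapping.lookup (x + y) (k, p) \<in> gen_at m k"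
      using gens_lookup[OF xy(1)] gens_lookup[OF xy(2)] rat_vec.subspace_add[OF subspace_gen_at]
      by (simp add: lookup_add)
  qed
  show "c *\<^sub>Q x \<in> gens m n" if x: "x \<in> gens m n" for c x
    unfolding free_FI_gens_def
  proof (rule CollectI, safe)
    fix k p assume "(k, p) \<in> Poly_Mapping.keys (c *\<^sub>Q x)"
    then have "(k, p) \<in> Poly_Mapping.keys x" by (auto simp: in_keys_iff lookup_scaleQ)
    then show "p \<in> FI_hom 1 k n" using gensD(1) x by blast
    show "Poly_Mapping.lookup (c *\<^sub>Q x) (k, p) \<in> gen_at m k"
      using gens_lookup[OF x] rat_vec.subspace_scale[OF subspace_gen_at] by (simp add: lookup_scaleQ)
  qed
qed

lemma single_gens:
  assumes "p \<in> FI_hom 1 k n" "u \<in> gen_at m k"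
  shows "Poly_Mapping.single (k, p) u \<in> gens m n"
  using assms by (simp add: free_FI_gens_def)

lemma FI_eval_superset:
  assumes "finite A" "Poly_Mapping.keys x \<subseteq> A" "\<And>k p. (k, p) \<in> A \<Longrightarrow> p \<in> FI_hom 1 k n"
  shows "FI_eval m n x = (\<Sum>(k, p)\<in>A. FI_push m k n p (Poly_Mapping.lookup x (k, p)))"
  unfolding FI_eval_def
proof (rule sum.mono_neutral_left[OF assms(1,2)], safe)
  fix k p assume "(k, p) \<in> A" "(k, p) \<notin> Poly_Mapping.keys x"
  then show "FI_push m k n p (Poly_Mapping.lookup x (k, p)) = 0"
    using FI_push_simps(3)[OF assms(3)] by (simp add: in_keys_iff)
qed

lemma lin_on_FI_eval: "lin_on (gens m n) (FI_eval m n)"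
  unfolding lin_on_def
proof (intro conjI ballI allI)
  fix x y assume xy: "x \<in> gens m n" "y \<in> gens m n"
  let ?A = "Poly_Mapping.keys x \<union> Poly_Mapping.keys y"
  have A: "finite ?A" "Poly_Mapping.keys x \<subseteq> ?A" "Poly_Mapping.keys y \<subseteq> ?A"
    "Poly_Mapping.keys (x + y) \<subseteq> ?A"
    using Poly_Mapping.keys_add[of x y] by auto
  have hom: "p \<in> FI_hom 1 k n" if "(k, p) \<in> ?A" for k p using that gensD(1) xy by blast
  have "FI_push m k n p (Poly_Mapping.lookup (x + y) (k, p))
      = FI_push m k n p (Poly_Mapping.lookup x (k, p)) + FI_push m k n p (Poly_Mapping.lookup y (k, p))"
    if "(k, p) \<in> ?A" for k p
    using FI_push_simps(2)[OF hom[OF that], of m] gens_lookup[OF xy(1)] gens_lookup[OF xy(2)]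
      gen_at_eta_span unfolding lin_on_def lookup_add by blast
  then have add: "(\<Sum>(k, p)\<in>?A. FI_push m k n p (Poly_Mapping.lookup (x + y) (k, p)))
      = (\<Sum>t\<in>?A. (case t of (k, p) \<Rightarrow> FI_push m k n p (Poly_Mapping.lookup x (k, p)))
          + (case t of (k, p) \<Rightarrow> FI_push m k n p (Poly_Mapping.lookup y (k, p))))"
    by (intro sum.cong[OF refl]) (simp only: split_paired_all case_prod_conv)
  have ev: "FI_eval m n z = (\<Sum>(k, p)\<in>?A. FI_push m k n p (Poly_Mapping.lookup z (k, p)))"
    if "Poly_Mapping.keys z \<subseteq> ?A" for z
    by (rule FI_eval_superset[OF A(1) that]) (rule hom)
  show "FI_eval m n (x + y) = FI_eval m n x + FI_eval m n y"
    unfolding ev[OF A(4)] ev[OF A(2)] ev[OF A(3)] add sum.distrib ..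
next
  fix c x assume x: "x \<in> gens m n"
  have sub: "Poly_Mapping.keys (c *\<^sub>Q x) \<subseteq> Poly_Mapping.keys x" by (auto simp: in_keys_iff lookup_scaleQ)
  have "FI_push m k n p (Poly_Mapping.lookup (c *\<^sub>Q x) (k, p))
      = c *\<^sub>Q FI_push m k n p (Poly_Mapping.lookup x (k, p))" if "(k, p) \<in> Poly_Mapping.keys x" for k p
    using FI_push_simps(2)[OF gensD(1)[OF x that], of m] gensD(4)[OF x that]
    unfolding lin_on_def lookup_scaleQ by blast
  then have scale: "(\<Sum>(k, p)\<in>Poly_Mapping.keys x. FI_push m k n p (Poly_Mapping.lookup (c *\<^sub>Q x) (k, p)))
      = (\<Sum>t\<in>Poly_Mapping.keys x. c *\<^sub>Q (case t of (k, p) \<Rightarrow> FI_push m k n p (Poly_Mapping.lookup x (k, p))))"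
    by (intro sum.cong[OF refl]) (simp only: split_paired_all case_prod_conv)
  have ev: "FI_eval m n (c *\<^sub>Q x)
      = (\<Sum>(k, p)\<in>Poly_Mapping.keys x. FI_push m k n p (Poly_Mapping.lookup (c *\<^sub>Q x) (k, p)))"
    by (rule FI_eval_superset[OF finite_keys sub]) (rule gensD(1)[OF x])
  show "FI_eval m n (c *\<^sub>Q x) = c *\<^sub>Q FI_eval m n x"
    unfolding ev scale FI_eval_def[of m n x] rat_vec.scale_sum_right ..
qed

lemma FI_eval_single:
  assumes "p \<in> FI_hom 1 k n"
  shows "FI_eval m n (Poly_Mapping.single (k, p) u) = FI_push m k n p u"
proof -
  have "FI_eval m n (Poly_Mapping.single (k, p) u)
      = (\<Sum>(k', p')\<in>{(k, p)}. FI_push m k' n p' (Poly_Mapping.lookup (Poly_Mapping.single (k, p) u) (k', p')))"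
    by (rule FI_eval_superset) (use assms in auto)
  then show ?thesis by simp
qed

lemma hact_gen_at: "\<sigma> permutes {1..k} \<Longrightarrow> u \<in> gen_at m k \<Longrightarrow> hact \<sigma> u \<in> gen_at m k"
  by (auto simp: gen_at_def hact_0 hact_eta_span split: if_splits)

lemma rel_in_kernel:
  assumes "p \<in> FI_hom 1 k n" "\<sigma> permutes {1..k}" "u \<in> gen_at m k"
  defines "r \<equiv> Poly_Mapping.single (k, FI_comp k k n p (FI_perm k \<sigma>)) u - Poly_Mapping.single (k, p) (hact \<sigma> u)"
  shows "r \<in> gens m n" "FI_eval m n r = 0" "r \<in> rels m n"
proof -
  have c: "FI_comp k k n p (FI_perm k \<sigma>) \<in> FI_hom 1 k n"
    by (rule FI_comp_hom[OF assms(1) FI_perm_hom[OF assms(2)]])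
  note s = single_gens[OF c assms(3)] single_gens[OF assms(1) hact_gen_at[OF assms(2,3)]]
  show "r \<in> gens m n" unfolding r_def by (rule rat_vec.subspace_diff[OF subspace_gens s])
  have u: "u \<in> eta_span m k" using assms(3) gen_at_eta_span by blast
  show "FI_eval m n r = 0"
    unfolding r_def lin_on_diff[OF lin_on_FI_eval subspace_gens s] FI_eval_single[OF c]
      FI_eval_single[OF assms(1)] FI_push_comp[OF assms(1) FI_perm_hom[OF assms(2)] u]
      FI_push_perm[OF assms(2) u] by simp
  show "r \<in> rels m n"
    unfolding free_FI_rels_def r_def using assms(1-3) by (intro rat_vec.span_base CollectI) blast
qed

lemma subspace_rels: "rat_vec.subspace (rels m n)"
  unfolding free_FI_rels_def by (rule rat_vec.subspace_span)

lemma rels_kernel: "rels m n \<subseteq> {x \<in> gens m n. FI_eval m n x = 0}"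
proof -
  have "rat_vec.subspace {x \<in> gens m n. FI_eval m n x \<in> {0}}"
    by (rule subspace_preimage[OF lin_on_FI_eval subspace_gens rat_vec.subspace_single_0])
  then have "rat_vec.subspace {x \<in> gens m n. FI_eval m n x = 0}" by simp
  then show ?thesis
    unfolding free_FI_rels_def
    by (rule rat_vec.span_minimal[rotated]) (use rel_in_kernel(1,2) in blast)
qed

text \<open>Modulo the relations every element is supported on one morphism for each image \<open>T\<close>, and the
  functionals for \<open>T\<close> detect the coefficient of that morphism.\<close>

lemma kernel_rels:
  assumes x: "x \<in> gens m n" and zero: "FI_eval m n x = 0"
  shows "x \<in> rels m n"
proof -
  let ?K = "{1..m + 2}"
  \<comment> \<open>a reference morphism for each image \<open>T\<close>\<close>
  define e where "e T = (SOME p. p \<in> FI_hom 1 (m + 2) n \<and> fst p ` ?K = T)" for T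
  have e: "e (fst p ` ?K) \<in> FI_hom 1 (m + 2) n" "fst (e (fst p ` ?K)) ` ?K = fst p ` ?K"
    if "p \<in> FI_hom 1 (m + 2) n" for p
    using someI[of "\<lambda>q. q \<in> FI_hom 1 (m + 2) n \<and> fst q ` ?K = fst p ` ?K" p] that
    unfolding e_def by blast+
  have "\<exists>\<sigma>. \<sigma> permutes ?K \<and> p = FI_comp (m + 2) (m + 2) n (e (fst p ` ?K)) (FI_perm (m + 2) \<sigma>)"
    if "p \<in> FI_hom 1 (m + 2) n" for p
    using FI_hom_same_image[OF that e(1)[OF that] e(2)[OF that, symmetric]] by blast
  then obtain s where s: "\<And>p. p \<in> FI_hom 1 (m + 2) n \<Longrightarrow> s p permutes ?K"
    "\<And>p. p \<in> FI_hom 1 (m + 2) n \<Longrightarrow>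
      p = FI_comp (m + 2) (m + 2) n (e (fst p ` ?K)) (FI_perm (m + 2) (s p))" by metis
  define c where "c t = Poly_Mapping.single (m + 2, e (fst (snd t) ` ?K)) (hact (s (snd t)) (Poly_Mapping.lookup x t))"
    for t :: "nat \<times> fimor"
  \<comment> \<open>the normal form of \<open>x\<close>, supported on reference morphisms\<close>
  define y where "y = (\<Sum>t\<in>Poly_Mapping.keys x. c t)"
  have key: "snd t \<in> FI_hom 1 (m + 2) n" "Poly_Mapping.lookup x t \<in> gen_at m (m + 2)" "t = (m + 2, snd t)"
    if "t \<in> Poly_Mapping.keys x" for t
    using gensD[OF x, of "fst t" "snd t"] that by (auto simp: prod_eq_iff)
  have step: "Poly_Mapping.single t (Poly_Mapping.lookup x t) - c t \<in> rels m n"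
    if t: "t \<in> Poly_Mapping.keys x" for t
  proof -
    note k = key[OF t]
    have "Poly_Mapping.single (m + 2, FI_comp (m + 2) (m + 2) n (e (fst (snd t) ` ?K)) (FI_perm (m + 2) (s (snd t))))
        (Poly_Mapping.lookup x t) - c t \<in> rels m n"
      unfolding c_def by (rule rel_in_kernel(3)[OF e(1)[OF k(1)] s(1)[OF k(1)] k(2)])
    then show ?thesis unfolding s(2)[OF k(1), symmetric] using k(3) by metis
  qed
  have "x - y = (\<Sum>t\<in>Poly_Mapping.keys x. Poly_Mapping.single t (Poly_Mapping.lookup x t) - c t)"
    using poly_mapping_sum_single[of x] by (simp add: y_def sum_subtractf)
  then have xy: "x - y \<in> rels m n"
    using rat_vec.subspace_sum[OF subspace_rels step] by simp
  have cg: "c t \<in> gens m n" if "t \<in> Poly_Mapping.keys x" for t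
    unfolding c_def using key[OF that] by (intro single_gens e hact_gen_at s)
  then have y: "y \<in> gens m n" unfolding y_def by (rule rat_vec.subspace_sum[OF subspace_gens])
  have "FI_eval m n x - FI_eval m n y = FI_eval m n (x - y)"
    using lin_on_diff[OF lin_on_FI_eval subspace_gens x y] by simp
  moreover have "FI_eval m n (x - y) = 0" using subsetD[OF rels_kernel xy] by blast
  ultimately have y0: "FI_eval m n y = 0" using zero by simp
  have keys_y: "\<exists>p\<in>FI_hom 1 (m + 2) n. t = (m + 2, e (fst p ` ?K))" if "t \<in> Poly_Mapping.keys y" for t
  proof -
    have "Poly_Mapping.keys y \<subseteq> (\<Union>t\<in>Poly_Mapping.keys x. Poly_Mapping.keys (c t))"
      unfolding y_def by (rule Poly_Mapping.keys_sum)
    with \<open>t \<in> Poly_Mapping.keys y\<close> obtain t'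
      where "t' \<in> Poly_Mapping.keys x" "t \<in> Poly_Mapping.keys (c t')" by blast
    then show ?thesis using key(1)[of t'] by (auto simp: c_def split: if_splits)
  qed
  have "y = 0"
  proof (rule ccontr)
    assume "y \<noteq> 0"
    then obtain t where t: "t \<in> Poly_Mapping.keys y" by (metis all_not_in_conv keys_eq_empty)
    then obtain p where p: "p \<in> FI_hom 1 (m + 2) n" "t = (m + 2, e (fst p ` ?K))" using keys_y by blast
    define f where "f = fst (e (fst p ` ?K))"
    define u where "u = Poly_Mapping.lookup y t"
    have u: "u \<in> eta_span m (m + 2)" "u \<noteq> 0"
      using gensD(4)[OF y t[unfolded p(2)]] t by (auto simp: u_def p(2) in_keys_iff)
    note f = FI_homD(1,2)[OF e(1)[OF p(1)], folded f_def]
    have cf: "card (f ` ?K) = m + 2" using card_image[OF f(1)] by simp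
    have "u = 0"
    proof (rule eta_span_zero_by_theta[OF u(1)])
      fix a b c' assume abc: "distinct [a, b, c']" "{a, b, c'} \<subseteq> ?K"
      let ?\<theta> = "theta (f ` ?K) (f a) (f b) (f c')"
      have "0 = ?\<theta> (FI_eval m n y)" by (simp add: y0 theta_linear)
      also have "\<dots> = (\<Sum>r\<in>Poly_Mapping.keys y. ?\<theta> (FI_push m (fst r) n (snd r) (Poly_Mapping.lookup y r)))"
        unfolding FI_eval_def theta_sum by (simp add: case_prod_unfold)
      also have "\<dots> = (\<Sum>r\<in>Poly_Mapping.keys y. if r = t then theta ?K a b c' u else 0)"
      proof (rule sum.cong[OF refl])
        fix r assume r: "r \<in> Poly_Mapping.keys y"
        show "?\<theta> (FI_push m (fst r) n (snd r) (Poly_Mapping.lookup y r)) = (if r = t then theta ?K a b c' u else 0)"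
        proof (cases "r = t")
          case True
          then show ?thesis
            using theta_push(1)[OF f u(1) abc] by (simp add: FI_push_def p(2) f_def u_def)
        next
          case False
          obtain q where q: "q \<in> FI_hom 1 (m + 2) n" "r = (m + 2, e (fst q ` ?K))" using keys_y[OF r] by blast
          let ?g = "fst (e (fst q ` ?K))"
          have "fst q ` ?K \<noteq> fst p ` ?K" using False p(2) q(2) by auto
          then have ne: "f ` ?K \<noteq> ?g ` ?K" using e(2)[OF p(1)] e(2)[OF q(1)] by (simp add: f_def)
          have "Poly_Mapping.lookup y r \<in> eta_span m (m + 2)" using gensD(4)[OF y r[unfolded q(2)]] q(2) by simp
          from theta_push(2)[OF FI_homD(1,2)[OF e(1)[OF q(1)]] this f(2) cf ne, of "f a" "f b" "f c'"]
          show ?thesis using abc(2) False by (auto simp: FI_push_def q(2))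
        qed
      qed
      also have "\<dots> = theta ?K a b c' u" using t by simp
      finally show "theta ?K a b c' u = 0" by simp
    qed
    then show False using u(2) by simp
  qed
  then show ?thesis using xy by simp
qed

lemma FI_eval_image: "FI_eval m n ` gens m n = eta_span m n"
proof
  show "FI_eval m n ` gens m n \<subseteq> eta_span m n"
  proof (rule image_subsetI)
    fix x assume x: "x \<in> gens m n"
    show "FI_eval m n x \<in> eta_span m n"
      unfolding FI_eval_def
    proof (rule rat_vec.subspace_sum[OF subspace_eta_span], safe)
      fix k p assume "(k, p) \<in> Poly_Mapping.keys x"
      from FI_push_simps(1)[OF gensD(1)[OF x this] gensD(4)[OF x this]]
      show "FI_push m k n p (Poly_Mapping.lookup x (k, p)) \<in> eta_span m n" .
    qed
  qed
  show "eta_span m n \<subseteq> FI_eval m n ` gens m n"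
  proof (rule eta_span_subset)
    show "rat_vec.subspace (FI_eval m n ` gens m n)"
      by (rule subspace_image_lin_on[OF lin_on_FI_eval subspace_gens])
    fix T a b assume T: "T \<subseteq> {1..n}" "card T = m + 2" "a \<in> T" "b \<in> T"
    let ?K = "{1..m + 2}"
    have n: "m + 2 \<le> n" using card_mono[OF _ T(1)] T(2) by simp
    obtain \<sigma> where \<sigma>: "\<sigma> permutes {1..n}" "\<sigma> ` ?K = T" using ex_permutation_image[OF T(1,2) n] by metis
    obtain a' b' where ab: "a' \<in> ?K" "a = \<sigma> a'" "b' \<in> ?K" "b = \<sigma> b'"
      using T(3,4) unfolding \<sigma>(2)[symmetric] by blast
    define f where "f = restrict \<sigma> ?K"
    define p where "p = (f, restrict (\<lambda>_. 0 :: nat) ({1..n} - T))"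
    have im: "f ` ?K = T" unfolding f_def image_restrict_eq by (rule \<sigma>(2))
    have inj: "inj_on f ?K" unfolding f_def inj_on_restrict_eq by (rule permutes_inj_on[OF \<sigma>(1)])
    have "f \<in> ?K \<rightarrow>\<^sub>E {1..n}"
      unfolding f_def restrict_PiE_iff using \<sigma>(2) T(1) by blast
    moreover have "restrict (\<lambda>_. 0 :: nat) ({1..n} - T) \<in> ({1..n} - T) \<rightarrow>\<^sub>E {..<1}"
      unfolding restrict_PiE_iff by simp
    ultimately have p: "p \<in> FI_hom 1 (m + 2) n"
      unfolding p_def FI_hom_def mem_Collect_eq case_prod_conv im using inj by blast
    have e: "eta (m + 2) ?K a' b' \<in> eta_span m (m + 2)" using ab by (intro eta_in_eta_span) auto
    have "f ` ?K \<subseteq> {1..n}" using im T(1) by simp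
    from push_eta[OF inj this subset_refl _ ab(1,3)]
    have "push m n f (eta (m + 2) ?K a' b') = eta n T (f a') (f b')" unfolding im by simp
    moreover have "f a' = a" "f b' = b" using ab by (simp_all add: f_def)
    moreover have "fst p = f" by (simp add: p_def)
    ultimately have "FI_eval m n (Poly_Mapping.single (m + 2, p) (eta (m + 2) ?K a' b')) = eta n T a b"
      unfolding FI_eval_single[OF p] FI_push_def by simp
    moreover have "Poly_Mapping.single (m + 2, p) (eta (m + 2) ?K a' b') \<in> gens m n"
      using e by (intro single_gens[OF p]) (simp add: gen_at_def)
    ultimately show "eta n T a b \<in> FI_eval m n ` gens m n" by (metis image_eqI)
  qed
qed

lemma FI_eval_natural:
  assumes q: "q \<in> FI_hom 1 n n'" and x: "x \<in> gens m n"
  shows "free_FI_map n n' q x \<in> gens m n'"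
    "FI_eval m n' (free_FI_map n n' q x) = FI_push m n n' q (FI_eval m n x)"
proof -
  let ?g = "\<lambda>(k, p). Poly_Mapping.single (k, FI_comp k n n' q p) (Poly_Mapping.lookup x (k, p))"
  have g: "?g t \<in> gens m n' \<and> FI_eval m n' (?g t)
      = FI_push m n n' q (FI_push m (fst t) n (snd t) (Poly_Mapping.lookup x t))
      \<and> FI_push m (fst t) n (snd t) (Poly_Mapping.lookup x t) \<in> eta_span m n"
    if t: "t \<in> Poly_Mapping.keys x" for t
  proof -
    obtain k p where t': "t = (k, p)" by (cases t)
    note d = gensD[OF x t[unfolded t']]
    have c: "FI_comp k n n' q p \<in> FI_hom 1 k n'" by (rule FI_comp_hom[OF q d(1)])
    show ?thesis
      unfolding t' case_prod_conv fst_conv snd_conv FI_eval_single[OF c]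
      using single_gens[OF c d(2)] FI_push_comp[OF q d(1) d(4)] FI_push_simps(1)[OF d(1) d(4)] by blast
  qed
  have map: "free_FI_map n n' q x = (\<Sum>t\<in>Poly_Mapping.keys x. ?g t)"
    by (simp add: free_FI_map_def)
  show "free_FI_map n n' q x \<in> gens m n'"
    unfolding map using g by (intro rat_vec.subspace_sum[OF subspace_gens]) blast
  have "FI_eval m n' (free_FI_map n n' q x) = (\<Sum>t\<in>Poly_Mapping.keys x. FI_eval m n' (?g t))"
    unfolding map using g by (intro lin_on_sum[OF lin_on_FI_eval subspace_gens]) blast
  also have "\<dots> = (\<Sum>t\<in>Poly_Mapping.keys x.
      FI_push m n n' q (FI_push m (fst t) n (snd t) (Poly_Mapping.lookup x t)))"
    by (rule sum.cong[OF refl]) (use g in blast)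
  also have "\<dots> = FI_push m n n' q (\<Sum>t\<in>Poly_Mapping.keys x. FI_push m (fst t) n (snd t) (Poly_Mapping.lookup x t))"
    using g by (intro lin_on_sum[OF FI_push_simps(2)[OF q] subspace_eta_span, symmetric]) blast
  finally show "FI_eval m n' (free_FI_map n n' q x) = FI_push m n n' q (FI_eval m n x)"
    by (simp add: FI_eval_def case_prod_unfold)
qed

lemma FI_free_eta_span: "FI_free 1 (eta_span m) (FI_push m)"
proof -
  have "\<exists>\<phi>. quotient_iso (gens m n) (rels m n) \<phi> (eta_span m n)
      \<and> (\<forall>x\<in>gens m n. \<phi> (coset (rels m n) x) = FI_eval m n x)" for n
  proof -
    have sub: "rels m n \<subseteq> gens m n" using rels_kernel by blast
    have ker: "FI_eval m n x = 0 \<longleftrightarrow> x \<in> rels m n" if "x \<in> gens m n" for x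
      using rels_kernel kernel_rels[OF that] by blast
    show ?thesis
    proof (rule quotient_iso_of_linear[OF subspace_gens subspace_rels sub lin_on_FI_eval FI_eval_image])
      show "FI_eval m n x = 0 \<longleftrightarrow> x \<in> rels m n" if "x \<in> gens m n" for x by (rule ker[OF that])
    qed blast
  qed
  then obtain \<phi> where \<phi>: "\<And>n. quotient_iso (gens m n) (rels m n) (\<phi> n) (eta_span m n)"
    "\<And>n x. x \<in> gens m n \<Longrightarrow> \<phi> n (coset (rels m n) x) = FI_eval m n x" by metis
  have rep: "rep_on k (gen_at m k) hact" for k
    using gen_at_eta_span eta_span_Hcell hact_gen_at by (intro rep_on_hact[OF subspace_gen_at]) blast+
  show ?thesis
    unfolding FI_free_def
  proof (intro conjI exI allI ballI)
    show "FI_module 1 (eta_span m) (FI_push m)" by (rule FI_module_eta_span)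
    show "rep_on k (gen_at m k) hact" for k by (rule rep)
    show "quotient_iso (gens m n) (rels m n) (\<phi> n) (eta_span m n)" for n by (rule \<phi>(1))
    fix n n' q x assume q: "q \<in> FI_hom 1 n n'" and x: "x \<in> gens m n"
    show "\<phi> n' (coset (rels m n') (free_FI_map n n' q x)) = FI_push m n n' q (\<phi> n (coset (rels m n) x))"
      unfolding \<phi>(2)[OF x] \<phi>(2)[OF FI_eval_natural(1)[OF q x]] by (rule FI_eval_natural(2)[OF q x])
  qed
qed

lemma free_submodule_eta_span: "free_submodule 1 [1] (eta_span m)"
  unfolding free_submodule_def
proof (intro conjI exI)
  show "FI_closed 1 [1] (eta_span m)" by (rule FI_closed_eta_span)
  show "FI_action 1 [1] (eta_span m) (FI_push m)" by (rule FI_action_eta_span)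
  have "length [1 :: nat] = 1" by simp
  then show "FI_free (length [1 :: nat]) (eta_span m) (FI_push m)" using FI_free_eta_span by metis
qed

section \<open>The exterior square of the standard representation\<close>

lemma lookup_lin_ext:
  fixes f :: "'a \<Rightarrow> ('b \<Rightarrow>\<^sub>0 rat)"
  shows "Poly_Mapping.lookup (lin_ext f x) b
    = (\<Sum>a\<in>Poly_Mapping.keys x. Poly_Mapping.lookup x a * Poly_Mapping.lookup (f a) b)"
  by (simp add: lin_ext_def lookup_sum lookup_scaleQ scaleQ_rat_def)

lemma lookup_tensor: "Poly_Mapping.lookup (tensor v w) (a, b) = Poly_Mapping.lookup v a * Poly_Mapping.lookup w b"
proof -
  have w: "Poly_Mapping.lookup (lin_ext (\<lambda>j. basis_elt (i, j)) w) (a, b)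
      = (if i = a then Poly_Mapping.lookup w b else 0)" for i
  proof -
    have "Poly_Mapping.lookup (lin_ext (\<lambda>j. basis_elt (i, j)) w) (a, b)
        = (\<Sum>j\<in>Poly_Mapping.keys w. if j = b then (if i = a then Poly_Mapping.lookup w b else 0) else 0)"
      unfolding lookup_lin_ext by (rule sum.cong) (auto simp: lookup_basis_elt)
    then show ?thesis by (simp add: in_keys_iff)
  qed
  have "Poly_Mapping.lookup (tensor v w) (a, b)
      = (\<Sum>i\<in>Poly_Mapping.keys v. if i = a then Poly_Mapping.lookup v a * Poly_Mapping.lookup w b else 0)"
    unfolding tensor_def lookup_lin_ext[of _ v] by (rule sum.cong) (auto simp: w)
  then show ?thesis by (simp add: in_keys_iff)
qed

definition transpose_tensor :: "(nat \<times> nat \<Rightarrow>\<^sub>0 rat) \<Rightarrow> (nat \<times> nat \<Rightarrow>\<^sub>0 rat)" where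
  "transpose_tensor = lin_ext (\<lambda>(a, b). basis_elt (b, a))"

lemma lookup_transpose_tensor:
  "Poly_Mapping.lookup (transpose_tensor t) (a, b) = Poly_Mapping.lookup t (b, a)"
proof -
  have "Poly_Mapping.lookup (transpose_tensor t) (a, b)
      = (\<Sum>s\<in>Poly_Mapping.keys t. if s = (b, a) then Poly_Mapping.lookup t (b, a) else 0)"
    unfolding transpose_tensor_def lookup_lin_ext
    by (rule sum.cong) (auto simp: lookup_basis_elt split: if_splits)
  then show ?thesis by (simp add: in_keys_iff)
qed

lemma transpose_tensor_tensor: "transpose_tensor (tensor v w) = tensor w v"
proof (rule poly_mapping_eqI)
  fix s show "Poly_Mapping.lookup (transpose_tensor (tensor v w)) s = Poly_Mapping.lookup (tensor w v) s"
    by (cases s) (simp add: lookup_transpose_tensor lookup_tensor)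
qed

lemma subspace_Std: "rat_vec.subspace (Std N)"
proof -
  have eq: "Std N = {v. Poly_Mapping.keys v \<subseteq> {1..N}} \<inter> {v. (\<Sum>i\<in>{1..N}. Poly_Mapping.lookup v i) = 0}"
    by (auto simp: Std_def)
  have s: "rat_vec.subspace {v :: nat \<Rightarrow>\<^sub>0 rat. (\<Sum>i\<in>{1..N}. Poly_Mapping.lookup v i) = 0}"
    unfolding rat_vec.subspace_def
    by (simp add: lookup_add lookup_scaleQ scaleQ_rat_def sum.distrib sum_distrib_left[symmetric])
  show ?thesis unfolding eq by (rule rat_vec.subspace_inter[OF subspace_keys s])
qed

text \<open>All properties are linear in \<open>t\<close> and clear for \<open>v \<otimes> w\<close>; for the last one, \<open>v \<otimes> w + w \<otimes> v
  = (v + w) \<otimes> (v + w) - v \<otimes> v - w \<otimes> w\<close>.\<close>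

lemma Std_tensor_StdD:
  assumes "t \<in> Std_tensor_Std N"
  shows "Poly_Mapping.keys t \<subseteq> {1..N} \<times> {1..N}" "(\<Sum>b\<in>{1..N}. Poly_Mapping.lookup t (a, b)) = 0"
    "(\<Sum>b\<in>{1..N}. Poly_Mapping.lookup t (b, a)) = 0"
    "t + transpose_tensor t \<in> alternating_relations N"
proof -
  let ?Q = "{t. (\<forall>a. (\<Sum>b\<in>{1..N}. Poly_Mapping.lookup t (a, b)) = 0)
    \<and> (\<forall>a. (\<Sum>b\<in>{1..N}. Poly_Mapping.lookup t (b, a)) = 0) \<and> t + transpose_tensor t \<in> alternating_relations N}"
  let ?P = "{t. Poly_Mapping.keys t \<subseteq> {1..N} \<times> {1..N}} \<inter> ?Q"
  have alt: "rat_vec.subspace (alternating_relations N)"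
    unfolding alternating_relations_def by (rule rat_vec.subspace_span)
  have "rat_vec.subspace ?Q"
    unfolding rat_vec.subspace_def mem_Collect_eq
  proof (intro conjI ballI allI)
    fix x y :: "nat \<times> nat \<Rightarrow>\<^sub>0 rat"
    assume "x \<in> ?Q"
      "y \<in> ?Q"
    then have "(x + transpose_tensor x) + (y + transpose_tensor y) \<in> alternating_relations N"
      using rat_vec.subspace_add[OF alt] by blast
    then show "x + y + transpose_tensor (x + y) \<in> alternating_relations N"
      by (simp add: transpose_tensor_def lin_ext_add add_ac)
  next
    fix c and x :: "nat \<times> nat \<Rightarrow>\<^sub>0 rat"
    assume "x \<in> ?Q"
    then have "c *\<^sub>Q (x + transpose_tensor x) \<in> alternating_relations N"
      using rat_vec.subspace_scale[OF alt] by blast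
    then show "c *\<^sub>Q x + transpose_tensor (c *\<^sub>Q x) \<in> alternating_relations N"
      by (simp add: transpose_tensor_def lin_ext_scale scaleQ_add_right)
  qed (simp_all add: lookup_add lookup_scaleQ scaleQ_rat_def sum.distrib sum_distrib_left[symmetric]
      transpose_tensor_def rat_vec.subspace_0[OF alt])
  then have sub: "rat_vec.subspace ?P" by (rule rat_vec.subspace_inter[OF subspace_keys])
  have "tensor v w \<in> ?P" if v: "v \<in> Std N" and w: "w \<in> Std N" for v w
  proof (intro IntI CollectI conjI allI)
    show "Poly_Mapping.keys (tensor v w) \<subseteq> {1..N} \<times> {1..N}"
    proof
      fix s assume "s \<in> Poly_Mapping.keys (tensor v w)"
      then have "fst s \<in> Poly_Mapping.keys v \<and> snd s \<in> Poly_Mapping.keys w"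
        by (cases s) (auto simp: in_keys_iff lookup_tensor)
      moreover have "Poly_Mapping.keys v \<subseteq> {1..N}" "Poly_Mapping.keys w \<subseteq> {1..N}"
        using v w by (simp_all add: Std_def)
      ultimately show "s \<in> {1..N} \<times> {1..N}" unfolding mem_Times_iff by blast
    qed
    show "(\<Sum>b\<in>{1..N}. Poly_Mapping.lookup (tensor v w) (a, b)) = 0" for a
      using w by (simp add: lookup_tensor sum_distrib_left[symmetric] Std_def)
    show "(\<Sum>b\<in>{1..N}. Poly_Mapping.lookup (tensor v w) (b, a)) = 0" for a
      using v by (simp add: lookup_tensor sum_distrib_right[symmetric] Std_def)
    have "tensor (v + w) (v + w) - tensor v v - tensor w w \<in> alternating_relations N"
      unfolding alternating_relations_def using v w rat_vec.subspace_add[OF subspace_Std v w]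
      by (intro rat_vec.span_diff rat_vec.span_base) blast+
    moreover have "tensor v w + tensor w v = tensor (v + w) (v + w) - tensor v v - tensor w w"
    proof (rule poly_mapping_eqI)
      fix s show "Poly_Mapping.lookup (tensor v w + tensor w v) s
          = Poly_Mapping.lookup (tensor (v + w) (v + w) - tensor v v - tensor w w) s"
        by (cases s) (simp add: lookup_tensor lookup_add lookup_minus algebra_simps)
    qed
    ultimately show "tensor v w + transpose_tensor (tensor v w) \<in> alternating_relations N"
      by (simp add: transpose_tensor_tensor)
  qed
  then have "Std_tensor_Std N \<subseteq> ?P"
    unfolding Std_tensor_Std_def by (intro rat_vec.span_minimal[OF _ sub]) blast
  with assms have P: "t \<in> ?P" by (rule subsetD[rotated])
  show "Poly_Mapping.keys t \<subseteq> {1..N} \<times> {1..N}" "(\<Sum>b\<in>{1..N}. Poly_Mapping.lookup t (a, b)) = 0"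
    "(\<Sum>b\<in>{1..N}. Poly_Mapping.lookup t (b, a)) = 0"
    "t + transpose_tensor t \<in> alternating_relations N" using P by blast+
qed

lemma subspace_Std_tensor_Std: "rat_vec.subspace (Std_tensor_Std N)"
  unfolding Std_tensor_Std_def by (rule rat_vec.subspace_span)

lemma subspace_alternating_relations: "rat_vec.subspace (alternating_relations N)"
  unfolding alternating_relations_def by (rule rat_vec.subspace_span)

lemma alternating_relations_subset: "alternating_relations N \<subseteq> Std_tensor_Std N"
  unfolding alternating_relations_def Std_tensor_Std_def by (rule rat_vec.span_mono) blast

lemma tensor_act_Std:
  assumes "\<sigma> permutes {1..N}" "t \<in> Std_tensor_Std N"
  shows "tensor_act \<sigma> t \<in> Std_tensor_Std N"
proof -
  have "rat_vec.subspace {t. tensor_act \<sigma> t \<in> Std_tensor_Std N}"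
    using rat_vec.subspace_0[OF subspace_Std_tensor_Std] rat_vec.subspace_add[OF subspace_Std_tensor_Std]
      rat_vec.subspace_scale[OF subspace_Std_tensor_Std]
    by (simp add: rat_vec.subspace_def tensor_act_def lin_ext_add lin_ext_scale)
  moreover have "tensor v w \<in> {t. tensor_act \<sigma> t \<in> Std_tensor_Std N}" if vw: "v \<in> Std N" "w \<in> Std N" for v w
  proof -
    let ?s = "\<lambda>v. lin_ext (\<lambda>i. basis_elt (\<sigma> i)) v :: nat \<Rightarrow>\<^sub>0 rat"
    have "?s v \<in> Std N" if v: "v \<in> Std N" for v
    proof -
      have look: "Poly_Mapping.lookup (?s v) (\<sigma> j) = Poly_Mapping.lookup v j" for j
      proof -
        have "Poly_Mapping.lookup (?s v) (\<sigma> j)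
            = (\<Sum>i\<in>Poly_Mapping.keys v. if i = j then Poly_Mapping.lookup v j else 0)"
          unfolding lookup_lin_ext
          by (rule sum.cong) (auto simp: lookup_basis_elt inj_eq[OF permutes_inj[OF assms(1)]])
        then show ?thesis by (simp add: in_keys_iff)
      qed
      have "(\<Sum>i\<in>{1..N}. Poly_Mapping.lookup (?s v) i) = (\<Sum>i\<in>{1..N}. Poly_Mapping.lookup v i)"
        using sum.permute[OF assms(1), of "Poly_Mapping.lookup (?s v)"] by (simp add: look o_def)
      moreover have "Poly_Mapping.keys (?s v) \<subseteq> {1..N}"
      proof
        fix k assume "k \<in> Poly_Mapping.keys (?s v)"
        moreover obtain j where j: "k = \<sigma> j" using permutes_surj[OF assms(1)] by (metis surjD)
        ultimately have "j \<in> {1..N}" using v look by (auto simp: in_keys_iff Std_def subset_eq)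
        then show "k \<in> {1..N}" unfolding j using permutes_in_image[OF assms(1)] by blast
      qed
      ultimately show ?thesis using v by (simp add: Std_def)
    qed
    then have "tensor (?s v) (?s w) \<in> Std_tensor_Std N"
      unfolding Std_tensor_Std_def using vw by (intro rat_vec.span_base) blast
    moreover have "tensor_act \<sigma> (tensor v w) = tensor (?s v) (?s w)"
      by (simp add: tensor_act_def tensor_def lin_ext_lin_ext)
    ultimately show ?thesis by simp
  qed
  ultimately have "Std_tensor_Std N \<subseteq> {t. tensor_act \<sigma> t \<in> Std_tensor_Std N}"
    unfolding Std_tensor_Std_def[of N] by (intro rat_vec.span_minimal) (auto simp: Std_tensor_Std_def)
  then show ?thesis using assms(2) by blast
qed

definition wedge_to_eta :: "nat \<Rightarrow> (nat \<times> nat \<Rightarrow>\<^sub>0 rat) \<Rightarrow> homology" where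
  "wedge_to_eta N = lin_ext (\<lambda>(a, b). eta N {1..N} a b)"

lemma wedge_to_eta_transpose:
  assumes "Poly_Mapping.keys t \<subseteq> {1..N} \<times> {1..N}"
  shows "wedge_to_eta N (transpose_tensor t) = - wedge_to_eta N t"
proof -
  have "wedge_to_eta N (transpose_tensor t) = lin_ext (\<lambda>(a, b). eta N {1..N} b a) t"
    by (simp add: wedge_to_eta_def transpose_tensor_def lin_ext_lin_ext case_prod_unfold)
  also have "\<dots> = lin_ext (\<lambda>s. (- 1) *\<^sub>Q (\<lambda>(a, b). eta N {1..N} a b) s) t"
  proof (rule lin_ext_cong)
    fix s assume "s \<in> Poly_Mapping.keys t"
    moreover obtain a b where "s = (a, b)" by (cases s)
    ultimately have s: "s = (a, b)" "a \<in> {1..N}" "b \<in> {1..N}" using assms by blast+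
    show "(case s of (a, b) \<Rightarrow> eta N {1..N} b a) = (- 1) *\<^sub>Q (\<lambda>(a, b). eta N {1..N} a b) s"
      using eta_swap[OF subset_refl s(2,3)] by (simp add: s(1))
  qed
  also have "\<dots> = - wedge_to_eta N t"
    by (simp add: wedge_to_eta_def lin_ext_def sum_negf)
  finally show ?thesis .
qed

text \<open>Symmetric tensors go to zero, because \<open>eta\<close> is alternating. Conversely the functionals
  \<open>theta\<close> show for the antisymmetric part \<open>u\<close> of a tensor in the kernel that \<open>u p q + u q r + u
  r p = 0\<close>. Sum over \<open>r\<close>: the row and column sums of a tensor of standard vectors vanish, so \<open>N
  u p q = 0\<close>. Thus the tensor is symmetric, and half the sum of it and its transpose is an
  alternating relation.\<close>

lemma wedge_to_eta_kernel:
  assumes N: "3 \<le> N" and t: "t \<in> Std_tensor_Std N"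
  shows "wedge_to_eta N t = 0 \<longleftrightarrow> t \<in> alternating_relations N"
proof
  assume t': "t \<in> alternating_relations N"
  have sub: "rat_vec.subspace {t. wedge_to_eta N t = 0}"
    by (simp add: rat_vec.subspace_def wedge_to_eta_def lin_ext_add lin_ext_scale)
  have "tensor v v \<in> {t. wedge_to_eta N t = 0}" if v: "v \<in> Std N" for v
  proof -
    have "tensor v v \<in> Std_tensor_Std N"
      unfolding Std_tensor_Std_def using v by (intro rat_vec.span_base) blast
    from wedge_to_eta_transpose[OF Std_tensor_StdD(1)[OF this]]
    have "2 *\<^sub>Q wedge_to_eta N (tensor v v) = 0"
      using scaleQ_add_left[of 1 1 "wedge_to_eta N (tensor v v)"]
      by (simp add: transpose_tensor_tensor eq_neg_iff_add_eq_0)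
    then show ?thesis by simp
  qed
  then have "alternating_relations N \<subseteq> {t. wedge_to_eta N t = 0}"
    unfolding alternating_relations_def by (intro rat_vec.span_minimal[OF _ sub]) blast
  then show "wedge_to_eta N t = 0" using t' by blast
next
  assume zero: "wedge_to_eta N t = 0"
  note S = Std_tensor_StdD[OF t]
  let ?T = "{1..N}"
  define u where "u p q = Poly_Mapping.lookup t (p, q) - Poly_Mapping.lookup t (q, p)" for p q
  have altsum: "(\<Sum>(a, b)\<in>Poly_Mapping.keys t. Poly_Mapping.lookup t (a, b) * alt2 a b p q) = u p q" for p q
  proof -
    have "(\<Sum>(a, b)\<in>Poly_Mapping.keys t. Poly_Mapping.lookup t (a, b) * alt2 a b p q)
        = (\<Sum>s\<in>Poly_Mapping.keys t. (if s = (p, q) then Poly_Mapping.lookup t (p, q) else 0)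
          - (if s = (q, p) then Poly_Mapping.lookup t (q, p) else 0))"
    proof (rule sum.cong[OF refl])
      fix s :: "nat \<times> nat"
      obtain a b where s: "s = (a, b)" by (cases s)
      have e: "(if (a, b) = (x, y) then Poly_Mapping.lookup t (x, y) else 0)
          = Poly_Mapping.lookup t (a, b) * (if a = x \<and> b = y then 1 else 0)" for x y
        by simp
      show "(case s of (a, b) \<Rightarrow> Poly_Mapping.lookup t (a, b) * alt2 a b p q)
        = (if s = (p, q) then Poly_Mapping.lookup t (p, q) else 0)
          - (if s = (q, p) then Poly_Mapping.lookup t (q, p) else 0)"
        unfolding s e case_prod_conv alt2_def right_diff_distrib ..
    qed
    also have "\<dots> = u p q"
      unfolding sum_subtractf u_def by (simp add: in_keys_iff)
    finally show ?thesis .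
  qed
  have three: "u p q + u q r + u r p = 0" if pqr: "p \<in> ?T" "q \<in> ?T" "r \<in> ?T" "p \<noteq> q" for p q r
  proof (cases "r = p \<or> r = q")
    case True
    then show ?thesis by (auto simp: u_def)
  next
    case False
    let ?k = "- ((- 1) ^ card ?T) * (of_nat (card ?T) :: rat)"
    have "0 = theta ?T p q r (wedge_to_eta N t)" by (simp add: zero theta_linear)
    also have "\<dots> = (\<Sum>(a, b)\<in>Poly_Mapping.keys t. Poly_Mapping.lookup t (a, b) * theta ?T p q r (eta N ?T a b))"
      by (simp add: wedge_to_eta_def lin_ext_def theta_sum theta_linear case_prod_unfold)
    also have "\<dots> = (\<Sum>s\<in>Poly_Mapping.keys t. ?k *
        ((case s of (a, b) \<Rightarrow> Poly_Mapping.lookup t (a, b) * alt2 a b p q)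
         + (case s of (a, b) \<Rightarrow> Poly_Mapping.lookup t (a, b) * alt2 a b q r)
         + (case s of (a, b) \<Rightarrow> Poly_Mapping.lookup t (a, b) * alt2 a b r p)))"
    proof (rule sum.cong[OF refl])
      fix s assume "s \<in> Poly_Mapping.keys t"
      moreover obtain a b where "s = (a, b)" by (cases s)
      ultimately have s: "s = (a, b)" "a \<in> ?T" "b \<in> ?T" using S(1) by blast+
      have d: "distinct [p, q, r]" using pqr(4) False by auto
      show "(case s of (a, b) \<Rightarrow> Poly_Mapping.lookup t (a, b) * theta ?T p q r (eta N ?T a b)) = ?k *
        ((case s of (a, b) \<Rightarrow> Poly_Mapping.lookup t (a, b) * alt2 a b p q)
         + (case s of (a, b) \<Rightarrow> Poly_Mapping.lookup t (a, b) * alt2 a b q r)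
         + (case s of (a, b) \<Rightarrow> Poly_Mapping.lookup t (a, b) * alt2 a b r p))"
        unfolding s(1) case_prod_conv theta_eta[OF subset_refl s(2,3) pqr(1-3) d]
        by (simp only: distrib_left mult_ac)
    qed
    also have "\<dots> = ?k * (u p q + u q r + u r p)"
      unfolding sum_distrib_left[symmetric] sum.distrib altsum ..
    finally show ?thesis using N by simp
  qed
  have "u p q = 0" if pq: "p \<in> ?T" "q \<in> ?T" "p \<noteq> q" for p q
  proof -
    have "0 = (\<Sum>r\<in>?T. u p q + u q r + u r p)"
      using three[OF pq(1,2) _ pq(3)] by (intro sum.neutral[symmetric]) blast
    also have "\<dots> = of_nat N * u p q" using S(2,3) by (simp add: sum.distrib u_def sum_subtractf)
    finally show ?thesis using N by simp
  qed
  then have sym: "Poly_Mapping.lookup t (p, q) = Poly_Mapping.lookup t (q, p)" for p q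
  proof (cases "p \<in> ?T \<and> q \<in> ?T \<and> p \<noteq> q")
    case True
    then have "u p q = 0" using \<open>\<And>p q. p \<in> ?T \<Longrightarrow> q \<in> ?T \<Longrightarrow> p \<noteq> q \<Longrightarrow> u p q = 0\<close> by blast
    then show ?thesis by (simp add: u_def)
  next
    case False
    then consider "p = q" | "(p, q) \<notin> Poly_Mapping.keys t" "(q, p) \<notin> Poly_Mapping.keys t" using S(1) by blast
    then show ?thesis by cases (simp_all add: in_keys_iff)
  qed
  have "transpose_tensor t = t"
  proof (rule poly_mapping_eqI)
    fix s show "Poly_Mapping.lookup (transpose_tensor t) s = Poly_Mapping.lookup t s"
      by (cases s) (simp add: lookup_transpose_tensor sym)
  qed
  then have "(1 / 2) *\<^sub>Q (t + t) \<in> alternating_relations N"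
    using S(4) rat_vec.subspace_scale[OF subspace_alternating_relations] by metis
  moreover have "(1 / 2) *\<^sub>Q (t + t) = t"
    using scaleQ_add_left[of "1 / 2" "1 / 2" t] by (simp add: scaleQ_add_right)
  ultimately show "t \<in> alternating_relations N" by simp
qed

text \<open>The vector \<open>v c\<close> below is \<open>N\<close> times the projection of the label \<open>c\<close> to the standard
  representation; the multiples of the sum \<open>e\<close> of all labels do not contribute, because \<open>eta\<close>
  vanishes on \<open>e\<close>.\<close>

lemma wedge_to_eta_image:
  assumes N: "N = m + 2"
  shows "wedge_to_eta N ` Std_tensor_Std N = eta_span m N"
proof
  let ?T = "{1..N}"
  show "wedge_to_eta N ` Std_tensor_Std N \<subseteq> eta_span m N"
  proof (rule image_subsetI)
    fix t assume t: "t \<in> Std_tensor_Std N"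
    show "wedge_to_eta N t \<in> eta_span m N"
      unfolding wedge_to_eta_def lin_ext_def
    proof (intro rat_vec.subspace_sum[OF subspace_eta_span] rat_vec.subspace_scale[OF subspace_eta_span])
      fix s assume "s \<in> Poly_Mapping.keys t"
      moreover obtain a b where "s = (a, b)" by (cases s)
      ultimately have s: "s = (a, b)" "a \<in> ?T" "b \<in> ?T" using Std_tensor_StdD(1)[OF t] by blast+
      show "(case s of (a, b) \<Rightarrow> eta N ?T a b) \<in> eta_span m N"
        unfolding s(1) case_prod_conv by (rule eta_in_eta_span[OF subset_refl _ s(2,3)]) (simp add: N)
    qed
  qed
  have sub: "rat_vec.subspace (wedge_to_eta N ` Std_tensor_Std N)"
    by (rule subspace_image_lin_on[OF _ subspace_Std_tensor_Std])
      (simp add: lin_on_def wedge_to_eta_def lin_ext_add lin_ext_scale)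
  show "eta_span m N \<subseteq> wedge_to_eta N ` Std_tensor_Std N"
  proof (rule eta_span_subset[OF sub])
    fix T a b assume T: "T \<subseteq> ?T" "card T = m + 2" "a \<in> T" "b \<in> T"
    have TK: "T = ?T" by (rule card_subset_eq) (use T N in auto)
    define v where "v c = of_nat N *\<^sub>Q basis_elt c - (\<Sum>i\<in>?T. basis_elt i :: nat \<Rightarrow>\<^sub>0 rat)" for c
    have lv: "Poly_Mapping.lookup (v c) i = (if i = c then of_nat N else 0) - (if i \<in> ?T then 1 else 0)" for c i
      by (auto simp: v_def lookup_minus lookup_scaleQ lookup_sum lookup_basis_elt scaleQ_rat_def)
    have v: "v c \<in> Std N" if "c \<in> ?T" for c
    proof -
      have "Poly_Mapping.keys (v c) \<subseteq> ?T"
      proof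
        fix i assume "i \<in> Poly_Mapping.keys (v c)"
        then show "i \<in> ?T" using that unfolding in_keys_iff lv by (metis diff_zero)
      qed
      moreover have "(\<Sum>i\<in>?T. Poly_Mapping.lookup (v c) i) = 0"
        unfolding lv sum_subtractf using that by simp
      ultimately show ?thesis by (simp add: Std_def)
    qed
    have lin: "lin_ext f (v c) = of_nat N *\<^sub>Q f c - (\<Sum>i\<in>?T. f i)" for f :: "nat \<Rightarrow> homology" and c
      by (simp add: v_def lin_ext_diff lin_ext_scale lin_ext_sum)
    have row: "(\<Sum>j\<in>?T. eta N ?T i j) = 0" if "i \<in> ?T" for i
      by (rule sum_eta_zero[OF subset_refl that])
    have col: "(\<Sum>i\<in>?T. eta N ?T i j) = 0" if "j \<in> ?T" for j
    proof -
      have "(\<Sum>i\<in>?T. eta N ?T i j) = (\<Sum>i\<in>?T. - eta N ?T j i)"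
        by (rule sum.cong[OF refl]) (rule eta_swap[OF subset_refl that])
      then show ?thesis using row[OF that] by (simp add: sum_negf)
    qed
    have double: "(\<Sum>i\<in>?T. \<Sum>j\<in>?T. eta N ?T i j) = 0"
      by (rule sum.neutral) (use row in blast)
    have ab: "a \<in> ?T" "b \<in> ?T" using T TK by blast+
    have "wedge_to_eta N (tensor (v a) (v b)) = lin_ext (\<lambda>i. lin_ext (\<lambda>j. eta N ?T i j) (v b)) (v a)"
      by (simp add: wedge_to_eta_def tensor_def lin_ext_lin_ext)
    also have "\<dots> = of_nat N *\<^sub>Q (of_nat N *\<^sub>Q eta N ?T a b - (\<Sum>j\<in>?T. eta N ?T a j))
        - (\<Sum>i\<in>?T. of_nat N *\<^sub>Q eta N ?T i b - (\<Sum>j\<in>?T. eta N ?T i j))"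
      unfolding lin ..
    also have "\<dots> = of_nat N *\<^sub>Q of_nat N *\<^sub>Q eta N ?T a b"
      unfolding row[OF ab(1)] sum_subtractf rat_vec.scale_sum_right[symmetric] col[OF ab(2)] double
      by (simp only: diff_zero rat_vec.scale_zero_right)
    finally have e: "wedge_to_eta N (tensor (v a) (v b)) = of_nat N *\<^sub>Q of_nat N *\<^sub>Q eta N ?T a b" .
    have "tensor (v a) (v b) \<in> Std_tensor_Std N"
      unfolding Std_tensor_Std_def using v ab by (intro rat_vec.span_base) blast
    then have "of_nat N *\<^sub>Q of_nat N *\<^sub>Q eta N ?T a b \<in> wedge_to_eta N ` Std_tensor_Std N"
      unfolding e[symmetric] by (rule imageI)
    then have "inverse (of_nat N * of_nat N) *\<^sub>Q (of_nat N *\<^sub>Q of_nat N *\<^sub>Q eta N ?T a b)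
        \<in> wedge_to_eta N ` Std_tensor_Std N" by (rule rat_vec.subspace_scale[OF sub])
    moreover have "of_nat N * of_nat N \<noteq> (0 :: rat)" using N by simp
    ultimately show "eta N T a b \<in> wedge_to_eta N ` Std_tensor_Std N"
      unfolding TK scaleQ_scaleQ by (metis left_inverse mult.assoc scaleQ_one)
  qed
qed

lemma iso_Ext2_eta_span:
  assumes "1 \<le> m"
  shows "iso_Ext2_Std (m + 2) (eta_span m (m + 2)) hact"
proof -
  let ?N = "m + 2"
  have lin: "lin_on (Std_tensor_Std ?N) (wedge_to_eta ?N)"
    by (simp add: lin_on_def wedge_to_eta_def lin_ext_add lin_ext_scale)
  have N: "3 \<le> ?N" using assms by simp
  have "\<exists>\<psi>. quotient_iso (Std_tensor_Std ?N) (alternating_relations ?N) \<psi> (eta_span m ?N)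
      \<and> (\<forall>t\<in>Std_tensor_Std ?N. \<psi> (coset (alternating_relations ?N) t) = wedge_to_eta ?N t)"
  proof (rule quotient_iso_of_linear[OF subspace_Std_tensor_Std subspace_alternating_relations
        alternating_relations_subset lin wedge_to_eta_image[OF refl]])
    show "wedge_to_eta ?N t = 0 \<longleftrightarrow> t \<in> alternating_relations ?N" if "t \<in> Std_tensor_Std ?N" for t
      by (rule wedge_to_eta_kernel[OF N that])
  qed blast
  then obtain \<psi> where \<psi>: "quotient_iso (Std_tensor_Std ?N) (alternating_relations ?N) \<psi> (eta_span m ?N)"
    "\<And>t. t \<in> Std_tensor_Std ?N \<Longrightarrow> \<psi> (coset (alternating_relations ?N) t) = wedge_to_eta ?N t" by blast
  have equiv: "wedge_to_eta ?N (tensor_act \<sigma> t) = hact \<sigma> (wedge_to_eta ?N t)"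
    if \<sigma>: "\<sigma> permutes {1..?N}" and t: "t \<in> Std_tensor_Std ?N" for \<sigma> t
  proof -
    have "wedge_to_eta ?N (tensor_act \<sigma> t) = lin_ext (\<lambda>(a, b). eta ?N {1..?N} (\<sigma> a) (\<sigma> b)) t"
      by (simp add: wedge_to_eta_def tensor_act_def lin_ext_lin_ext case_prod_unfold)
    also have "\<dots> = lin_ext (\<lambda>s. hact \<sigma> (case s of (a, b) \<Rightarrow> eta ?N {1..?N} a b)) t"
    proof (rule lin_ext_cong)
      fix s assume "s \<in> Poly_Mapping.keys t"
      moreover obtain a b where "s = (a, b)" by (cases s)
      ultimately have s: "s = (a, b)" "a \<in> {1..?N}" "b \<in> {1..?N}" using Std_tensor_StdD(1)[OF t] by blast+
      show "(case s of (a, b) \<Rightarrow> eta ?N {1..?N} (\<sigma> a) (\<sigma> b)) = hact \<sigma> (case s of (a, b) \<Rightarrow> eta ?N {1..?N} a b)"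
        unfolding s(1) case_prod_conv hact_eta[OF subset_refl s(2,3) \<sigma>] permutes_image[OF \<sigma>] ..
    qed
    also have "\<dots> = hact \<sigma> (wedge_to_eta ?N t)"
      by (simp add: wedge_to_eta_def lin_ext_def hact_sum hact_linear)
    finally show ?thesis .
  qed
  show ?thesis
    unfolding iso_Ext2_Std_def
    using \<psi> equiv tensor_act_Std by (intro exI[of _ \<psi>]) simp
qed

section \<open>The structure of homology in degree one\<close>

lemma new_basis_Hcell: "new_basis n m \<subseteq> Hcell 1 n"
  using rat_vec.span_superset[of "new_basis n m"] eta_span_Hcell unfolding span_new_basis by blast

theorem theorem4p9:
  shows "\<exists>A' :: nat \<Rightarrow> nat \<Rightarrow> homology set.
    \<forall>n m. 3 \<le> n \<and> 1 \<le> m \<and> m \<le> n - 2 \<longrightarrow>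
      (finite (A' n m) \<and> A' n m \<subseteq> Hcell 1 n)
    \<and> (rat_vec.independent (A' n m) \<and> card (A' n m) = card (setA n m))
    \<and> rat_vec.span (setB n 0 \<union> (\<Union>l\<in>{1..m}. A' n l \<union> setB n l))
        = rat_vec.span (setB n 0 \<union> (\<Union>l\<in>{1..m}. setA n l \<union> setB n l))
    \<and> (rat_vec.span (A' n m) = generated 1 [1] (m + 2) (rat_vec.span (A' (m + 2) m)) n
        \<and> free_submodule 1 [1] (generated 1 [1] (m + 2) (rat_vec.span (A' (m + 2) m))))
    \<and> (rep_on (m + 2) (rat_vec.span (A' (m + 2) m)) hact
        \<and> iso_Ext2_Std (m + 2) (rat_vec.span (A' (m + 2) m)) hact
        \<and> rat_vec.span (A' (m + 2) m) \<subseteq> generated 1 [0] 3 (rat_vec.span (A' 3 1)) (m + 2))"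
proof (intro exI[of _ new_basis] allI impI)
  fix n m :: nat assume "3 \<le> n \<and> 1 \<le> m \<and> m \<le> n - 2"
  then have m: "m + 2 \<le> n" "1 \<le> m" by auto
  show "(finite (new_basis n m) \<and> new_basis n m \<subseteq> Hcell 1 n)
    \<and> (rat_vec.independent (new_basis n m) \<and> card (new_basis n m) = card (setA n m))
    \<and> rat_vec.span (setB n 0 \<union> (\<Union>l\<in>{1..m}. new_basis n l \<union> setB n l))
        = rat_vec.span (setB n 0 \<union> (\<Union>l\<in>{1..m}. setA n l \<union> setB n l))
    \<and> (rat_vec.span (new_basis n m) = generated 1 [1] (m + 2) (rat_vec.span (new_basis (m + 2) m)) n
        \<and> free_submodule 1 [1] (generated 1 [1] (m + 2) (rat_vec.span (new_basis (m + 2) m))))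
    \<and> (rep_on (m + 2) (rat_vec.span (new_basis (m + 2) m)) hact
        \<and> iso_Ext2_Std (m + 2) (rat_vec.span (new_basis (m + 2) m)) hact
        \<and> rat_vec.span (new_basis (m + 2) m) \<subseteq> generated 1 [0] 3 (rat_vec.span (new_basis 3 1)) (m + 2))"
    unfolding span_new_basis generated_eta_span span_setA_setB[OF m(1)] span_new_basis_setB[OF m(1)]
  proof (intro conjI refl)
    show "finite (new_basis n m)" unfolding new_basis_def using finite_new_index by (rule finite_imageI)
    show "new_basis n m \<subseteq> Hcell 1 n" by (rule new_basis_Hcell)
    show "rat_vec.independent (new_basis n m)" by (rule new_basis_independent)
    show "card (new_basis n m) = card (setA n m)" by (rule card_new_basis[OF m])
    show "free_submodule 1 [1] (eta_span m)" by (rule free_submodule_eta_span)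
    show "rep_on (m + 2) (eta_span m (m + 2)) hact" by (rule rep_on_eta_span)
    show "iso_Ext2_Std (m + 2) (eta_span m (m + 2)) hact" by (rule iso_Ext2_eta_span[OF m(2)])
    show "eta_span m (m + 2) \<subseteq> generated 1 [0] 3 (eta_span 1 3) (m + 2)"
      by (rule eta_span_sub_generated_0[OF m(2)])
  qed
qed

end
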